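(* Let $\vartheta\in\mathcal V$ be (continuously differentiable and) regularly varying at infinity with index $\alpha:=\partial\vartheta>0$, and let $\varphi=\iota[\vartheta]:\mathbb N\to\mathbb R$ be the completely additive function induced by $\vartheta$, i.e. $\varphi(k)=\sum_{p\text{ prime}}\alpha_p(k)\,\vartheta(\log p)$. For $n\ge 1$ let $H_n$ be a random variable with the harmonic distribution on $\{1,\dots,n\}$. Then, as $n\to\infty$, the random variables $$\frac{\varphi(H_n)}{\vartheta(\log n)}$$ (defined for all sufficiently large $n$) converge in law to the conditional distribution $$\mathcal L\Big(\int_{\mathcal X}x^{\alpha}\,\eta(ds,dx)\ \Big|\ \int_{\mathcal X}x\,\eta(ds,dx)\le 1\Big),$$ that is, to the law of $\int_{\mathcal X}x^{\alpha}\,\eta(ds,dx)$ conditioned on the event $\{\int_{\mathcal X}x\,\eta(ds,dx)\le 1\}$.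
   Context: Here $\mathbb N=\{1,2,\dots\}$ and $\mathbb R_+=(0,\infty)$. Harmonic distribution: $\mathbb P[H_n=k]=\frac{1}{kL_n}$ for $k\in\{1,\dots,n\}$, where $L_n=\sum_{k=1}^n k^{-1}$. Completely additive functions: $\varphi:\mathbb N\to\mathbb R$ is completely additive if $\varphi(ab)=\varphi(a)+\varphi(b)$ for all positive integers $a,b$. For a prime $p$, $\alpha_p(k)=\max\{m\ge 0: p^m\mid k\}$ is the $p$-adic valuation. Given $\vartheta:\mathbb R_+\to\mathbb R$, the induced completely additive function $\iota[\vartheta]:\mathbb N\to\mathbb R$ is the one with $\iota[\vartheta](p)=\vartheta(\log p)$ for every prime $p$, i.e. $\iota[\vartheta](k)=\sum_{p}\alpha_p(k)\vartheta(\log p)$. The class $\mathcal V$: the collection of continuously differentiable functions $\vartheta:\mathbb R_+\to\mathbb R$ such that (1) $\vartheta$ is eventually non-zero, and there exists $\alpha>0$ such that $\vartheta(cx)/\vartheta(x)\to c^{\alpha}$ as $x\to\infty$, for every $c>0$ (regular variation with positive index; the index $\alpha$ is denoted $\partial\vartheta$); (2) $\frac{1}{|\vartheta(x)|}\int_1^x\frac{|\vartheta'(s)|}{s}\,ds\to 0$ as $x\to\infty$; (3) for every $a>0$ there exist constants $\beta>0$, $C>0$ and $x_0>0$ such that $\left|\frac{\vartheta(ux)}{\vartheta(x)}\right|\le C u^{\beta}$ for all $x\ge x_0$ and all $u$ with $a/x\le u\le 1$. Poisson random measure: $\mathcal X=(0,1]^2$, and $\eta$ is a Poisson random measure on $\mathcal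 X$ with intensity measure $\mu(dt,dx)=\frac{1}{x}\,dt\,dx$, $(t,x)\in(0,1]^2$. *)

theory Defs
  imports "HOL-Probability.Probability" "HOL-Computational_Algebra.Primes"
    "HOL-Analysis.Harmonic_Numbers"
begin

section \<open>The harmonic distribution\<close>

text \<open>\<^term>\<open>harm n :: real\<close> is the library's harmonic number, written \<open>L\<^sub>n\<close> in the literature.\<close>

definition harmonic_distributed :: "'b measure \<Rightarrow> nat \<Rightarrow> ('b \<Rightarrow> nat) \<Rightarrow> bool" where
  "harmonic_distributed N n H \<longleftrightarrow>
     prob_space N \<and> H \<in> measurable N (count_space UNIV) \<and>
     (\<forall>k\<in>{1..n}. measure N {\<omega> \<in> space N. H \<omega> = k} = 1 / (real k * harm n))"


section \<open>Induced completely additive functions\<close>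

text \<open>Arguments are meant to be positive. At \<open>0\<close> the sum is empty and the value is a
  meaningless \<open>0\<close>.\<close>

definition induced :: "(real \<Rightarrow> real) \<Rightarrow> nat \<Rightarrow> real" where
  "induced \<theta> k = (\<Sum>p\<in>prime_factors k. real (multiplicity p k) * \<theta> (ln (real p)))"

lemma induced_prime:
  assumes "prime p"
  shows "induced \<theta> p = \<theta> (ln (real p))"
  using assms by (simp add: induced_def prime_prime_factors)

lemma induced_mult:
  assumes "a > 0" "b > 0"
  shows "induced \<theta> (a * b) = induced \<theta> a + induced \<theta> b"
proof -
  let ?P = "prime_factors (a * b)"
  let ?f = "\<lambda>k p. real (multiplicity p k) * \<theta> (ln (real p))"
  have P: "?P = prime_factors a \<union> prime_factors b"
    using assms by (simp add: prime_factors_product)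
  have ext: "induced \<theta> k = (\<Sum>p\<in>?P. ?f k p)" if "k = a \<or> k = b" for k
    unfolding induced_def
  proof (rule sum.mono_neutral_left)
    show "\<forall>p\<in>?P - prime_factors k. ?f k p = 0"
      using that assms by (auto simp: in_prime_factors_iff prime_factors_multiplicity)
  qed (use that in \<open>auto simp: P\<close>)
  have "induced \<theta> (a * b) = (\<Sum>p\<in>?P. ?f a p + ?f b p)"
    unfolding induced_def
  proof (rule sum.cong)
    fix p assume "p \<in> ?P"
    then have "prime p" by (simp add: in_prime_factors_iff)
    then have "multiplicity p (a * b) = multiplicity p a + multiplicity p b"
      using assms by (intro prime_elem_multiplicity_mult_distrib) auto
    then show "?f (a * b) p = ?f a p + ?f b p" by (simp add: distrib_right)
  qed simp
  then show ?thesis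
    by (simp add: sum.distrib ext)
qed


section \<open>The class of regularly varying functions\<close>

text \<open>Functions on \<open>(0, \<infinity>)\<close> are rendered as functions on all reals; no condition below
  involves values at arguments \<open>\<le> 0\<close>.\<close>

definition regularly_varying :: "(real \<Rightarrow> real) \<Rightarrow> real \<Rightarrow> bool" where
  "regularly_varying \<theta> \<alpha> \<longleftrightarrow>
     (\<forall>\<^sub>F x in at_top. \<theta> x \<noteq> 0) \<and>
     (\<forall>c>0. ((\<lambda>x. \<theta> (c * x) / \<theta> x) \<longlongrightarrow> c powr \<alpha>) at_top)"

text \<open>The index is unique, so the relation \<^term>\<open>regularly_varying \<theta> \<alpha>\<close> expresses
  that the index of \<open>\<theta>\<close> is \<open>\<alpha>\<close>.\<close>

lemma regularly_varying_unique:
  assumes "regularly_varying \<theta> \<alpha>" "regularly_varying \<theta> \<beta>"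
  shows "\<alpha> = \<beta>"
proof -
  have "((\<lambda>x. \<theta> (2 * x) / \<theta> x) \<longlongrightarrow> 2 powr \<alpha>) at_top"
       "((\<lambda>x. \<theta> (2 * x) / \<theta> x) \<longlongrightarrow> 2 powr \<beta>) at_top"
    using assms by (auto simp: regularly_varying_def)
  then have "(2::real) powr \<alpha> = 2 powr \<beta>"
    by (intro tendsto_unique[OF trivial_limit_at_top_linorder])
  then show ?thesis by (simp add: powr_inj)
qed

definition class_V :: "(real \<Rightarrow> real) set" where
  "class_V = {\<theta>.
     \<theta> C1_differentiable_on {0<..} \<and>
     (\<exists>\<alpha>>0. regularly_varying \<theta> \<alpha>) \<and>
     ((\<lambda>x. 1 / \<bar>\<theta> x\<bar> * integral {1..x} (\<lambda>s. \<bar>deriv \<theta> s\<bar> / s)) \<longlongrightarrow> 0) at_top \<and>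
     (\<forall>a>0. \<exists>\<beta>>0. \<exists>C>0. \<exists>x\<^sub>0>0. \<forall>x\<ge>x\<^sub>0. \<forall>u. a / x \<le> u \<and> u \<le> 1 \<longrightarrow>
        \<bar>\<theta> (u * x) / \<theta> x\<bar> \<le> C * u powr \<beta>)}"


section \<open>Poisson random measures\<close>

text \<open>\<open>\<eta>\<close> is a random measure on the measurable space of \<open>\<mu>\<close>, defined on the probability
  space \<open>M\<close>. The Poisson law is written out because the library's \<^const>\<open>poisson_pmf\<close> is only
  specified for positive rates; sets of measure zero are included here via \<open>0 ^ 0 = 1\<close>.
  The Poisson law with infinite mean is the point mass at \<open>\<infinity>\<close>.\<close>

definition poisson_random_measure ::
    "'w measure \<Rightarrow> 'a measure \<Rightarrow> ('w \<Rightarrow> 'a measure) \<Rightarrow> bool" where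
  "poisson_random_measure M \<mu> \<eta> \<longleftrightarrow>
     prob_space M \<and>
     (\<forall>\<omega>\<in>space M. sets (\<eta> \<omega>) = sets \<mu>) \<and>
     (\<forall>A\<in>sets \<mu>. (\<lambda>\<omega>. emeasure (\<eta> \<omega>) A) \<in> borel_measurable M) \<and>
     (\<forall>A\<in>sets \<mu>. emeasure \<mu> A < \<infinity> \<longrightarrow>
        (\<forall>k::nat. measure M {\<omega> \<in> space M. emeasure (\<eta> \<omega>) A = of_nat k} =
           measure \<mu> A ^ k / fact k * exp (- measure \<mu> A))) \<and>
     (\<forall>A\<in>sets \<mu>. emeasure \<mu> A = \<infinity> \<longrightarrow> (AE \<omega> in M. emeasure (\<eta> \<omega>) A = \<infinity>)) \<and>
     (\<forall>(m::nat) A. (\<forall>i<m. A i \<in> sets \<mu>) \<longrightarrow> disjoint_family_on A {..<m} \<longrightarrow>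
        prob_space.indep_vars M (\<lambda>_. borel) (\<lambda>i \<omega>. emeasure (\<eta> \<omega>) (A i)) {..<m})"

text \<open>The measure \<open>dt dx / x\<close> on \<open>(0,1]\<^sup>2\<close>; its underlying space is \<open>(0,1]\<^sup>2\<close>, not the plane.\<close>

definition intensity :: "(real \<times> real) measure" where
  "intensity = density (restrict_space lborel ({0<..1} \<times> {0<..1})) (\<lambda>(t, x). ennreal (1 / x))"

definition power_integral :: "(real \<times> real) measure \<Rightarrow> real \<Rightarrow> ennreal" where
  "power_integral \<nu> a = (\<integral>\<^sup>+ (s, x). ennreal (x powr a) \<partial>\<nu>)"

text \<open>\<^const>\<open>uniform_measure\<close> is the library's conditional probability given an event of
  positive probability. The integral of \<open>x\<^sup>\<alpha>\<close> is almost surely finite for \<open>\<alpha> > 0\<close>, so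
  \<^const>\<open>enn2real\<close> only affects a null set.\<close>

definition conditional_limit_law ::
    "'w measure \<Rightarrow> ('w \<Rightarrow> (real \<times> real) measure) \<Rightarrow> real \<Rightarrow> real measure" where
  "conditional_limit_law M \<eta> \<alpha> =
     distr (uniform_measure M {\<omega> \<in> space M. power_integral (\<eta> \<omega>) 1 \<le> 1}) borel
       (\<lambda>\<omega>. enn2real (power_integral (\<eta> \<omega>) \<alpha>))"

end

theory Submission
  imports Defs "HOL-Number_Theory.Prime_Powers" "HOL-Real_Asymp.Real_Asymp"
begin

text \<open>
  The harmonic law is a conditioned product of independent prime powers. Let \<open>G\<^sub>p\<close>, for the
  primes \<open>p \<le> n\<close>, be independent geometric variables with \<open>P(G\<^sub>p \<ge> j)\<close> equal to \<open>p\<close> to the power \<open>-j\<close>, and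
  let \<open>Z\<close> be the product of the \<open>p\<close> to the power \<open>G\<^sub>p\<close>. Every \<open>k \<le> n\<close> is \<open>n\<close>-smooth, so by unique
  factorisation \<open>P(Z = k)\<close> is a constant times \<open>1 / k\<close>: the variable \<open>H\<^sub>n\<close> has the law of \<open>Z\<close>
  conditioned on \<open>Z \<le> n\<close>, that is on \<open>ln Z / ln n \<le> 1\<close>. Moreover \<open>\<phi>(Z)\<close> and \<open>ln Z\<close> are the sums of
  \<open>G\<^sub>p \<theta>(ln p)\<close> and of \<open>G\<^sub>p ln p\<close>. By Mertens, the points \<open>ln p / ln n\<close> with weights \<open>1 / p\<close> look like
  the measure \<open>dx / x\<close> on \<open>(0,1]\<close>, so the pair \<open>(\<phi>(Z) / \<theta>(ln n), ln Z / ln n)\<close> should converge to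
  the pair \<open>(X, Y)\<close> of the Poisson integrals of \<open>x\<close> to the power \<open>\<alpha>\<close> and of \<open>x\<close>.

  The convergence is proved for the transforms \<open>E exp(i t \<phi>(Z) / \<theta>(ln n) - k ln Z / ln n)\<close> with
  \<open>t\<close> real and \<open>k\<close> a natural number. Such a transform is a finite Euler product; up to a vanishing
  error it is the exponential of minus the sum of \<open>(1 - z\<^sub>p) / p\<close>, where \<open>z\<^sub>p\<close> is the twist by \<open>p\<close>
  (\<open>euler_product_tendsto\<close>). Partial summation with the bounded error of Mertens' first theorem
  (\<open>mertens_first\<close>) replaces the sum by an integral. The essential part of the error is an integral
  of \<open>|\<theta>'(s)| / s\<close> divided by \<open>|\<theta>(ln n)|\<close>, which is what the second defining condition
  of the class controls, and the Potter-type third condition provides the dominating function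
  that turns pointwise regular variation into convergence of the integral. On the
  Poisson side, the transform of \<open>(X, Y)\<close> is found by discretising \<open>x\<close>
  (\<open>poisson_joint_transform\<close>), and the two limits agree.

  Conditioning is handled by \<open>threshold_convergence\<close>. For fixed \<open>t\<close> the transforms are the moments of
  \<open>U = exp(- ln Z / ln n)\<close> weighted by the bounded factor \<open>exp(i t \<phi>(Z) / \<theta>(ln n))\<close>, so the Weierstrass
  theorem gives convergence for every continuous function of \<open>U\<close> in place of a power. It extends to
  the indicator of \<open>Z \<le> n\<close> because the event that \<open>Z\<close> lies slightly above \<open>n\<close>
  has small probability uniformly in \<open>n\<close> (\<open>smooth_mass_near_threshold\<close>). Dividing by
  the case \<open>t = 0\<close>, whose limit \<open>P(Y \<le> 1)\<close> is positive because \<open>E Y = 1\<close>, gives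
  convergence of the characteristic functions, and Levy's continuity theorem concludes.
\<close>

section \<open>Mertens' first theorem\<close>

definition chebyshev_theta :: "nat \<Rightarrow> real" where
  "chebyshev_theta n = (\<Sum>p | prime p \<and> p \<le> n. ln (real p))"

lemma prod_primes_dvd:
  fixes m :: nat
  assumes "finite P" "\<And>p. p \<in> P \<Longrightarrow> prime p" "\<And>p. p \<in> P \<Longrightarrow> p dvd m"
  shows "\<Prod>P dvd m"
  using assms
proof (induction P rule: finite_induct)
  case (insert p P)
  have "coprime p (\<Prod>P)"
    using insert by (intro prod_coprime_right primes_coprime) auto
  then show ?case using insert by (simp add: divides_mult)
qed simp

text \<open>A prime in \<open>(k, n]\<close> divides \<open>n!\<close> but neither \<open>k!\<close> nor \<open>(n - k)!\<close>, so the
  product of all of them divides a binomial coefficient, which is at most \<open>2\<close> to the power \<open>n\<close>.\<close>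

lemma chebyshev_theta_step:
  assumes "k \<le> n" "n \<le> 2 * k"
  shows "chebyshev_theta n \<le> chebyshev_theta k + real n * ln 2"
proof -
  define P where "P = {p. prime p \<and> k < p \<and> p \<le> n}"
  have fin: "finite P" by (rule finite_subset[of _ "{..n}"]) (auto simp: P_def)
  have dvd: "p dvd (n choose k)" if "p \<in> P" for p
  proof -
    have p: "prime p" "k < p" "p \<le> n" using that by (auto simp: P_def)
    have "p dvd fact n" using p by (simp add: prime_dvd_fact_iff)
    moreover have "fact n = fact k * fact (n - k) * (n choose k)"
      using binomial_fact_lemma[OF \<open>k \<le> n\<close>] by simp
    moreover have "\<not> p dvd fact k" "\<not> p dvd fact (n - k)"
      using p assms by (auto simp: prime_dvd_fact_iff)
    ultimately show ?thesis using p by (metis prime_dvd_mult_iff)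
  qed
  have pos: "0 < (n choose k)" using assms by simp
  have "\<Prod>P \<le> (n choose k)"
    by (intro dvd_imp_le pos prod_primes_dvd fin dvd) (auto simp: P_def)
  also have "(n choose k) \<le> 2 ^ n" using binomial_le_pow2 by blast
  finally have "real (\<Prod>P) \<le> 2 ^ n" by (metis of_nat_le_iff of_nat_numeral of_nat_power)
  moreover have Ppos: "\<And>p. p \<in> P \<Longrightarrow> 0 < p" by (auto simp: P_def prime_gt_0_nat)
  ultimately have "ln (real (\<Prod>P)) \<le> ln (2 ^ n)"
    by (intro ln_mono) (auto simp: prod_pos)
  also have "ln (2 ^ n) = real n * ln (2::real)" by (simp add: ln_realpow)
  also have "ln (real (\<Prod>P)) = (\<Sum>p\<in>P. ln (real p))"
    using Ppos fin by (simp add: ln_prod)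
  finally have "(\<Sum>p\<in>P. ln (real p)) \<le> real n * ln 2" .
  moreover have "chebyshev_theta n = chebyshev_theta k + (\<Sum>p\<in>P. ln (real p))"
    unfolding chebyshev_theta_def
    using assms fin by (subst sum.union_disjoint[symmetric]) (auto simp: P_def intro!: sum.cong)
  ultimately show ?thesis by simp
qed

lemma chebyshev_theta_le: "chebyshev_theta n \<le> 4 * real n * ln 2"
proof (induction n rule: less_induct)
  case (less n)
  consider "n \<le> 1" | "n = 2" | "n = 3" | "n \<ge> 4" by linarith
  then show ?case
  proof cases
    case 1
    then have "\<not> (prime p \<and> p \<le> n)" for p :: nat using prime_ge_2_nat[of p] by auto
    then show ?thesis unfolding chebyshev_theta_def by (subst sum.neutral) auto
  next
    case 2
    have "chebyshev_theta 2 \<le> chebyshev_theta 1 + 2 * ln 2"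
      using chebyshev_theta_step[of 1 2] by simp
    moreover have "chebyshev_theta 1 \<le> 4 * ln 2" using less[of 1] 2 by simp
    ultimately have "chebyshev_theta 2 \<le> 8 * ln 2" using ln_gt_zero[of "2::real"] by linarith
    then show ?thesis using 2 by simp
  next
    case 3
    have "chebyshev_theta 3 \<le> chebyshev_theta 2 + 3 * ln 2"
      using chebyshev_theta_step[of 2 3] by simp
    moreover have "chebyshev_theta 2 \<le> 8 * ln 2" using less[of 2] 3 by simp
    ultimately have "chebyshev_theta 3 \<le> 12 * ln 2" using ln_gt_zero[of "2::real"] by linarith
    then show ?thesis using 3 by simp
  next
    case 4
    define k where "k = (n + 1) div 2"
    have k: "k < n" "n \<le> 2 * k" "2 * k \<le> n + 1" using 4 by (auto simp: k_def)
    have "chebyshev_theta n \<le> 4 * real k * ln 2 + real n * ln 2"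
      using chebyshev_theta_step[of k n] less[of k] k by linarith
    also have "4 * real k * ln 2 + real n * ln 2 = (4 * real k + real n) * ln 2"
      by (simp add: algebra_simps)
    also have "\<dots> \<le> (4 * real n) * ln 2"
      using k 4 by (intro mult_right_mono) auto
    finally show ?thesis by simp
  qed
qed

text \<open>Sum the identity that expresses \<open>ln k\<close> through the von Mangoldt function over all \<open>k \<le> n\<close>; the divisor
  \<open>d\<close> is counted once for each of its multiples up to \<open>n\<close>.\<close>

lemma ln_fact_eq_sum_mangoldt:
  "ln (fact n :: real) = (\<Sum>d=1..n. mangoldt d * real (n div d))"
proof -
  have "ln (fact n :: real) = (\<Sum>k=1..n. ln (real k))"
    by (simp add: fact_prod) (subst ln_prod, auto)
  also have "\<dots> = (\<Sum>k=1..n. \<Sum>d | d dvd k. mangoldt d)"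
    by (intro sum.cong refl) (subst mangoldt_sum, auto)
  also have "\<dots> = (\<Sum>k=1..n. \<Sum>d=1..n. if d dvd k then mangoldt d else 0)"
  proof (rule sum.cong[OF refl])
    fix k assume "k \<in> {1..n}"
    then show "(\<Sum>d | d dvd k. mangoldt d) = (\<Sum>d=1..n. if d dvd k then mangoldt d else (0::real))"
      by (subst sum.inter_filter[symmetric])
         (auto intro!: sum.cong dest: dvd_imp_le intro: Suc_leI Nat.gr0I)
  qed
  also have "\<dots> = (\<Sum>d=1..n. \<Sum>k=1..n. if d dvd k then mangoldt d else 0)"
    by (rule sum.swap)
  also have "\<dots> = (\<Sum>d=1..n. mangoldt d * real (n div d))"
  proof (intro sum.cong refl)
    fix d assume d: "d \<in> {1..n}"
    have "{k\<in>{1..n}. d dvd k} = (\<lambda>j. d * j) ` {1..n div d}"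
    proof (intro equalityI subsetI)
      fix k assume "k \<in> {k\<in>{1..n}. d dvd k}"
      then obtain j where "k = d * j" "1 \<le> d * j" "d * j \<le> n" by auto
      moreover from this have "1 \<le> j" by (cases j) auto
      moreover have "j \<le> n div d" using \<open>d * j \<le> n\<close> d
        by (simp add: less_eq_div_iff_mult_less_eq mult.commute)
      ultimately show "k \<in> (\<lambda>j. d * j) ` {1..n div d}" by auto
    next
      fix k assume "k \<in> (\<lambda>j. d * j) ` {1..n div d}"
      then obtain j where "k = d * j" "j \<in> {1..n div d}" by blast
      then show "k \<in> {k\<in>{1..n}. d dvd k}" using d
        by (auto simp: less_eq_div_iff_mult_less_eq mult.commute)
    qed
    moreover have "inj_on (\<lambda>j. d * j) {1..n div d}" using d by (auto simp: inj_on_def)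
    ultimately have "card {k\<in>{1..n}. d dvd k} = n div d" by (simp add: card_image)
    then show "(\<Sum>k=1..n. if d dvd k then mangoldt d else (0::real)) = mangoldt d * real (n div d)"
      by (simp add: sum.If_cases Int_def)
  qed
  finally show ?thesis .
qed

lemma summable_ln_div_square: "summable (\<lambda>n. ln (real n) / (real n * (real n - 1)))"
proof (rule summable_comparison_test_bigo)
  show "summable (\<lambda>n. norm (real n powr (- 3/2)))"
    by (simp add: summable_real_powr_iff)
  show "(\<lambda>n. ln (real n) / (real n * (real n - 1))) \<in> O(\<lambda>n. real n powr (- 3/2))"
    by real_asymp
qed

text \<open>Proper prime powers contribute a bounded amount: for a prime \<open>p\<close> the geometric series of the
  powers from the second on has sum \<open>1 / (p (p - 1))\<close>.\<close>

lemma sum_mangoldt_minus_primes: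
  "(\<Sum>d=1..n. mangoldt d / real d) - (\<Sum>p | prime p \<and> p \<le> n. ln (real p) / real p)
     \<le> (\<Sum>m. ln (real m) / (real m * (real m - 1)))"
proof -
  define P where "P = {p. prime p \<and> p \<le> n}"
  have finP: "finite P" by (rule finite_subset[of _ "{..n}"]) (auto simp: P_def)
  define Q where "Q = {d\<in>{1..n}. primepow d \<and> \<not> prime d}"
  have finQ: "finite Q" by (simp add: Q_def)
  have "(\<Sum>d=1..n. mangoldt d / real d) = (\<Sum>d\<in>P \<union> Q. mangoldt d / real d)"
    by (intro sum.mono_neutral_right)
       (auto simp: P_def Q_def mangoldt_def prime_ge_Suc_0_nat)
  also have "\<dots> = (\<Sum>d\<in>P. mangoldt d / real d) + (\<Sum>d\<in>Q. mangoldt d / real d)"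
    using finP finQ by (intro sum.union_disjoint) (auto simp: P_def Q_def)
  also have "(\<Sum>d\<in>P. mangoldt d / real d) = (\<Sum>p\<in>P. ln (real p) / real p)"
    by (intro sum.cong) (auto simp: P_def)
  finally have eq: "(\<Sum>d=1..n. mangoldt d / real d) - (\<Sum>p\<in>P. ln (real p) / real p)
     = (\<Sum>d\<in>Q. mangoldt d / real d)" by simp
  have Qsub: "Q \<subseteq> (\<lambda>(p, k). p ^ k) ` (P \<times> {2..n})"
  proof
    fix d assume "d \<in> Q"
    then have d: "d \<le> n" "primepow d" "\<not> prime d" by (auto simp: Q_def)
    then obtain p k where pk: "prime p" "k > 0" "d = p ^ k" by (auto simp: primepow_def)
    have "k \<noteq> 1" using pk d by auto
    moreover have "k < p ^ k" using pk by (intro power_gt_expt) (auto simp: prime_gt_Suc_0_nat)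
    moreover have "p \<le> p ^ k" using pk by (simp add: prime_gt_0_nat self_le_power Suc_leI)
    ultimately show "d \<in> (\<lambda>(p, k). p ^ k) ` (P \<times> {2..n})"
      using pk d by (auto simp: P_def image_iff intro!: bexI[of _ p] bexI[of _ k])
  qed
  have "(\<Sum>d\<in>Q. mangoldt d / real d) \<le> (\<Sum>d\<in>(\<lambda>(p, k). p ^ k) ` (P \<times> {2..n}). mangoldt d / real d)"
    using Qsub finP by (intro sum_mono2) (auto simp: mangoldt_nonneg)
  also have "\<dots> \<le> (\<Sum>(p,k)\<in>P \<times> {2..n}. mangoldt (p ^ k) / real (p ^ k))"
    using finP sum_image_le[of "P \<times> {2..n}" "\<lambda>d. mangoldt d / real d" "\<lambda>(p, k). p ^ k"]
    by (simp add: mangoldt_nonneg o_def case_prod_unfold)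
  also have "\<dots> = (\<Sum>p\<in>P. \<Sum>k=2..n. mangoldt (p ^ k) / real (p ^ k))"
    by (simp add: sum.cartesian_product)
  also have "\<dots> \<le> (\<Sum>p\<in>P. ln (real p) / (real p * (real p - 1)))"
  proof (rule sum_mono)
    fix p assume "p \<in> P"
    then have p: "prime p" "real p \<ge> 2" by (auto simp: P_def dest: prime_ge_2_nat)
    define r where "r = 1 / real p"
    have r: "0 < r" "r < 1" using p by (auto simp: r_def)
    have "(\<Sum>k=2..n. mangoldt (p ^ k) / real (p ^ k)) = ln (real p) * (\<Sum>k=2..n. r ^ k)"
      using p by (simp add: sum_distrib_left r_def power_divide)
    also have "(\<Sum>k=2..n. r ^ k) \<le> r^2 / (1 - r)"
      using r by (simp add: sum_gp divide_right_mono)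
    also have "r^2 / (1 - r) = 1 / (real p * (real p - 1))"
      using p by (simp add: r_def field_simps power2_eq_square)
    finally show "(\<Sum>k=2..n. mangoldt (p ^ k) / real (p ^ k)) \<le> ln (real p) / (real p * (real p - 1))"
      using p by (simp add: mult_left_mono)
  qed
  also have "\<dots> \<le> (\<Sum>m. ln (real m) / (real m * (real m - 1)))"
  proof (intro sum_le_suminf summable_ln_div_square finP)
    fix m :: nat show "0 \<le> ln (real m) / (real m * (real m - 1))" by (cases "m = 0") auto
  qed
  finally show ?thesis using eq by (simp add: P_def)
qed

text \<open>Both bounds compare \<open>ln n!\<close>, which is \<open>n ln n\<close> up to \<open>O(n)\<close>, with \<open>n\<close> times the sum over
  primes. For the upper bound the integer parts \<open>n div p\<close> cost at most Chebyshev's function of \<open>n\<close>, which is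
  \<open>O(n)\<close>; for the lower bound the proper prime powers cost a convergent series.\<close>

theorem mertens_first:
  obtains C :: real where
    "\<And>x. x \<ge> 1 \<Longrightarrow> \<bar>(\<Sum>p | prime p \<and> real p \<le> x. ln (real p) / real p) - ln x\<bar> \<le> C"
proof -
  define A where "A = (\<lambda>n. \<Sum>p | prime p \<and> p \<le> n. ln (real p) / real p)"
  define K where "K = (\<Sum>m. ln (real m) / (real m * (real m - 1)))"
  have upper: "A n \<le> ln (real n) + 4 * ln 2" if n: "n \<ge> 1" for n
  proof -
    define P where "P = {p. prime p \<and> p \<le> n}"
    have P: "P \<subseteq> {1..n}" by (auto simp: P_def prime_ge_Suc_0_nat)
    then have finP: "finite P" using finite_subset by blast
    have "real n * A n - chebyshev_theta n = (\<Sum>p\<in>P. ln (real p) * (real n / real p - 1))"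
      by (simp add: A_def chebyshev_theta_def P_def sum_distrib_left sum_subtractf algebra_simps)
    also have "\<dots> \<le> (\<Sum>p\<in>P. mangoldt p * real (n div p))"
    proof (rule sum_mono)
      fix p assume "p \<in> P"
      then have p: "prime p" by (simp add: P_def)
      have "real n / real p - 1 \<le> real (n div p)"
        using floor_divide_of_nat_eq[of n p, where 'a = real] by linarith
      then show "ln (real p) * (real n / real p - 1) \<le> mangoldt p * real (n div p)"
        using p prime_gt_0_nat[OF p] by (auto intro!: mult_left_mono)
    qed
    also have "\<dots> \<le> (\<Sum>d=1..n. mangoldt d * real (n div d))"
      using P by (intro sum_mono2) (auto simp: mangoldt_nonneg)
    also have "\<dots> = ln (fact n)" by (simp add: ln_fact_eq_sum_mangoldt)
    also have "\<dots> \<le> ln (real n ^ n)"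
      using fact_le_power[of n, where 'a = real] by (intro ln_mono) (simp_all add: fact_gt_zero)
    also have "\<dots> = real n * ln (real n)" using n by (simp add: ln_realpow)
    finally have "real n * A n \<le> real n * (ln (real n) + 4 * ln 2)"
      using chebyshev_theta_le[of n] by (simp add: algebra_simps)
    then show ?thesis using n by simp
  qed
  have lower: "A n \<ge> ln (real n) - 1 - K" if n: "n \<ge> 1" for n
  proof -
    \<comment> \<open>a single term of the exponential series gives the lower bound on \<open>ln n!\<close>\<close>
    have "real n ^ n / fact n \<le> exp (real n)"
    proof -
      have "(\<Sum>k\<in>{n}. inverse (fact k) * real n ^ k) \<le> (\<Sum>k. inverse (fact k) * real n ^ k)"
        by (intro sum_le_suminf summable_exp) auto
      then show ?thesis by (simp add: exp_def field_simps)
    qed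
    then have "ln (real n ^ n / fact n) \<le> real n"
      using n ln_mono[of "real n ^ n / fact n" "exp (real n)"] by simp
    then have "real n * ln (real n) - real n \<le> ln (fact n)"
      using n by (simp add: ln_div ln_realpow)
    also have "\<dots> = (\<Sum>d=1..n. mangoldt d * real (n div d))" by (simp add: ln_fact_eq_sum_mangoldt)
    also have "\<dots> \<le> (\<Sum>d=1..n. mangoldt d * (real n / real d))"
      by (intro sum_mono mult_left_mono mangoldt_nonneg of_nat_div_le_of_nat)
    also have "\<dots> = real n * (\<Sum>d=1..n. mangoldt d / real d)"
      by (simp add: sum_distrib_left mult_ac)
    finally have "real n * (ln (real n) - 1) \<le> real n * (\<Sum>d=1..n. mangoldt d / real d)"
      by (simp add: algebra_simps)
    then have "ln (real n) - 1 \<le> (\<Sum>d=1..n. mangoldt d / real d)" using n by simp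
    then show ?thesis using sum_mangoldt_minus_primes[of n] by (simp add: A_def K_def)
  qed
  have K: "K \<ge> 0" unfolding K_def
  proof (intro suminf_nonneg summable_ln_div_square)
    fix m :: nat show "0 \<le> ln (real m) / (real m * (real m - 1))" by (cases "m = 0") auto
  qed
  show thesis
  proof (rule that[of "4 * ln 2 + 2 + K"])
    fix x :: real assume x: "x \<ge> 1"
    define n where "n = nat \<lfloor>x\<rfloor>"
    have n: "n \<ge> 1" "real n \<le> x" "x \<le> real n + 1" using x unfolding n_def by linarith+
    then have "x \<le> 2 * real n" by linarith
    note n = n(1,2) this
    have "ln (real n) \<le> ln x" "ln x \<le> ln (2 * real n)" using n x by (auto simp del: ln_mult_pos)
    then have l: "ln (real n) \<le> ln x" "ln x \<le> ln (real n) + 1"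
      using n ln_2_less_1 by (auto simp: ln_mult)
    have "real p \<le> x \<longleftrightarrow> p \<le> n" for p :: nat
    proof
      assume "real p \<le> x"
      then show "p \<le> n" unfolding n_def by (rule le_nat_floor)
    next
      assume "p \<le> n"
      then have "real p \<le> real n" by simp
      then show "real p \<le> x" using n(2) by linarith
    qed
    then have "(\<Sum>p | prime p \<and> real p \<le> x. ln (real p) / real p) = A n" by (simp add: A_def)
    then show "\<bar>(\<Sum>p | prime p \<and> real p \<le> x. ln (real p) / real p) - ln x\<bar> \<le> 4 * ln 2 + 2 + K"
      using upper[OF n(1)] lower[OF n(1)] l K ln_gt_zero[of "2::real"] by linarith
  qed
qed

lemma mertens_first_ln:
  obtains C :: real where
    "\<And>x. x \<ge> 0 \<Longrightarrow> \<bar>(\<Sum>p | prime p \<and> ln (real p) \<le> x. ln (real p) / real p) - x\<bar> \<le> C"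
proof -
  obtain C :: real where C: "\<And>x. x \<ge> 1 \<Longrightarrow> \<bar>(\<Sum>p | prime p \<and> real p \<le> x. ln (real p) / real p) - ln x\<bar> \<le> C"
    using mertens_first by metis
  show thesis
  proof (rule that[of C])
    fix x :: real assume "x \<ge> 0"
    have "real p \<le> exp x \<longleftrightarrow> ln (real p) \<le> x" if "prime p" for p :: nat
      using prime_gt_0_nat[OF that] exp_le_cancel_iff[of "ln (real p)" x] by simp
    then have "{p. prime p \<and> ln (real p) \<le> x} = {p. prime p \<and> real p \<le> exp x}" by auto
    then show "\<bar>(\<Sum>p | prime p \<and> ln (real p) \<le> x. ln (real p) / real p) - x\<bar> \<le> C"
      using C[of "exp x"] \<open>x \<ge> 0\<close> by simp
  qed
qed

section \<open>Comparing sums over primes with integrals\<close>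

text \<open>Abel summation. With \<open>A s\<close> the total weight of the points up to \<open>s\<close>, the sum is
  \<open>A L * f L\<close> minus the integral of \<open>A s * f' s\<close>, and the integral of \<open>f\<close> has the same shape with \<open>A s\<close> replaced
  by \<open>s\<close>, apart from a boundary term at \<open>a\<close>. Hence the difference of the two integrals only sees \<open>A s - s\<close>, which stays bounded when the points are the logarithms
  of the primes, with weights \<open>ln p / p\<close>.\<close>

lemma sum_minus_integral_bound:
  fixes f f' :: "real \<Rightarrow> complex" and w q :: "'i \<Rightarrow> real"
  assumes fin: "finite I" and q: "\<And>i. i \<in> I \<Longrightarrow> a \<le> q i \<and> q i \<le> L" and aL: "a \<le> L"
    and deriv: "\<And>s. a \<le> s \<Longrightarrow> s \<le> L \<Longrightarrow> (f has_vector_derivative f' s) (at s)"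
    and cont: "continuous_on {a..L} f'"
    and bound: "\<And>s. a \<le> s \<Longrightarrow> s \<le> L \<Longrightarrow> \<bar>(\<Sum>i\<in>{i\<in>I. q i \<le> s}. w i) - s\<bar> \<le> C"
  shows "norm ((\<Sum>i\<in>I. w i *\<^sub>R f (q i)) - (\<integral>s. indicator {a..L} s *\<^sub>R f s \<partial>lborel))
       \<le> C * norm (f L) + \<bar>a\<bar> * norm (f a) + C * (\<integral>s. indicator {a..L} s * norm (f' s) \<partial>lborel)"
proof -
  define A where "A = (\<lambda>s. \<Sum>i\<in>I. w i * indicator {q i..} s)"
  have A_eq: "A s = (\<Sum>i\<in>{i\<in>I. q i \<le> s}. w i)" for s
    unfolding A_def sum.inter_filter[OF fin, of w "\<lambda>i. q i \<le> s"]
    by (intro sum.cong) (auto simp: indicator_def)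
  have AL: "A L = (\<Sum>i\<in>I. w i)" unfolding A_eq using q by (intro sum.cong) auto
  have contf: "continuous_on {a..L} f"
    by (intro continuous_at_imp_continuous_on ballI has_vector_derivative_continuous[OF deriv]) auto
  have Fi: "has_bochner_integral lborel (\<lambda>s. indicator {q i..L} s *\<^sub>R f' s) (f L - f (q i))" if "i \<in> I" for i
    using q[OF that] deriv cont
    by (intro has_bochner_integral_FTC_Icc)
       (auto intro: has_vector_derivative_at_within continuous_on_subset)
  have F: "has_bochner_integral lborel (\<lambda>s. indicator {a..L} s *\<^sub>R (f s + s *\<^sub>R f' s)) (L *\<^sub>R f L - a *\<^sub>R f a)"
  proof (rule has_bochner_integral_FTC_Icc[OF aL])
    show "continuous_on {a..L} (\<lambda>s. f s + s *\<^sub>R f' s)"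
      by (intro continuous_intros contf cont)
    fix s assume "a \<le> s" "s \<le> L"
    then have "((\<lambda>s. s *\<^sub>R f s) has_vector_derivative (s *\<^sub>R f' s + 1 *\<^sub>R f s)) (at s)"
      by (intro has_vector_derivative_scaleR deriv) auto
    then show "((\<lambda>s. s *\<^sub>R f s) has_vector_derivative f s + s *\<^sub>R f' s) (at s within {a..L})"
      by (auto simp: add.commute intro: has_vector_derivative_at_within)
  qed
  have intf: "integrable lborel (\<lambda>s. indicator {a..L} s *\<^sub>R f s)"
    by (rule borel_integrable_compact[OF compact_Icc contf])
  have intf': "integrable lborel (\<lambda>s. indicator {a..L} s *\<^sub>R f' s)"
    by (rule borel_integrable_compact[OF compact_Icc cont])
  have "has_bochner_integral lborel (\<lambda>s. \<Sum>i\<in>I. w i *\<^sub>R (indicator {q i..L} s *\<^sub>R f' s))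
           (\<Sum>i\<in>I. w i *\<^sub>R (f L - f (q i)))"
    by (intro has_bochner_integral_sum has_bochner_integral_scaleR_right Fi)
  also have "(\<lambda>s. \<Sum>i\<in>I. w i *\<^sub>R (indicator {q i..L} s *\<^sub>R f' s)) = (\<lambda>s. A s *\<^sub>R (indicator {a..L} s *\<^sub>R f' s))"
    unfolding A_def scaleR_sum_left
    by (intro ext sum.cong refl) (use q in \<open>force simp: indicator_def\<close>)
  finally have IA: "has_bochner_integral lborel (\<lambda>s. A s *\<^sub>R (indicator {a..L} s *\<^sub>R f' s))
           (A L *\<^sub>R f L - (\<Sum>i\<in>I. w i *\<^sub>R f (q i)))"
    by (simp add: AL scaleR_diff_right sum_subtractf scaleR_sum_left)
  have "has_bochner_integral lborel (\<lambda>s. indicator {a..L} s *\<^sub>R (f s + s *\<^sub>R f' s) - indicator {a..L} s *\<^sub>R f s)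
      (L *\<^sub>R f L - a *\<^sub>R f a - (\<integral>s. indicator {a..L} s *\<^sub>R f s \<partial>lborel))"
    by (intro has_bochner_integral_diff F has_bochner_integral_integrable intf)
  also have "(\<lambda>s. indicator {a..L} s *\<^sub>R (f s + s *\<^sub>R f' s) - indicator {a..L} s *\<^sub>R f s)
      = (\<lambda>s. s *\<^sub>R (indicator {a..L} s *\<^sub>R f' s))"
    by (auto simp: algebra_simps)
  finally have IS: "has_bochner_integral lborel (\<lambda>s. s *\<^sub>R (indicator {a..L} s *\<^sub>R f' s))
      (L *\<^sub>R f L - a *\<^sub>R f a - (\<integral>s. indicator {a..L} s *\<^sub>R f s \<partial>lborel))" .
  have "has_bochner_integral lborel
      (\<lambda>s. A s *\<^sub>R (indicator {a..L} s *\<^sub>R f' s) - s *\<^sub>R (indicator {a..L} s *\<^sub>R f' s))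
      ((A L *\<^sub>R f L - (\<Sum>i\<in>I. w i *\<^sub>R f (q i))) -
       (L *\<^sub>R f L - a *\<^sub>R f a - (\<integral>s. indicator {a..L} s *\<^sub>R f s \<partial>lborel)))"
    by (intro has_bochner_integral_diff IA IS)
  then have "has_bochner_integral lborel (\<lambda>s. (A s - s) *\<^sub>R (indicator {a..L} s *\<^sub>R f' s))
      ((A L *\<^sub>R f L - (\<Sum>i\<in>I. w i *\<^sub>R f (q i))) -
       (L *\<^sub>R f L - a *\<^sub>R f a - (\<integral>s. indicator {a..L} s *\<^sub>R f s \<partial>lborel)))"
    by (simp only: scaleR_diff_left)
  then have diff: "(\<integral>s. (A s - s) *\<^sub>R (indicator {a..L} s *\<^sub>R f' s) \<partial>lborel) =
      ((A L *\<^sub>R f L - (\<Sum>i\<in>I. w i *\<^sub>R f (q i))) -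
       (L *\<^sub>R f L - a *\<^sub>R f a - (\<integral>s. indicator {a..L} s *\<^sub>R f s \<partial>lborel)))"
    and intd: "integrable lborel (\<lambda>s. (A s - s) *\<^sub>R (indicator {a..L} s *\<^sub>R f' s))"
    unfolding has_bochner_integral_iff by blast+
  have intn: "integrable lborel (\<lambda>s. C * (indicator {a..L} s * norm (f' s)))"
    using integrable_norm[OF intf'] by (intro integrable_mult_right) simp
  have "norm (\<integral>s. (A s - s) *\<^sub>R (indicator {a..L} s *\<^sub>R f' s) \<partial>lborel)
      \<le> (\<integral>s. C * (indicator {a..L} s * norm (f' s)) \<partial>lborel)"
  proof (rule order_trans[OF integral_norm_bound integral_mono[OF integrable_norm[OF intd] intn]])
    fix s :: real
    show "norm ((A s - s) *\<^sub>R (indicator {a..L} s *\<^sub>R f' s)) \<le> C * (indicator {a..L} s * norm (f' s))"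
      using bound[of s] by (auto simp: indicator_def A_eq intro!: mult_right_mono)
  qed
  then have main: "norm (\<integral>s. (A s - s) *\<^sub>R (indicator {a..L} s *\<^sub>R f' s) \<partial>lborel)
      \<le> C * (\<integral>s. indicator {a..L} s * norm (f' s) \<partial>lborel)" by simp
  have "(\<Sum>i\<in>I. w i *\<^sub>R f (q i)) - (\<integral>s. indicator {a..L} s *\<^sub>R f s \<partial>lborel)
      = (A L - L) *\<^sub>R f L + a *\<^sub>R f a - (\<integral>s. (A s - s) *\<^sub>R (indicator {a..L} s *\<^sub>R f' s) \<partial>lborel)"
    unfolding diff by (simp add: algebra_simps)
  also have "norm \<dots> \<le> norm ((A L - L) *\<^sub>R f L) + norm (a *\<^sub>R f a)
      + norm (\<integral>s. (A s - s) *\<^sub>R (indicator {a..L} s *\<^sub>R f' s) \<partial>lborel)"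
    by (intro order_trans[OF norm_triangle_ineq4] add_right_mono norm_triangle_ineq)
  also have "norm ((A L - L) *\<^sub>R f L) \<le> C * norm (f L)"
    using bound[of L] aL by (auto simp: A_eq intro!: mult_right_mono)
  finally show ?thesis using main by simp
qed

text \<open>The value at the prime \<open>p\<close> with \<open>s = ln p\<close>, for \<open>L = ln n\<close>, of the completely multiplicative
  function \<open>m \<mapsto> exp (i t \<phi>(m) / \<theta>(L) - \<kappa> ln m / L)\<close>.\<close>

definition twist :: "(real \<Rightarrow> real) \<Rightarrow> real \<Rightarrow> real \<Rightarrow> real \<Rightarrow> real \<Rightarrow> complex" where
  "twist \<theta> t \<kappa> L s = exp (Complex (- (\<kappa> * s / L)) (t * \<theta> s / \<theta> L))"

text \<open>The limit of the twist at \<open>s = u L\<close> as \<open>L\<close> tends to infinity.\<close>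

definition limit_twist :: "real \<Rightarrow> real \<Rightarrow> real \<Rightarrow> real \<Rightarrow> complex" where
  "limit_twist \<alpha> t \<kappa> u = exp (Complex (- (\<kappa> * u)) (t * u powr \<alpha>))"

lemma norm_one_minus_exp_le:
  assumes "a \<ge> 0"
  shows "norm (1 - exp (Complex (- a) b)) \<le> a + \<bar>b\<bar>"
proof -
  have "1 - exp (Complex (- a) b) = (1 - of_real (exp (- a))) - of_real (exp (- a)) * (iexp b - 1)"
  proof -
    have "Complex (- a) b = of_real (- a) + \<i> * of_real b" by (simp add: complex_eq_iff)
    then have "exp (Complex (- a) b) = of_real (exp (- a)) * iexp b"
      by (simp only: exp_add exp_of_real)
    then show ?thesis by (simp add: algebra_simps)
  qed
  also have "norm \<dots> \<le> norm (1 - of_real (exp (- a)) :: complex) + norm (of_real (exp (- a)) * (iexp b - 1))"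
    by (rule norm_triangle_ineq4)
  also have "norm (1 - of_real (exp (- a)) :: complex) = 1 - exp (- a)"
  proof -
    have "(1 - of_real (exp (- a)) :: complex) = of_real (1 - exp (- a))" by simp
    then show ?thesis using assms by (simp only: norm_of_real) simp
  qed
  also have "1 - exp (- a) \<le> a" using exp_ge_add_one_self[of "- a"] by simp
  also have "norm (of_real (exp (- a)) * (iexp b - 1)) \<le> 1 * \<bar>b\<bar>"
    unfolding norm_mult using assms iexp_approx1[of b 0] by (intro mult_mono) auto
  finally show ?thesis by simp
qed

lemma norm_twist_le_1: "\<kappa> \<ge> 0 \<Longrightarrow> L > 0 \<Longrightarrow> s \<ge> 0 \<Longrightarrow> norm (twist \<theta> t \<kappa> L s) \<le> 1"
  by (simp add: twist_def)

text \<open>This is the third condition of the class, used with \<open>a = ln 2\<close> because no prime is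
  smaller than \<open>2\<close>. The exponent is capped at \<open>1/2\<close>: then the linear term \<open>\<kappa> s / L\<close> obeys the same bound, and
  the integral of \<open>s\<close> to the power \<open>\<gamma> - 2\<close> converges at infinity.\<close>

lemma one_minus_twist_bound:
  assumes "\<theta> \<in> class_V" "\<kappa> \<ge> 0"
  obtains K \<gamma> L0 where "K > 0" "0 < \<gamma>" "\<gamma> \<le> 1/2" "L0 \<ge> 1"
    "\<And>L s. L \<ge> L0 \<Longrightarrow> ln 2 \<le> s \<Longrightarrow> s \<le> L \<Longrightarrow> norm (1 - twist \<theta> t \<kappa> L s) \<le> K * (s / L) powr \<gamma>"
proof -
  have "\<exists>\<beta>>0. \<exists>C>0. \<exists>x0>0. \<forall>x\<ge>x0. \<forall>u. ln 2 / x \<le> u \<and> u \<le> 1 \<longrightarrow>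
        \<bar>\<theta> (u * x) / \<theta> x\<bar> \<le> C * u powr \<beta>"
    using assms(1) unfolding class_V_def by (auto elim!: allE[of _ "ln 2"])
  then obtain \<beta> C x0 where b: "\<beta> > 0" "C > 0" "x0 > 0"
    "\<And>x u. x \<ge> x0 \<Longrightarrow> ln 2 / x \<le> u \<Longrightarrow> u \<le> 1 \<Longrightarrow> \<bar>\<theta> (u * x) / \<theta> x\<bar> \<le> C * u powr \<beta>"
    by blast
  define \<gamma> where "\<gamma> = min \<beta> (1/2)"
  have \<gamma>: "0 < \<gamma>" "\<gamma> \<le> 1/2" "\<gamma> \<le> \<beta>" "\<gamma> \<le> 1" using b by (auto simp: \<gamma>_def)
  show thesis
  proof (rule that[of "\<kappa> + \<bar>t\<bar> * C + 1" \<gamma> "max 1 x0"])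
    fix L s :: real assume L: "L \<ge> max 1 x0" and s: "ln 2 \<le> s" "s \<le> L"
    have pos: "L > 0" "s > 0" using L s ln_gt_zero[of 2] by linarith+
    define u where "u = s / L"
    have u: "0 < u" "u \<le> 1" "ln 2 / L \<le> u" "u * L = s"
      using pos s by (auto simp: u_def field_simps)
    have mono: "u powr c \<le> u powr \<gamma>" if "\<gamma> \<le> c" for c
      using u that by (intro powr_mono') auto
    have "norm (1 - twist \<theta> t \<kappa> L s) \<le> \<kappa> * s / L + \<bar>t * \<theta> s / \<theta> L\<bar>"
      unfolding twist_def by (intro norm_one_minus_exp_le) (use assms pos in auto)
    also have "\<kappa> * s / L = \<kappa> * u powr 1" using u pos by (simp add: u_def)
    also have "\<bar>t * \<theta> s / \<theta> L\<bar> = \<bar>t\<bar> * \<bar>\<theta> (u * L) / \<theta> L\<bar>" using u by (simp add: abs_mult)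
    also have "\<dots> \<le> \<bar>t\<bar> * (C * u powr \<beta>)" using b(4)[of L u] u L by (intro mult_left_mono) auto
    also have "\<kappa> * u powr 1 + \<bar>t\<bar> * (C * u powr \<beta>) \<le> \<kappa> * u powr \<gamma> + \<bar>t\<bar> * (C * u powr \<gamma>)"
      using assms b \<gamma> by (intro add_mono mult_left_mono mono) auto
    also have "\<dots> \<le> (\<kappa> + \<bar>t\<bar> * C + 1) * u powr \<gamma>"
      by (simp add: algebra_simps)
    finally show "norm (1 - twist \<theta> t \<kappa> L s) \<le> (\<kappa> + \<bar>t\<bar> * C + 1) * (s / L) powr \<gamma>"
      by (simp add: u_def)
  next
    have "0 \<le> \<bar>t\<bar> * C" using b by simp
    then show "0 < \<kappa> + \<bar>t\<bar> * C + 1" using assms by linarith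
  qed (use \<gamma> in simp_all)
qed

lemma powr_real_at_top:
  assumes "(b::real) > 0" shows "filterlim (\<lambda>x::real. x powr b) at_top at_top"
proof -
  have "filterlim (\<lambda>x::real. exp (b * ln x)) at_top at_top"
    using assms by (intro filterlim_compose[OF exp_at_top] filterlim_tendsto_pos_mult_at_top[OF tendsto_const] ln_at_top)
  moreover have "\<forall>\<^sub>F x in at_top. exp (b * ln x) = x powr b"
    using eventually_gt_at_top[of 0] by eventually_elim (simp add: powr_def)
  ultimately show ?thesis by (simp cong: filterlim_cong)
qed

text \<open>The third condition of the class bounds \<open>\<theta> s0 / \<theta> x\<close>, for a fixed point \<open>s0\<close> at which \<open>\<theta>\<close>
  does not vanish, by a negative power of \<open>x\<close>.\<close>

lemma class_V_at_top:
  assumes "\<theta> \<in> class_V"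
  shows "filterlim (\<lambda>x. \<bar>\<theta> x\<bar>) at_top at_top"
proof -
  obtain s0 where s0: "s0 \<ge> 1" "\<theta> s0 \<noteq> 0"
  proof -
    have "\<forall>\<^sub>F x in at_top. \<theta> x \<noteq> 0" using assms by (auto simp: class_V_def regularly_varying_def)
    then have "\<forall>\<^sub>F x in at_top. \<theta> x \<noteq> 0 \<and> x \<ge> 1"
      using eventually_ge_at_top[of 1] by eventually_elim auto
    then show ?thesis using that by (auto dest: eventually_happens)
  qed
  have "\<exists>\<beta>>0. \<exists>C>0. \<exists>x0>0. \<forall>x\<ge>x0. \<forall>u. s0 / x \<le> u \<and> u \<le> 1 \<longrightarrow>
        \<bar>\<theta> (u * x) / \<theta> x\<bar> \<le> C * u powr \<beta>"
    using assms(1) s0 unfolding class_V_def by (auto elim!: allE[of _ s0])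
  then obtain \<beta> C x0 where b: "\<beta> > 0" "C > 0" "x0 > 0"
    "\<And>x u. x \<ge> x0 \<Longrightarrow> s0 / x \<le> u \<Longrightarrow> u \<le> 1 \<Longrightarrow> \<bar>\<theta> (u * x) / \<theta> x\<bar> \<le> C * u powr \<beta>"
    by blast
  have nz: "\<forall>\<^sub>F x in at_top. \<theta> x \<noteq> 0" using assms by (auto simp: class_V_def regularly_varying_def)
  have ev: "\<forall>\<^sub>F x in at_top. \<bar>\<theta> s0\<bar> / (C * s0 powr \<beta>) * x powr \<beta> \<le> \<bar>\<theta> x\<bar>"
    using eventually_ge_at_top[of "max x0 s0"] nz
  proof eventually_elim
    case (elim x)
    have "\<bar>\<theta> s0 / \<theta> x\<bar> \<le> C * (s0 / x) powr \<beta>" using b(4)[of x "s0 / x"] elim s0 by auto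
    then show ?case using elim b s0 by (simp add: field_simps powr_divide)
  qed
  have "filterlim (\<lambda>x. \<bar>\<theta> s0\<bar> / (C * s0 powr \<beta>) * x powr \<beta>) at_top at_top"
    using s0 b by (intro filterlim_tendsto_pos_mult_at_top[OF tendsto_const] powr_real_at_top) auto
  then show ?thesis using ev by (rule filterlim_at_top_mono)
qed

lemma finite_primes_ln_le: "finite {p::nat. prime p \<and> ln (real p) \<le> L}"
proof (rule finite_subset[of _ "{..nat \<lceil>exp L\<rceil>}"])
  show "{p::nat. prime p \<and> ln (real p) \<le> L} \<subseteq> {..nat \<lceil>exp L\<rceil>}"
  proof
    fix p :: nat assume "p \<in> {p. prime p \<and> ln (real p) \<le> L}"
    then have "real p > 0" "ln (real p) \<le> L" using prime_gt_0_nat[of p] by auto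
    then have "real p \<le> exp L" using exp_ln[of "real p"] exp_le_cancel_iff[of "ln (real p)" L] by simp
    then show "p \<in> {..nat \<lceil>exp L\<rceil>}" unfolding atMost_iff by linarith
  qed
qed simp

lemma class_V_derivative:
  assumes "\<theta> \<in> class_V"
  obtains D where "\<And>x. x > 0 \<Longrightarrow> (\<theta> has_vector_derivative D x) (at x)"
    "continuous_on {0<..} D" "\<And>x. x > 0 \<Longrightarrow> deriv \<theta> x = D x"
proof -
  have "\<theta> C1_differentiable_on {0<..}" using assms by (simp add: class_V_def)
  then obtain D where D: "\<And>x. x > 0 \<Longrightarrow> (\<theta> has_vector_derivative D x) (at x)"
    "continuous_on {0<..} D" unfolding C1_differentiable_on_def by (metis greaterThan_iff)
  moreover have "deriv \<theta> x = D x" if "x > 0" for x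
    using D(1)[OF that] by (intro DERIV_imp_deriv) (simp add: has_real_derivative_iff_has_vector_derivative)
  ultimately show ?thesis using that by blast
qed

lemma twist_has_vector_derivative:
  assumes "(\<theta> has_vector_derivative D) (at s)"
  shows "((\<lambda>s. twist \<theta> t \<kappa> L s) has_vector_derivative
     (Complex (- (\<kappa> / L)) (t * D / \<theta> L) * twist \<theta> t \<kappa> L s)) (at s)"
proof -
  have eq: "Complex (- (\<kappa> * s / L)) (t * \<theta> s / \<theta> L) = s *\<^sub>R Complex (- (\<kappa> / L)) 0 + \<theta> s *\<^sub>R Complex 0 (t / \<theta> L)" for s
    by (simp add: complex_eq_iff)
  have id: "((\<lambda>s. s) has_real_derivative 1) (at s)" by (rule DERIV_ident)
  have d: "(\<theta> has_real_derivative D) (at s)" using assms by (simp add: has_real_derivative_iff_has_vector_derivative)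
  have "((\<lambda>s. s *\<^sub>R Complex (- (\<kappa> / L)) 0 + \<theta> s *\<^sub>R Complex 0 (t / \<theta> L)) has_vector_derivative
      ((s *\<^sub>R 0 + 1 *\<^sub>R Complex (- (\<kappa> / L)) 0) + (\<theta> s *\<^sub>R 0 + D *\<^sub>R Complex 0 (t / \<theta> L)))) (at s)"
    by (intro has_vector_derivative_add has_vector_derivative_scaleR id d has_vector_derivative_const)
  also have "(s *\<^sub>R 0 + 1 *\<^sub>R Complex (- (\<kappa> / L)) 0) + (\<theta> s *\<^sub>R 0 + D *\<^sub>R Complex 0 (t / \<theta> L)) =
    Complex (- (\<kappa> / L)) (t * D / \<theta> L)" by (simp add: complex_eq_iff)
  finally have "((\<lambda>s. Complex (- (\<kappa> * s / L)) (t * \<theta> s / \<theta> L)) has_vector_derivative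
     Complex (- (\<kappa> / L)) (t * D / \<theta> L)) (at s)" by (simp only: eq)
  from field_vector_diff_chain_at[OF this DERIV_exp] show ?thesis
    by (simp add: twist_def o_def)
qed

text \<open>Abel summation applied to \<open>f s = (1 - twist s) / s\<close>. The part of \<open>f'\<close> that
  differentiates the twist is at most \<open>(\<kappa> / L + |t| |\<theta>' s| / |\<theta> L|) / s\<close>, and its
  integral tends to \<open>0\<close>, for the summand with \<open>\<theta>'\<close> by the second condition of the
  class; the part that differentiates \<open>1 / s\<close> is integrated with the power bound on \<open>1 - twist\<close>.\<close>

lemma prime_sum_minus_integral_tendsto_0:
  assumes V: "\<theta> \<in> class_V" and \<kappa>: "\<kappa> \<ge> 0"
  shows "((\<lambda>L. (\<Sum>p | prime p \<and> ln (real p) \<le> L. (1 - twist \<theta> t \<kappa> L (ln (real p))) / of_nat p)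
     - (\<integral>s. indicator {ln 2..L} s *\<^sub>R ((1 / s) *\<^sub>R (1 - twist \<theta> t \<kappa> L s)) \<partial>lborel)) \<longlongrightarrow> 0) at_top"
proof -
  obtain K \<gamma> L0 where K: "K > 0" "0 < \<gamma>" "\<gamma> \<le> 1/2" "L0 \<ge> 1"
    and Kb: "\<And>L s. L \<ge> L0 \<Longrightarrow> ln 2 \<le> s \<Longrightarrow> s \<le> L \<Longrightarrow> norm (1 - twist \<theta> t \<kappa> L s) \<le> K * (s / L) powr \<gamma>"
    using one_minus_twist_bound[OF V \<kappa>, of t] by metis
  obtain D where D: "\<And>x. x > 0 \<Longrightarrow> (\<theta> has_vector_derivative D x) (at x)"
    and contD: "continuous_on {0<..} D" and derivD: "\<And>x. x > 0 \<Longrightarrow> deriv \<theta> x = D x"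
    using class_V_derivative[OF V] by metis
  obtain C where C: "\<And>x. x \<ge> 0 \<Longrightarrow> \<bar>(\<Sum>p | prime p \<and> ln (real p) \<le> x. ln (real p) / real p) - x\<bar> \<le> C"
    using mertens_first_ln by metis
  have C0: "C \<ge> 0" using C[of 0] by linarith
  have l2: "0 < ln (2::real)" "ln (2::real) \<le> 1" using ln_2_less_1 by auto
  have lp: "s > 0" if "ln 2 \<le> s" for s :: real using that l2(1) by linarith
  define J where "J = (\<integral>s. indicator {ln 2..1} s * (\<bar>D s\<bar> / s) \<partial>lborel)"
  define I where "I = (\<lambda>L. integral {1..L} (\<lambda>s. \<bar>deriv \<theta> s\<bar> / s))"
  \<comment> \<open>bounds the integral of \<open>|f'|\<close>; \<open>J\<close> is the part over \<open>[ln 2, 1]\<close>,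
    below the range of integration in the second condition of the class\<close>
  define B where "B = (\<lambda>L. \<kappa> / L * (ln L - ln (ln 2)) + \<bar>t\<bar> * (1 / \<bar>\<theta> L\<bar> * J + 1 / \<bar>\<theta> L\<bar> * I L)
      + K * L powr (-\<gamma>) * (ln 2 powr (\<gamma> - 1) / (1 - \<gamma>)))"
  have contq: "continuous_on {a..b} (\<lambda>s. \<bar>D s\<bar> / s)" if "a > 0" for a b
    using that by (intro continuous_intros continuous_on_subset[OF contD]) auto
  have intq: "integrable lborel (\<lambda>s. indicator {a..b} s * (\<bar>D s\<bar> / s))" if "a > 0" for a b
    using borel_integrable_compact[OF compact_Icc contq[OF that, of b]] by simp
  have deriv_bound: "norm ((\<Sum>p | prime p \<and> ln (real p) \<le> L. (1 - twist \<theta> t \<kappa> L (ln (real p))) / of_nat p)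
     - (\<integral>s. indicator {ln 2..L} s *\<^sub>R ((1 / s) *\<^sub>R (1 - twist \<theta> t \<kappa> L s)) \<partial>lborel))
     \<le> C * (K / L) + K * (ln 2 / L) powr \<gamma> + C * B L" if L: "L \<ge> L0" for L
  proof -
    have L1: "L \<ge> 1" "ln 2 \<le> L" using L K l2 by auto
    define f where "f = (\<lambda>s. (1 / s) *\<^sub>R (1 - twist \<theta> t \<kappa> L s))"
    define f' where "f' = (\<lambda>s. (1 / s) *\<^sub>R (- (Complex (- (\<kappa> / L)) (t * D s / \<theta> L) * twist \<theta> t \<kappa> L s))
        + (- (1 / s\<^sup>2)) *\<^sub>R (1 - twist \<theta> t \<kappa> L s))"
    define P where "P = {p::nat. prime p \<and> ln (real p) \<le> L}"
    have ln2p: "ln 2 \<le> ln (real p)" if "prime p" for p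
      using prime_ge_2_nat[OF that] by (intro ln_mono) auto
    have fder: "(f has_vector_derivative f' s) (at s)" if "ln 2 \<le> s" for s
    proof -
      have s: "s > 0" using that l2 by linarith
      have "((\<lambda>s. 1 / s) has_real_derivative (- (1 / s\<^sup>2))) (at s)"
        using s by (auto intro!: derivative_eq_intros simp: power2_eq_square)
      moreover have "((\<lambda>s. 1 - twist \<theta> t \<kappa> L s) has_vector_derivative
          (- (Complex (- (\<kappa> / L)) (t * D s / \<theta> L) * twist \<theta> t \<kappa> L s))) (at s)"
        using has_vector_derivative_diff[OF has_vector_derivative_const twist_has_vector_derivative[OF D[OF s]]]
        by simp
      ultimately show ?thesis unfolding f_def f'_def by (rule has_vector_derivative_scaleR)
    qed
    have conttw: "continuous_on {ln 2..L} (twist \<theta> t \<kappa> L)"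
    proof (intro continuous_at_imp_continuous_on ballI)
      fix s assume "s \<in> {ln 2..L}"
      then have "s > 0" by (intro lp) simp
      then show "isCont (twist \<theta> t \<kappa> L) s"
        by (rule has_vector_derivative_continuous[OF twist_has_vector_derivative[OF D]])
    qed
    have contf': "continuous_on {ln 2..L} f'"
    proof -
      have "continuous_on {ln 2..L} (\<lambda>s. Complex (- (\<kappa> / L)) (t * D s / \<theta> L))"
      proof -
        have "continuous_on {ln 2..L} D" by (rule continuous_on_subset[OF contD]) (auto intro: lp)
        then have "continuous_on {ln 2..L} (\<lambda>s. t * D s / \<theta> L)"
          using continuous_on_mult_left[of _ D "t / \<theta> L"] by simp
        then show ?thesis by (intro continuous_on_Complex continuous_on_const)
      qed
      then show ?thesis unfolding f'_def
        by (intro continuous_on_add continuous_on_scaleR continuous_on_minus continuous_on_mult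
             continuous_on_diff continuous_on_const conttw)
           (auto dest: lp intro!: continuous_intros)
    qed
    have "norm ((\<Sum>p\<in>P. (ln (real p) / real p) *\<^sub>R f (ln (real p))) - (\<integral>s. indicator {ln 2..L} s *\<^sub>R f s \<partial>lborel))
       \<le> C * norm (f L) + \<bar>ln 2\<bar> * norm (f (ln 2)) + C * (\<integral>s. indicator {ln 2..L} s * norm (f' s) \<partial>lborel)"
    proof (rule sum_minus_integral_bound[where f' = f'])
      show "finite P" unfolding P_def by (rule finite_primes_ln_le)
      show "ln 2 \<le> ln (real p) \<and> ln (real p) \<le> L" if "p \<in> P" for p
        using that ln2p by (auto simp: P_def)
      fix s assume s: "ln 2 \<le> s" "s \<le> L"
      have "{p \<in> P. ln (real p) \<le> s} = {p. prime p \<and> ln (real p) \<le> s}" using s by (auto simp: P_def)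
      then show "\<bar>(\<Sum>p\<in>{p \<in> P. ln (real p) \<le> s}. ln (real p) / real p) - s\<bar> \<le> C"
        using C[of s] s l2 by simp
    qed (use L1 fder contf' in auto)
    also have "(\<Sum>p\<in>P. (ln (real p) / real p) *\<^sub>R f (ln (real p))) =
       (\<Sum>p\<in>P. (1 - twist \<theta> t \<kappa> L (ln (real p))) / of_nat p)"
    proof (rule sum.cong[OF refl])
      fix p assume "p \<in> P"
      then have "ln (real p) > 0" "real p > 0" using ln2p[of p] l2 prime_gt_0_nat[of p] by (auto simp: P_def)
      then show "(ln (real p) / real p) *\<^sub>R f (ln (real p)) = (1 - twist \<theta> t \<kappa> L (ln (real p))) / of_nat p"
        by (simp add: f_def scaleR_conv_of_real)
    qed
    also have "norm (f L) \<le> K / L" using Kb[of L L] L L1 K by (simp add: f_def divide_right_mono)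
    also have "\<bar>ln 2\<bar> * norm (f (ln 2)) \<le> K * (ln 2 / L) powr \<gamma>"
      using Kb[of L "ln 2"] L L1 l2 by (simp add: f_def)
    also have "(\<integral>s. indicator {ln 2..L} s * norm (f' s) \<partial>lborel) \<le> B L"
    proof -
      have i1: "has_bochner_integral lborel (\<lambda>s. indicator {ln 2..L} s *\<^sub>R (1 / s)) (ln L - ln (ln 2))"
        using L1 by (intro has_bochner_integral_FTC_Icc)
          (auto dest!: lp intro!: derivative_eq_intros continuous_intros simp: has_real_derivative_iff_has_vector_derivative[symmetric])
      have i3: "has_bochner_integral lborel (\<lambda>s. indicator {ln 2..L} s *\<^sub>R (s powr (\<gamma> - 2)))
          (L powr (\<gamma> - 1) / (\<gamma> - 1) - ln 2 powr (\<gamma> - 1) / (\<gamma> - 1))"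
        using L1 K by (intro has_bochner_integral_FTC_Icc)
          (auto dest!: lp intro!: derivative_eq_intros continuous_intros simp: has_real_derivative_iff_has_vector_derivative[symmetric])
      define h where "h = (\<lambda>s. \<kappa> / L * (indicator {ln 2..L} s *\<^sub>R (1 / s))
        + \<bar>t\<bar> / \<bar>\<theta> L\<bar> * (indicator {ln 2..1} s * (\<bar>D s\<bar> / s) + indicator {1..L} s * (\<bar>D s\<bar> / s))
        + K * L powr (-\<gamma>) * (indicator {ln 2..L} s *\<^sub>R (s powr (\<gamma> - 2))))"
      have hint: "has_bochner_integral lborel h (\<kappa> / L * (ln L - ln (ln 2)) +
          \<bar>t\<bar> / \<bar>\<theta> L\<bar> * (J + (\<integral>s. indicator {1..L} s * (\<bar>D s\<bar> / s) \<partial>lborel))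
          + K * L powr (-\<gamma>) * (L powr (\<gamma> - 1) / (\<gamma> - 1) - ln 2 powr (\<gamma> - 1) / (\<gamma> - 1)))"
        unfolding h_def J_def using l2
        by (intro has_bochner_integral_add has_bochner_integral_mult_right i1 i3 has_bochner_integral_integrable intq) auto
      have le: "indicator {ln 2..L} s * norm (f' s) \<le> h s" for s
      proof (cases "s \<in> {ln 2..L}")
        case True
        then have s: "ln 2 \<le> s" "s \<le> L" "s > 0" using lp by auto
        have "norm (f' s) \<le> 1 / s * norm (Complex (- (\<kappa> / L)) (t * D s / \<theta> L) * twist \<theta> t \<kappa> L s)
            + 1 / s\<^sup>2 * norm (1 - twist \<theta> t \<kappa> L s)"
          unfolding f'_def using s by (intro order_trans[OF norm_triangle_ineq]) simp
        also have "norm (Complex (- (\<kappa> / L)) (t * D s / \<theta> L) * twist \<theta> t \<kappa> L s)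
            \<le> (\<kappa> / L + \<bar>t\<bar> / \<bar>\<theta> L\<bar> * \<bar>D s\<bar>) * 1"
          unfolding norm_mult using s L1 \<kappa>
          by (intro mult_mono norm_twist_le_1 order_trans[OF cmod_le]) (auto simp: abs_mult)
        also have "norm (1 - twist \<theta> t \<kappa> L s) \<le> K * (s / L) powr \<gamma>" using Kb L s by simp
        finally have "norm (f' s) \<le> 1 / s * (\<kappa> / L + \<bar>t\<bar> / \<bar>\<theta> L\<bar> * \<bar>D s\<bar>) + 1 / s\<^sup>2 * (K * (s / L) powr \<gamma>)"
          using s by (simp add: mult_left_mono divide_right_mono)
        also have "1 / s\<^sup>2 * (K * (s / L) powr \<gamma>) = K * L powr (-\<gamma>) * s powr (\<gamma> - 2)"
          using s L1 by (simp add: powr_divide powr_minus powr_diff field_simps power2_eq_square)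
        also have "1 / s * (\<kappa> / L + \<bar>t\<bar> / \<bar>\<theta> L\<bar> * \<bar>D s\<bar>) = \<kappa> / L * (1 / s) + \<bar>t\<bar> / \<bar>\<theta> L\<bar> * (\<bar>D s\<bar> / s)"
          by (simp add: field_simps add_divide_distrib)
        also have "\<bar>t\<bar> / \<bar>\<theta> L\<bar> * (\<bar>D s\<bar> / s) \<le> \<bar>t\<bar> / \<bar>\<theta> L\<bar> * (indicator {ln 2..1} s * (\<bar>D s\<bar> / s) + indicator {1..L} s * (\<bar>D s\<bar> / s))"
          using s by (intro mult_left_mono) (auto simp: indicator_def)
        finally show ?thesis using True by (simp add: h_def)
      next
        case False
        then have "h s \<ge> 0" unfolding h_def using K lp[of s] by (auto simp: indicator_def)
        then show ?thesis using False by simp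
      qed
      have "(\<integral>s. indicator {ln 2..L} s * norm (f' s) \<partial>lborel) \<le> (\<integral>s. h s \<partial>lborel)"
      proof (rule integral_mono[OF _ _ le])
        show "integrable lborel (\<lambda>s. indicator {ln 2..L} s * norm (f' s))"
          using integrable_norm[OF borel_integrable_compact[OF compact_Icc contf']] by simp
        show "integrable lborel h" using hint by (simp add: has_bochner_integral_iff)
      qed
      also have "\<dots> = \<kappa> / L * (ln L - ln (ln 2)) +
          \<bar>t\<bar> / \<bar>\<theta> L\<bar> * (J + (\<integral>s. indicator {1..L} s * (\<bar>D s\<bar> / s) \<partial>lborel))
          + K * L powr (-\<gamma>) * (L powr (\<gamma> - 1) / (\<gamma> - 1) - ln 2 powr (\<gamma> - 1) / (\<gamma> - 1))"
        using hint by (simp add: has_bochner_integral_iff)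
      also have "(\<integral>s. indicator {1..L} s * (\<bar>D s\<bar> / s) \<partial>lborel) = I L"
      proof -
        have "(LINT s:{1..L}|lborel. \<bar>D s\<bar> / s) = integral {1..L} (\<lambda>s. \<bar>D s\<bar> / s)"
          by (intro set_borel_integral_eq_integral borel_integrable_atLeastAtMost' contq) auto
        also have "\<dots> = I L" unfolding I_def by (rule integral_cong) (simp add: derivD)
        finally show ?thesis by (simp add: set_lebesgue_integral_def)
      qed
      also have "K * L powr (-\<gamma>) * (L powr (\<gamma> - 1) / (\<gamma> - 1) - ln 2 powr (\<gamma> - 1) / (\<gamma> - 1))
          \<le> K * L powr (-\<gamma>) * (ln 2 powr (\<gamma> - 1) / (1 - \<gamma>))"
      proof (rule mult_left_mono)
        have "L powr (\<gamma> - 1) / (\<gamma> - 1) \<le> 0" using K by (simp add: divide_nonneg_neg)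
        moreover have "- (ln 2 powr (\<gamma> - 1) / (\<gamma> - 1)) = ln 2 powr (\<gamma> - 1) / (1 - \<gamma>)"
          using K by (simp add: field_simps)
        ultimately show "L powr (\<gamma> - 1) / (\<gamma> - 1) - ln 2 powr (\<gamma> - 1) / (\<gamma> - 1) \<le> ln 2 powr (\<gamma> - 1) / (1 - \<gamma>)"
          by linarith
      qed (use K in auto)
      finally show ?thesis unfolding B_def by (simp add: algebra_simps add_divide_distrib)
    qed
    finally show ?thesis using C0 unfolding P_def f_def by (simp add: mult_left_mono)
  qed
  have inv0: "((\<lambda>L. 1 / \<bar>\<theta> L\<bar>) \<longlongrightarrow> 0) at_top"
    using tendsto_inverse_0_at_top[OF class_V_at_top[OF V]] by (simp add: inverse_eq_divide)
  have I0: "((\<lambda>L. 1 / \<bar>\<theta> L\<bar> * I L) \<longlongrightarrow> 0) at_top"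
    using V unfolding I_def class_V_def by simp
  have id: "filterlim (\<lambda>L::real. L) at_top at_top" by (rule filterlim_ident)
  have inv: "((\<lambda>L::real. 1 / L) \<longlongrightarrow> 0) at_top"
    using tendsto_inverse_0_at_top[OF id] by (simp add: inverse_eq_divide)
  have lnL: "((\<lambda>L::real. ln L / L) \<longlongrightarrow> 0) at_top" by real_asymp
  have "((\<lambda>L. \<kappa> * (ln L / L) - \<kappa> * ln (ln 2) * (1 / L)) \<longlongrightarrow> \<kappa> * 0 - \<kappa> * ln (ln 2) * 0) at_top"
    by (intro tendsto_intros inv lnL)
  then have "((\<lambda>L. \<kappa> / L * (ln L - ln (ln 2))) \<longlongrightarrow> 0) at_top" by (simp add: algebra_simps)
  moreover have "((\<lambda>L. L powr (-\<gamma>)) \<longlongrightarrow> 0) at_top" using K by (intro tendsto_neg_powr id) auto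
  ultimately have "(B \<longlongrightarrow> 0 + \<bar>t\<bar> * (0 * J + 0) + K * 0 * (ln 2 powr (\<gamma> - 1) / (1 - \<gamma>))) at_top"
    unfolding B_def by (intro tendsto_intros inv0 I0)
  then have B0: "(B \<longlongrightarrow> 0) at_top" by simp
  have "((\<lambda>L. C * K * (1 / L)) \<longlongrightarrow> C * K * 0) at_top" by (intro tendsto_intros inv)
  then have "((\<lambda>L. C * (K / L)) \<longlongrightarrow> 0) at_top" by simp
  moreover have "((\<lambda>L. (ln 2 / L) powr \<gamma>) \<longlongrightarrow> 0) at_top"
  proof -
    have "((\<lambda>L. ln 2 powr \<gamma> * L powr (-\<gamma>)) \<longlongrightarrow> ln 2 powr \<gamma> * 0) at_top"
      using K by (intro tendsto_intros tendsto_neg_powr id) auto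
    then have "((\<lambda>L. ln 2 powr \<gamma> * L powr (-\<gamma>)) \<longlongrightarrow> 0) at_top" by simp
    moreover have "\<forall>\<^sub>F L in at_top. ln 2 powr \<gamma> * L powr (-\<gamma>) = (ln 2 / L) powr \<gamma>"
      using eventually_gt_at_top[of 0]
      by eventually_elim (use l2 in \<open>simp add: powr_divide powr_minus field_simps\<close>)
    ultimately show ?thesis by (rule Lim_transform_eventually)
  qed
  ultimately have "((\<lambda>L. C * (K / L) + K * (ln 2 / L) powr \<gamma> + C * B L) \<longlongrightarrow> 0 + K * 0 + C * 0) at_top"
    by (intro tendsto_intros B0)
  then have lim: "((\<lambda>L. C * (K / L) + K * (ln 2 / L) powr \<gamma> + C * B L) \<longlongrightarrow> 0) at_top" by simp
  show ?thesis
    by (rule Lim_null_comparison[OF _ lim])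
      (use deriv_bound in \<open>auto intro: eventually_mono[OF eventually_ge_at_top[of L0]]\<close>)
qed

lemma integrable_powr_unit_interval:
  assumes "\<gamma> > 0"
  shows "integrable lborel (\<lambda>u::real. indicator {0<..1} u * u powr (\<gamma> - 1))"
proof -
  have "((\<lambda>u. u powr (\<gamma> - 1)) has_integral (1 powr (\<gamma> - 1 + 1) / (\<gamma> - 1 + 1))) {0..1}"
    using assms by (intro has_integral_powr_from_0) auto
  then have "(\<lambda>u::real. u powr (\<gamma> - 1)) integrable_on {0..1}" by blast
  then have "(\<lambda>u::real. u powr (\<gamma> - 1)) absolutely_integrable_on {0..1}"
    by (intro nonnegative_absolutely_integrable_1) auto
  then have "integrable lebesgue (\<lambda>u::real. indicator {0..1} u *\<^sub>R u powr (\<gamma> - 1))"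
    by (simp add: set_integrable_def)
  then have "integrable lborel (\<lambda>u::real. indicator {0..1} u *\<^sub>R u powr (\<gamma> - 1))"
    by (subst (asm) integrable_completion) auto
  moreover have "(\<lambda>u::real. indicator {0..1} u *\<^sub>R u powr (\<gamma> - 1)) = (\<lambda>u. indicator {0<..1} u * u powr (\<gamma> - 1))"
    by (rule ext) (auto simp: indicator_def less_le)
  ultimately show ?thesis by simp
qed

text \<open>Substitute \<open>s = L u\<close>. The integrand then converges pointwise by regular variation and is dominated by
  a multiple of \<open>u\<close> to the power \<open>\<gamma> - 1\<close>.\<close>

lemma scaled_integral_tendsto:
  assumes V: "\<theta> \<in> class_V" and rv: "regularly_varying \<theta> \<alpha>" and \<kappa>: "\<kappa> \<ge> 0"
  shows "((\<lambda>L. \<integral>s. indicator {ln 2..L} s *\<^sub>R ((1 / s) *\<^sub>R (1 - twist \<theta> t \<kappa> L s)) \<partial>lborel) \<longlongrightarrow>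
     (\<integral>u. indicator {0<..1} u *\<^sub>R ((1 / u) *\<^sub>R (1 - limit_twist \<alpha> t \<kappa> u)) \<partial>lborel)) at_top"
proof -
  obtain K \<gamma> L0 where K: "K > 0" "0 < \<gamma>" "\<gamma> \<le> 1/2" "L0 \<ge> 1"
    and Kb: "\<And>L s. L \<ge> L0 \<Longrightarrow> ln 2 \<le> s \<Longrightarrow> s \<le> L \<Longrightarrow> norm (1 - twist \<theta> t \<kappa> L s) \<le> K * (s / L) powr \<gamma>"
    using one_minus_twist_bound[OF V \<kappa>, of t] by metis
  obtain D where D: "\<And>x. x > 0 \<Longrightarrow> (\<theta> has_vector_derivative D x) (at x)"
    using class_V_derivative[OF V] by metis
  have l2: "0 < ln (2::real)" by simp
  \<comment> \<open>Dominated convergence needs measurability for every \<open>L\<close>, so small \<open>L\<close> get the integrand \<open>0\<close>: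
    nothing is known about \<open>\<theta>\<close> on the negative half-line.\<close>
  define h where "h = (\<lambda>L u. if L \<ge> 1 then indicator {ln 2 / L..1} u *\<^sub>R ((1 / u) *\<^sub>R (1 - twist \<theta> t \<kappa> L (L * u))) else 0)"
  have scale: "(\<integral>s. indicator {ln 2..L} s *\<^sub>R ((1 / s) *\<^sub>R (1 - twist \<theta> t \<kappa> L s)) \<partial>lborel) = (\<integral>u. h L u \<partial>lborel)"
    if L: "L \<ge> 1" for L
  proof -
    have "(\<integral>s. indicator {ln 2..L} s *\<^sub>R ((1 / s) *\<^sub>R (1 - twist \<theta> t \<kappa> L s)) \<partial>lborel) =
      \<bar>L\<bar> *\<^sub>R (\<integral>u. indicator {ln 2..L} (0 + L * u) *\<^sub>R ((1 / (0 + L * u)) *\<^sub>R (1 - twist \<theta> t \<kappa> L (0 + L * u))) \<partial>lborel)"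
      using L by (intro lborel_integral_real_affine) auto
    also have "\<dots> = (\<integral>u. L *\<^sub>R (indicator {ln 2..L} (L * u) *\<^sub>R ((1 / (L * u)) *\<^sub>R (1 - twist \<theta> t \<kappa> L (L * u)))) \<partial>lborel)"
    proof -
      have "\<bar>L\<bar> = L" using L by simp
      then show ?thesis by (simp only: add_0 integral_scaleR_right)
    qed
    also have "(\<lambda>u. L *\<^sub>R (indicator {ln 2..L} (L * u) *\<^sub>R ((1 / (L * u)) *\<^sub>R (1 - twist \<theta> t \<kappa> L (L * u))))) = h L"
      using L by (auto simp: h_def fun_eq_iff indicator_def field_simps)
    finally show ?thesis .
  qed
  have contL: "continuous_on {ln 2 / L..1} (\<lambda>u. (1 / u) *\<^sub>R (1 - twist \<theta> t \<kappa> L (L * u)))" if L: "L \<ge> 1" for L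
  proof -
    have pos: "ln 2 / L > 0" using l2 L by (intro divide_pos_pos) auto
    have ct: "continuous_on {0<..} (twist \<theta> t \<kappa> L)"
    proof (intro continuous_at_imp_continuous_on ballI)
      fix s :: real assume "s \<in> {0<..}"
      then show "isCont (twist \<theta> t \<kappa> L) s"
        by (intro has_vector_derivative_continuous[OF twist_has_vector_derivative[OF D]]) simp
    qed
    have "continuous_on {ln 2 / L..1} (\<lambda>u. twist \<theta> t \<kappa> L (L * u))"
    proof (rule continuous_on_compose2[OF ct])
      show "(\<lambda>u. L * u) ` {ln 2 / L..1} \<subseteq> {0<..}"
      proof
        fix y assume "y \<in> (\<lambda>u. L * u) ` {ln 2 / L..1}"
        then obtain u where "y = L * u" "ln 2 / L \<le> u" by (metis (no_types, lifting) imageE atLeastAtMost_iff)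
          moreover from this have "u > 0" using pos by linarith
          ultimately show "y \<in> {0<..}" using L by (auto intro!: mult_pos_pos)
      qed
    qed (intro continuous_intros)
    then show ?thesis using pos
      by (intro continuous_on_scaleR continuous_on_diff continuous_on_const continuous_on_divide continuous_on_id) auto
  qed
  have meas: "h L \<in> borel_measurable lborel" for L
  proof (cases "L \<ge> 1")
    case True
    then show ?thesis unfolding h_def
      using borel_measurable_continuous_on_indicator[OF _ contL[OF True]] by simp
  qed (simp add: h_def)
  have lim: "((\<lambda>L. h L u) \<longlongrightarrow> indicator {0<..1} u *\<^sub>R ((1 / u) *\<^sub>R (1 - limit_twist \<alpha> t \<kappa> u))) at_top" for u
  proof (cases "u \<in> {0<..1}")
    case False
    have "\<forall>\<^sub>F L in at_top. h L u = 0"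
      using eventually_ge_at_top[of 1]
    proof eventually_elim
      case (elim L)
      then have "ln 2 / L > 0" using l2 by (intro divide_pos_pos) auto
      then show ?case using False by (auto simp: h_def indicator_def)
    qed
    then show ?thesis using False by (simp add: tendsto_eventually)
  next
    case True
    then have u: "0 < u" "u \<le> 1" by auto
    have "((\<lambda>L. \<theta> (u * L) / \<theta> L) \<longlongrightarrow> u powr \<alpha>) at_top"
      using rv u by (simp add: regularly_varying_def)
    then have "((\<lambda>L. (1 / u) *\<^sub>R (1 - exp (Complex (- (\<kappa> * u)) (t * (\<theta> (u * L) / \<theta> L))))) \<longlongrightarrow>
        (1 / u) *\<^sub>R (1 - exp (Complex (- (\<kappa> * u)) (t * u powr \<alpha>)))) at_top"
      by (intro tendsto_intros tendsto_Complex)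
    moreover have "\<forall>\<^sub>F L in at_top. (1 / u) *\<^sub>R (1 - exp (Complex (- (\<kappa> * u)) (t * (\<theta> (u * L) / \<theta> L)))) = h L u"
      using eventually_ge_at_top[of 1] eventually_ge_at_top[of "ln 2 / u"]
    proof eventually_elim
      case (elim L)
      then have "ln 2 / L \<le> u" using u by (simp add: field_simps)
      then show ?case using elim u by (simp add: h_def twist_def mult.commute)
    qed
    ultimately show ?thesis using True
      by (auto simp: limit_twist_def intro: Lim_transform_eventually)
  qed
  have "((\<lambda>L. \<integral>u. h L u \<partial>lborel) \<longlongrightarrow>
     (\<integral>u. indicator {0<..1} u *\<^sub>R ((1 / u) *\<^sub>R (1 - limit_twist \<alpha> t \<kappa> u)) \<partial>lborel)) at_top"
  proof (rule integral_dominated_convergence_at_top)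
    show "integrable lborel (\<lambda>u. K * (indicator {0<..1} u * u powr (\<gamma> - 1)))"
      using K by (intro integrable_mult_right integrable_powr_unit_interval)
    show "\<forall>\<^sub>F L in at_top. AE u in lborel. norm (h L u) \<le> K * (indicator {0<..1} u * u powr (\<gamma> - 1))"
      using eventually_ge_at_top[of L0]
    proof eventually_elim
      case (elim L)
      then have L: "L \<ge> 1" using K by simp
      have "norm (h L u) \<le> K * (indicator {0<..1} u * u powr (\<gamma> - 1))" for u
      proof (cases "u \<in> {ln 2 / L..1}")
        case True
        have pos: "ln 2 / L > 0" using l2 L by (intro divide_pos_pos) auto
        have lu: "ln 2 / L \<le> u" "u \<le> 1" using True by auto
        have u: "0 < u" "u \<le> 1" "ln 2 \<le> L * u" "L * u \<le> L"
          using pos lu L by (linarith, simp, simp add: pos_divide_le_eq mult.commute, simp)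
        have "norm (h L u) = 1 / u * norm (1 - twist \<theta> t \<kappa> L (L * u))"
          using True L u by (simp add: h_def)
        also have "\<dots> \<le> 1 / u * (K * (L * u / L) powr \<gamma>)"
          using Kb[OF elim u(3,4)] u by (intro mult_left_mono) auto
        also have "\<dots> = K * (indicator {0<..1} u * u powr (\<gamma> - 1))"
          using u L by (simp add: powr_diff)
        finally show ?thesis .
      next
        case False
        then show ?thesis using K L by (simp add: h_def)
      qed
      then show ?case by simp
    qed
    show "(\<lambda>u. indicator {0<..1} u *\<^sub>R ((1 / u) *\<^sub>R (1 - limit_twist \<alpha> t \<kappa> u))) \<in> borel_measurable lborel"
    proof (rule borel_measurable_LIMSEQ_metric)
      show "(\<lambda>n. h (real n) u) \<longlonglongrightarrow> indicator {0<..1} u *\<^sub>R ((1 / u) *\<^sub>R (1 - limit_twist \<alpha> t \<kappa> u))" for u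
        using filterlim_compose[OF lim filterlim_real_sequentially] .
    qed (rule meas)
  qed (use meas lim in auto)
  then show ?thesis
    by (rule Lim_transform_eventually)
      (use scale in \<open>auto intro: eventually_mono[OF eventually_ge_at_top[of 1]]\<close>)
qed

section \<open>Random smooth numbers\<close>

text \<open>For \<open>x = 1 / p\<close> this is the Euler factor at \<open>p\<close>, normalised by its value at \<open>z = 1\<close>.\<close>

lemma expectation_power_geometric_pmf:
  fixes z :: complex
  assumes x: "0 < x" "x \<le> 1/2" and z: "norm z \<le> 1"
  shows "measure_pmf.expectation (geometric_pmf (1 - x)) (\<lambda>j. z ^ j) = (1 - of_real x) / (1 - of_real x * z)"
proof -
  have n: "norm (of_real x * z) < 1"
  proof -
    have "norm (of_real x * z) \<le> x * 1" unfolding norm_mult using x z by (intro mult_mono) auto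
    then show ?thesis using x by linarith
  qed
  have s: "(\<lambda>j. (1 - of_real x) * (of_real x * z) ^ j) sums ((1 - of_real x) * (1 / (1 - of_real x * z)))"
    by (intro sums_mult geometric_sums n)
  have eq: "(1 - of_real x) * (of_real x * z) ^ j = pmf (geometric_pmf (1 - x)) j *\<^sub>R z ^ j" for j
    using x by (simp add: scaleR_conv_of_real power_mult_distrib)
  have "measure_pmf.expectation (geometric_pmf (1 - x)) (\<lambda>j. z ^ j) =
        (\<integral>j. pmf (geometric_pmf (1 - x)) j *\<^sub>R z ^ j \<partial>count_space UNIV)"
    unfolding measure_pmf_eq_density by (subst integral_density) auto
  also have "\<dots> = (\<Sum>j. pmf (geometric_pmf (1 - x)) j *\<^sub>R z ^ j)"
  proof (rule integral_count_space_nat)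
    have "summable (\<lambda>j. x ^ j)" using x by (intro summable_geometric) auto
    then have "summable (\<lambda>j. norm (pmf (geometric_pmf (1 - x)) j *\<^sub>R z ^ j))"
    proof (rule summable_comparison_test'[where N = 0])
      fix j
      have "x ^ j * (1 - x) * norm (z ^ j) \<le> x ^ j * 1 * 1"
        using x z by (intro mult_mono) (auto simp: norm_power power_le_one)
      then show "norm (norm (pmf (geometric_pmf (1 - x)) j *\<^sub>R z ^ j)) \<le> x ^ j" using x by simp
    qed
    then show "integrable (count_space UNIV) (\<lambda>j. pmf (geometric_pmf (1 - x)) j *\<^sub>R z ^ j)"
      by (simp add: integrable_count_space_nat_iff)
  qed
  also have "\<dots> = (1 - of_real x) / (1 - of_real x * z)"
    using s unfolding eq by (simp add: sums_iff)
  finally show ?thesis .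
qed

lemma expectation_prod_Pi_pmf_complex:
  fixes f :: "'i \<Rightarrow> 'a \<Rightarrow> complex"
  assumes fin: "finite I" and b: "\<And>i a. i \<in> I \<Longrightarrow> norm (f i a) \<le> 1"
  shows "measure_pmf.expectation (Pi_pmf I d p) (\<lambda>g. \<Prod>i\<in>I. f i (g i)) =
           (\<Prod>i\<in>I. measure_pmf.expectation (p i) (f i))"
proof (cases "I = {}")
  case False
  have "measure_pmf.expectation (Pi_pmf I d p) (\<lambda>g. \<Prod>i\<in>I. f i (g i)) =
      (\<Prod>i\<in>I. measure_pmf.expectation (Pi_pmf I d p) (\<lambda>g. f i (g i)))"
  proof (rule prob_space.indep_vars_lebesgue_integral)
    show "prob_space.indep_vars (measure_pmf (Pi_pmf I d p)) (\<lambda>_. borel) (\<lambda>i g. f i (g i)) I"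
      by (rule prob_space.indep_vars_compose2[OF _ indep_vars_Pi_pmf[OF fin]])
         (auto intro: prob_space_measure_pmf)
    show "integrable (measure_pmf (Pi_pmf I d p)) (\<lambda>g. f i (g i))" if "i \<in> I" for i
      using b[OF that] by (intro measure_pmf.integrable_const_bound[where B = 1]) auto
  qed (use fin prob_space_measure_pmf in auto)
  also have "\<dots> = (\<Prod>i\<in>I. measure_pmf.expectation (p i) (f i))"
  proof (rule prod.cong[OF refl])
    fix i assume "i \<in> I"
    have "measure_pmf.expectation (Pi_pmf I d p) (\<lambda>g. f i (g i)) =
       measure_pmf.expectation (map_pmf (\<lambda>g. g i) (Pi_pmf I d p)) (f i)" by simp
    also have "map_pmf (\<lambda>g. g i) (Pi_pmf I d p) = p i"
      using \<open>i \<in> I\<close> fin by (simp add: Pi_pmf_component)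
    finally show "measure_pmf.expectation (Pi_pmf I d p) (\<lambda>g. f i (g i)) = measure_pmf.expectation (p i) (f i)" .
  qed
  finally show ?thesis .
qed simp

definition primes_le :: "nat \<Rightarrow> nat set" where
  "primes_le n = {p. prime p \<and> p \<le> n}"

definition prime_exponents_pmf :: "nat \<Rightarrow> (nat \<Rightarrow> nat) pmf" where
  "prime_exponents_pmf n = Pi_pmf (primes_le n) 0 (\<lambda>p. geometric_pmf (1 - 1 / real p))"

definition prime_power_product :: "nat \<Rightarrow> (nat \<Rightarrow> nat) \<Rightarrow> nat" where
  "prime_power_product n g = (\<Prod>p\<in>primes_le n. p ^ g p)"

text \<open>The law of a random integer all of whose prime factors are at most \<open>n\<close> and whose weights are
  proportional to \<open>1 / k\<close>.\<close>

definition smooth_pmf :: "nat \<Rightarrow> nat pmf" where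
  "smooth_pmf n = map_pmf (prime_power_product n) (prime_exponents_pmf n)"

lemma finite_primes_le [simp]: "finite (primes_le n)"
  by (rule finite_subset[of _ "{..n}"]) (auto simp: primes_le_def)

lemma primes_leD: "p \<in> primes_le n \<Longrightarrow> prime p" "p \<in> primes_le n \<Longrightarrow> p \<le> n"
  by (auto simp: primes_le_def)

lemma multiplicity_prime_power_product:
  assumes "prime q"
  shows "multiplicity q (prime_power_product n g) = (if q \<in> primes_le n then g q else 0)"
proof -
  have "multiplicity q (\<Prod>p\<in>primes_le n. p ^ g p) = (if q \<in> primes_le n then g q else 0)"
    using assms by (intro multiplicity_prod_prime_powers) (auto dest: primes_leD)
  then show ?thesis by (simp add: prime_power_product_def)
qed

lemma prime_power_product_pos: "prime_power_product n g > 0"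
  unfolding prime_power_product_def by (intro prod_pos) (auto dest: primes_leD prime_gt_0_nat)

lemma prime_factors_prime_power_product: "prime_factors (prime_power_product n g) \<subseteq> primes_le n"
proof
  fix q assume "q \<in> prime_factors (prime_power_product n g)"
  then have "prime q" "multiplicity q (prime_power_product n g) > 0"
    by (auto simp: prime_factors_multiplicity)
  then show "q \<in> primes_le n" using multiplicity_prime_power_product[of q n g] by (auto split: if_splits)
qed

lemma induced_prime_power_product:
  "induced \<theta> (prime_power_product n g) = (\<Sum>p\<in>primes_le n. real (g p) * \<theta> (ln (real p)))"
proof -
  have "induced \<theta> (prime_power_product n g) =
     (\<Sum>p\<in>primes_le n. real (multiplicity p (prime_power_product n g)) * \<theta> (ln (real p)))"
    unfolding induced_def using prime_factors_prime_power_product[of n g]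
    by (intro sum.mono_neutral_left)
       (auto simp: prime_factors_multiplicity primes_le_def)
  also have "\<dots> = (\<Sum>p\<in>primes_le n. real (g p) * \<theta> (ln (real p)))"
    by (intro sum.cong) (auto simp: multiplicity_prime_power_product primes_le_def)
  finally show ?thesis .
qed

lemma ln_prime_power_product:
  "ln (real (prime_power_product n g)) = (\<Sum>p\<in>primes_le n. real (g p) * ln (real p))"
  unfolding prime_power_product_def of_nat_prod
  by (subst ln_prod) (auto simp: ln_realpow primes_le_def dest: prime_gt_0_nat)

text \<open>By unique factorisation at most one exponent vector produces \<open>k\<close>, namely the one of its
  multiplicities at the primes up to \<open>n\<close>; it does produce \<open>k\<close> as soon as \<open>k \<le> n\<close>, because then no larger
  prime divides \<open>k\<close>.\<close>

lemma pmf_smooth: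
  assumes "k > 0"
  shows "pmf (smooth_pmf n) k \<le> (\<Prod>p\<in>primes_le n. 1 - 1 / real p) / real k"
    and "k \<le> n \<Longrightarrow> pmf (smooth_pmf n) k = (\<Prod>p\<in>primes_le n. 1 - 1 / real p) / real k"
proof -
  let ?P = "primes_le n"
  define g where "g = (\<lambda>q. if q \<in> ?P then multiplicity q k else 0)"
  have sub: "h = g" if "h \<in> set_pmf (prime_exponents_pmf n)" "prime_power_product n h = k" for h
  proof
    fix q
    have "\<forall>x. x \<notin> ?P \<longrightarrow> h x = 0"
      using that(1) by (auto simp: prime_exponents_pmf_def set_Pi_pmf PiE_dflt_def)
    then show "h q = g q" using multiplicity_prime_power_product[of q n h] that(2)
      by (auto simp: g_def dest: primes_leD)
  qed
  have pmfg: "pmf (prime_exponents_pmf n) g = (\<Prod>p\<in>?P. 1 - 1 / real p) / real (prime_power_product n g)"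
  proof -
    have "pmf (prime_exponents_pmf n) g = (\<Prod>p\<in>?P. pmf (geometric_pmf (1 - 1 / real p)) (g p))"
      unfolding prime_exponents_pmf_def by (subst pmf_Pi) (auto simp: g_def)
    also have "\<dots> = (\<Prod>p\<in>?P. (1 - 1 / real p) / real p ^ g p)"
    proof (rule prod.cong[OF refl])
      fix p assume "p \<in> ?P"
      then have "real p \<ge> 2" using prime_ge_2_nat[of p] by (auto dest: primes_leD)
      then show "pmf (geometric_pmf (1 - 1 / real p)) (g p) = (1 - 1 / real p) / real p ^ g p"
        by (subst pmf_geometric) (auto simp: power_divide)
    qed
    finally show ?thesis by (simp add: prod_dividef prime_power_product_def)
  qed
  have eq: "pmf (smooth_pmf n) k = measure (measure_pmf (prime_exponents_pmf n)) {h. prime_power_product n h = k}"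
    by (simp add: smooth_pmf_def pmf_map vimage_def)
  have prod0: "(\<Prod>p\<in>?P. 1 - 1 / real p) \<ge> 0"
    by (intro prod_nonneg) (auto simp: primes_le_def dest: prime_ge_1_nat)
  show "pmf (smooth_pmf n) k \<le> (\<Prod>p\<in>?P. 1 - 1 / real p) / real k"
  proof (cases "prime_power_product n g = k")
    case True
    have "measure (measure_pmf (prime_exponents_pmf n)) {h. prime_power_product n h = k}
       \<le> measure (measure_pmf (prime_exponents_pmf n)) {g}"
      using sub by (intro measure_pmf.finite_measure_mono_AE) (auto simp: AE_measure_pmf_iff)
    then show ?thesis using True pmfg by (simp add: eq measure_pmf_single)
  next
    case False
    then have "measure (measure_pmf (prime_exponents_pmf n)) {h. prime_power_product n h = k} = 0"
      using sub by (subst measure_pmf_zero_iff) auto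
    then show ?thesis using prod0 by (simp add: eq)
  qed
  show "pmf (smooth_pmf n) k = (\<Prod>p\<in>?P. 1 - 1 / real p) / real k" if kn: "k \<le> n"
  proof -
    have gk: "prime_power_product n g = k"
    proof -
      have "prime_power_product n g = (\<Prod>p\<in>?P. p ^ multiplicity p k)"
        unfolding prime_power_product_def by (intro prod.cong) (auto simp: g_def)
      also have "\<dots> = (\<Prod>p\<in>prime_factors k. p ^ multiplicity p k)"
      proof (rule prod.mono_neutral_right)
        show "prime_factors k \<subseteq> ?P"
        proof
          fix q assume "q \<in> prime_factors k"
          then have "prime q" "q dvd k" by (auto simp: in_prime_factors_iff)
          then show "q \<in> ?P" using dvd_imp_le[of q k] kn assms by (simp add: primes_le_def)
        qed
      qed (auto simp: primes_le_def prime_factors_multiplicity)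
      also have "\<dots> = k" using assms by (simp add: prime_factorization_nat[symmetric])
      finally show ?thesis .
    qed
    have "measure (measure_pmf (prime_exponents_pmf n)) {h. prime_power_product n h = k}
        = measure (measure_pmf (prime_exponents_pmf n)) {g}"
      using sub gk by (intro measure_pmf.finite_measure_eq_AE) (auto simp: AE_measure_pmf_iff)
    then show ?thesis using pmfg gk by (simp add: eq measure_pmf_single)
  qed
qed

text \<open>With \<open>d = x (1 - z)\<close>, both terms equal \<open>1 - d\<close> up to an error of order \<open>x |d|\<close>. The bounds by \<open>1\<close>
  allow products of such factors to be compared term by term.\<close>

lemma euler_factor_minus_exp:
  fixes z :: complex
  assumes x: "0 < x" "x \<le> 1/2" and z: "norm z \<le> 1"
  shows "norm ((1 - of_real x) / (1 - of_real x * z)) \<le> 1"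
    and "norm (exp (- (of_real x * (1 - z)))) \<le> 1"
    and "norm ((1 - of_real x) / (1 - of_real x * z) - exp (- (of_real x * (1 - z)))) \<le> 8 * x\<^sup>2 * norm (1 - z)"
proof -
  define d where "d = of_real x * (1 - z)"
  have xz: "norm (of_real x * z) \<le> x"
    using x z by (simp add: norm_mult mult_left_le)
  have den: "norm (1 - of_real x * z) \<ge> 1 - x"
    using norm_triangle_ineq2[of 1 "of_real x * z"] xz by simp
  then have den2: "norm (1 - of_real x * z) \<ge> 1/2" "1 - of_real x * z \<noteq> 0" using x by (linarith, auto)
  have "norm (1 - of_real x :: complex) = 1 - x"
  proof -
    have "(1 - of_real x :: complex) = of_real (1 - x)" by simp
    then show ?thesis using x by (simp only: norm_of_real)
  qed
  then show "norm ((1 - of_real x) / (1 - of_real x * z)) \<le> 1"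
    using den den2 x by (simp add: norm_divide divide_le_eq_1)
  have Re: "Re d = x * (1 - Re z)" by (simp add: d_def)
  have "Re z \<le> 1" using z complex_Re_le_cmod[of z] by linarith
  then have Re0: "Re d \<ge> 0" using x by (simp add: Re)
  then show "norm (exp (- (of_real x * (1 - z)))) \<le> 1" by (simp flip: d_def)
  have nd: "norm d = x * norm (1 - z)" using x by (simp add: d_def norm_mult)
  have "norm (1 - z) \<le> 2" using norm_triangle_ineq4[of 1 z] z by simp
  then have nd2: "norm d \<le> 2 * x" using x by (simp add: nd)
  have "(1 - of_real x) / (1 - of_real x * z) - (1 - d) = - (d * (of_real x * z) / (1 - of_real x * z))"
    using den2 by (simp add: d_def divide_simps) (simp add: algebra_simps)
  then have "norm ((1 - of_real x) / (1 - of_real x * z) - (1 - d)) = norm d * norm (of_real x * z) / norm (1 - of_real x * z)"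
    by (simp add: norm_divide norm_mult)
  also have "\<dots> \<le> norm d * x / (1/2)"
    using den2 xz x by (intro frac_le mult_left_mono) auto
  finally have 1: "norm ((1 - of_real x) / (1 - of_real x * z) - (1 - d)) \<le> 2 * x * norm d" by (simp add: mult_ac)
  have "norm (exp (- d) - (\<Sum>k\<le>1. (- d) ^ k / fact k)) \<le> exp \<bar>Re (- d)\<bar> * norm (- d) ^ Suc 1 / fact 1"
    by (rule Taylor_exp)
  then have "norm (exp (- d) - (1 - d)) \<le> exp \<bar>Re d\<bar> * (norm d * norm d)" by (simp add: power2_eq_square)
  also have "\<dots> \<le> 3 * (norm d * (2 * x))"
  proof (intro mult_mono nd2)
    have "\<bar>Re d\<bar> \<le> 1" using abs_Re_le_cmod[of d] nd2 x by linarith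
    then have "exp \<bar>Re d\<bar> \<le> exp 1" by simp
    then show "exp \<bar>Re d\<bar> \<le> 3" using exp_le by linarith
  qed (use x in auto)
  finally have 2: "norm (exp (- d) - (1 - d)) \<le> 6 * x * norm d" by (simp add: mult_ac)
  have "norm ((1 - of_real x) / (1 - of_real x * z) - exp (- d)) =
    norm (((1 - of_real x) / (1 - of_real x * z) - (1 - d)) - (exp (- d) - (1 - d)))" by simp
  also have "\<dots> \<le> 2 * x * norm d + 6 * x * norm d"
    by (intro order_trans[OF norm_triangle_ineq4] add_mono 1 2)
  also have "\<dots> = 8 * x\<^sup>2 * norm (1 - z)" by (simp add: nd power2_eq_square)
  finally show "norm ((1 - of_real x) / (1 - of_real x * z) - exp (- (of_real x * (1 - z)))) \<le> 8 * x\<^sup>2 * norm (1 - z)"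
    by (simp add: d_def)
qed

text \<open>Replacing each Euler factor by the exponential costs at most \<open>8 |1 - z\<^sub>p| / p\<^sup>2\<close>. The power bound on
  \<open>1 - twist\<close>, together with \<open>ln p \<le> p\<close>, makes the total a convergent series over \<open>p\<close> times a negative power of
  \<open>ln n\<close>.\<close>

lemma euler_product_tendsto:
  assumes V: "\<theta> \<in> class_V" and rv: "regularly_varying \<theta> \<alpha>" and \<kappa>: "\<kappa> \<ge> 0"
  shows "(\<lambda>n. \<Prod>p\<in>primes_le n. (1 - of_real (1 / real p)) / (1 - of_real (1 / real p) * twist \<theta> t \<kappa> (ln (real n)) (ln (real p))))
     \<longlonglongrightarrow> exp (- (\<integral>u. indicator {0<..1} u *\<^sub>R ((1 / u) *\<^sub>R (1 - limit_twist \<alpha> t \<kappa> u)) \<partial>lborel))"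
proof -
  obtain K \<gamma> L0 where K: "K > 0" "0 < \<gamma>" "\<gamma> \<le> 1/2" "L0 \<ge> 1"
    and Kb: "\<And>L s. L \<ge> L0 \<Longrightarrow> ln 2 \<le> s \<Longrightarrow> s \<le> L \<Longrightarrow> norm (1 - twist \<theta> t \<kappa> L s) \<le> K * (s / L) powr \<gamma>"
    using one_minus_twist_bound[OF V \<kappa>, of t] by metis
  define I where "I = (\<integral>u. indicator {0<..1} u *\<^sub>R ((1 / u) *\<^sub>R (1 - limit_twist \<alpha> t \<kappa> u)) \<partial>lborel)"
  define z where "z = (\<lambda>n p. twist \<theta> t \<kappa> (ln (real n)) (ln (real p)))"
  let ?a = "\<lambda>n p. (1 - of_real (1 / real p)) / (1 - of_real (1 / real p) * z n p)"
  let ?b = "\<lambda>n p. exp (- (of_real (1 / real p) * (1 - z n p)))"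
  define S where "S = (\<lambda>n::nat. \<Sum>p\<in>primes_le n. (1 - z n p) / of_nat p)"
  have lnn: "filterlim (\<lambda>n::nat. ln (real n)) at_top sequentially"
    by (rule filterlim_compose[OF ln_at_top filterlim_real_sequentially])
  have "((\<lambda>L. (\<Sum>p | prime p \<and> ln (real p) \<le> L. (1 - twist \<theta> t \<kappa> L (ln (real p))) / of_nat p)) \<longlongrightarrow> 0 + I) at_top"
    using tendsto_add[OF prime_sum_minus_integral_tendsto_0[OF V \<kappa>, of t] scaled_integral_tendsto[OF V rv \<kappa>, of t]]
    by (simp only: diff_add_cancel I_def)
  from filterlim_compose[OF this lnn]
  have "(\<lambda>n. (\<Sum>p | prime p \<and> ln (real p) \<le> ln (real n). (1 - z n p) / of_nat p)) \<longlonglongrightarrow> I"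
    by (simp add: z_def)
  then have "S \<longlonglongrightarrow> I"
  proof (rule Lim_transform_eventually)
    show "\<forall>\<^sub>F n in sequentially. (\<Sum>p | prime p \<and> ln (real p) \<le> ln (real n). (1 - z n p) / of_nat p) = S n"
      using eventually_gt_at_top[of 0]
    proof eventually_elim
      case (elim n)
      have "{p. prime p \<and> ln (real p) \<le> ln (real n)} = primes_le n"
        using elim by (auto simp: primes_le_def dest: prime_gt_0_nat)
      then show ?case by (simp add: S_def)
    qed
  qed
  then have E: "(\<lambda>n. exp (- S n)) \<longlonglongrightarrow> exp (- I)" by (intro tendsto_intros)
  have "(\<lambda>n. (\<Prod>p\<in>primes_le n. ?a n p) - exp (- S n)) \<longlonglongrightarrow> 0"
  proof (rule Lim_null_comparison)
    define B where "B = (\<Sum>m. real m powr (- 3/2))"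
    have sumB: "summable (\<lambda>m. real m powr (- 3/2))" by (simp add: summable_real_powr_iff)
    have "(\<lambda>n. 8 * K * (ln (real n) powr (-\<gamma>) * B)) \<longlonglongrightarrow> 8 * K * (0 * B)"
      using K by (intro tendsto_intros tendsto_neg_powr lnn) auto
    then show "(\<lambda>n. 8 * K * (ln (real n) powr (-\<gamma>) * B)) \<longlonglongrightarrow> 0" by simp
    have "\<forall>\<^sub>F n in sequentially. ln (real n) \<ge> L0" using lnn by (simp add: filterlim_at_top)
    then show "\<forall>\<^sub>F n in sequentially. norm ((\<Prod>p\<in>primes_le n. ?a n p) - exp (- S n))
        \<le> 8 * K * (ln (real n) powr (-\<gamma>) * B)" using eventually_gt_at_top[of 0]
    proof eventually_elim
      case (elim n)
      then have L: "ln (real n) > 0" using K by linarith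
      have p: "real p \<ge> 2" "ln 2 \<le> ln (real p)" "ln (real p) \<le> ln (real n)" "0 < 1 / real p" "1 / real p \<le> 1/2"
        if "p \<in> primes_le n" for p
      proof -
        have "prime p" "p \<le> n" using that by (auto simp: primes_le_def)
        then show "real p \<ge> 2" using prime_ge_2_nat[of p] by simp
        then show "ln 2 \<le> ln (real p)" "ln (real p) \<le> ln (real n)" "0 < 1 / real p" "1 / real p \<le> 1/2"
          using \<open>p \<le> n\<close> by (auto simp: field_simps)
      qed
      have z1: "norm (z n p) \<le> 1" if "p \<in> primes_le n" for p
        unfolding z_def using p[OF that] L \<kappa> by (intro norm_twist_le_1) auto
      have expS: "exp (- S n) = (\<Prod>p\<in>primes_le n. ?b n p)"
        unfolding S_def sum_negf[symmetric] by (subst exp_sum) (auto intro!: prod.cong)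
      have "norm ((\<Prod>p\<in>primes_le n. ?a n p) - exp (- S n))
        \<le> (\<Sum>p\<in>primes_le n. norm (?a n p - ?b n p))"
        unfolding expS
        by (rule norm_prod_diff) (rule euler_factor_minus_exp(1) euler_factor_minus_exp(2); use p(4,5) z1 in blast)+
      also have "\<dots> \<le> (\<Sum>p\<in>primes_le n. 8 * K * (ln (real n) powr (-\<gamma>) * real p powr (- 3/2)))"
      proof (rule sum_mono)
        fix p assume pP: "p \<in> primes_le n"
        note p = p[OF pP]
        have "norm (?a n p - ?b n p)
          \<le> 8 * (1 / real p)\<^sup>2 * norm (1 - z n p)"
          by (rule euler_factor_minus_exp(3)[OF p(4,5) z1[OF pP]])
        also have "norm (1 - z n p) \<le> K * (ln (real p) / ln (real n)) powr \<gamma>"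
          unfolding z_def using elim p by (intro Kb) auto
        also have "(ln (real p) / ln (real n)) powr \<gamma> = ln (real p) powr \<gamma> * ln (real n) powr (-\<gamma>)"
          using p L by (simp add: powr_divide powr_minus field_simps)
        also have "ln (real p) powr \<gamma> \<le> real p powr (1/2)"
        proof -
          have "ln (real p) powr \<gamma> \<le> real p powr \<gamma>"
            using p K ln_le_minus_one[of "real p"] by (intro powr_mono2) auto
          also have "\<dots> \<le> real p powr (1/2)" using p K by (intro powr_mono) auto
          finally show ?thesis .
        qed
        also have "8 * (1 / real p)\<^sup>2 * (K * (real p powr (1/2) * ln (real n) powr (-\<gamma>)))
            = 8 * K * (ln (real n) powr (-\<gamma>) * real p powr (- 3/2))"
        proof -
          have "real p powr (1/2) = real p powr (2 + (- 3/2))" by simp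
          also have "\<dots> = real p powr 2 * real p powr (- 3/2)" by (rule powr_add)
          also have "real p powr 2 = (real p)\<^sup>2" using p by simp
          finally show ?thesis using p by (simp add: power_divide)
        qed
        finally show "norm (?a n p - ?b n p)
          \<le> 8 * K * (ln (real n) powr (-\<gamma>) * real p powr (- 3/2))"
          using K by (simp add: mult_left_mono mult_right_mono)
      qed
      also have "\<dots> = 8 * K * (ln (real n) powr (-\<gamma>) * (\<Sum>p\<in>primes_le n. real p powr (- 3/2)))"
        by (simp add: sum_distrib_left)
      also have "\<dots> \<le> 8 * K * (ln (real n) powr (-\<gamma>) * B)"
        unfolding B_def using K by (intro mult_left_mono sum_le_suminf sumB) auto
      finally show ?case .
    qed
  qed
  from tendsto_add[OF this E] show ?thesis by (simp add: z_def I_def)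
qed

text \<open>Independence of the exponents factors the expectation into the Euler product.\<close>

lemma smooth_expectation_tendsto:
  assumes V: "\<theta> \<in> class_V" and rv: "regularly_varying \<theta> \<alpha>"
  shows "(\<lambda>n. measure_pmf.expectation (smooth_pmf n)
            (\<lambda>m. iexp (t * (induced \<theta> m / \<theta> (ln (real n)))) * of_real (exp (- (ln (real m) / ln (real n)))) ^ k))
     \<longlonglongrightarrow> exp (- (\<integral>u. indicator {0<..1} u *\<^sub>R ((1 / u) *\<^sub>R (1 - limit_twist \<alpha> t (real k) u)) \<partial>lborel))"
proof (rule Lim_transform_eventually[OF euler_product_tendsto[OF V rv]])
  show "\<forall>\<^sub>F n in sequentially. (\<Prod>p\<in>primes_le n. (1 - of_real (1 / real p)) / (1 - of_real (1 / real p) * twist \<theta> t (real k) (ln (real n)) (ln (real p))))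
     = measure_pmf.expectation (smooth_pmf n)
            (\<lambda>m. iexp (t * (induced \<theta> m / \<theta> (ln (real n)))) * of_real (exp (- (ln (real m) / ln (real n)))) ^ k)"
    using eventually_gt_at_top[of 1]
  proof eventually_elim
    case (elim n)
    then have L: "ln (real n) > 0" by simp
    let ?z = "\<lambda>p. twist \<theta> t (real k) (ln (real n)) (ln (real p))"
    have z1: "norm (?z p) \<le> 1" if "p \<in> primes_le n" for p
      using L that by (intro norm_twist_le_1) (auto simp: primes_le_def dest: prime_ge_1_nat)
    have "(\<Prod>p\<in>primes_le n. (1 - of_real (1 / real p)) / (1 - of_real (1 / real p) * ?z p))
      = (\<Prod>p\<in>primes_le n. measure_pmf.expectation (geometric_pmf (1 - 1 / real p)) (\<lambda>j. ?z p ^ j))"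
    proof (rule prod.cong[OF refl])
      fix p assume p: "p \<in> primes_le n"
      then have "real p \<ge> 2" using prime_ge_2_nat[of p] by (auto simp: primes_le_def)
      then show "(1 - of_real (1 / real p)) / (1 - of_real (1 / real p) * ?z p)
          = measure_pmf.expectation (geometric_pmf (1 - 1 / real p)) (\<lambda>j. ?z p ^ j)"
        using z1[OF p] by (intro expectation_power_geometric_pmf[symmetric]) (auto simp: field_simps)
    qed
    also have "\<dots> = measure_pmf.expectation (prime_exponents_pmf n) (\<lambda>g. \<Prod>p\<in>primes_le n. ?z p ^ g p)"
      unfolding prime_exponents_pmf_def
      by (rule expectation_prod_Pi_pmf_complex[symmetric]) (auto simp: norm_power power_le_one z1)
    also have "(\<lambda>g. \<Prod>p\<in>primes_le n. ?z p ^ g p) =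
      (\<lambda>g. iexp (t * (induced \<theta> (prime_power_product n g) / \<theta> (ln (real n)))) * of_real (exp (- (ln (real (prime_power_product n g)) / ln (real n)))) ^ k)"
    proof
      fix g
      have "(\<Prod>p\<in>primes_le n. ?z p ^ g p) =
        exp (\<Sum>p\<in>primes_le n. of_nat (g p) * Complex (- (real k * ln (real p) / ln (real n))) (t * \<theta> (ln (real p)) / \<theta> (ln (real n))))"
        unfolding twist_def by (simp add: exp_sum exp_of_nat_mult)
      also have "(\<Sum>p\<in>primes_le n. of_nat (g p) * Complex (- (real k * ln (real p) / ln (real n))) (t * \<theta> (ln (real p)) / \<theta> (ln (real n))))
        = \<i> * of_real (t * (induced \<theta> (prime_power_product n g) / \<theta> (ln (real n)))) + of_nat k * of_real (- (ln (real (prime_power_product n g)) / ln (real n)))"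
        unfolding induced_prime_power_product ln_prime_power_product
        by (simp add: complex_eq_iff sum_distrib_left sum_divide_distrib sum_negf mult_ac)
      also have "exp \<dots> = iexp (t * (induced \<theta> (prime_power_product n g) / \<theta> (ln (real n)))) * of_real (exp (- (ln (real (prime_power_product n g)) / ln (real n)))) ^ k"
        by (simp only: exp_add exp_of_nat_mult exp_of_real)
      finally show "(\<Prod>p\<in>primes_le n. ?z p ^ g p) = \<dots>" .
    qed
    finally show ?case by (simp add: smooth_pmf_def)
  qed
qed simp

section \<open>The Poisson process\<close>

lemma space_intensity: "space intensity = {0<..1} \<times> {0<..1}"
  by (simp add: intensity_def space_restrict_space)

lemma borel_snd_measurable: "g \<in> borel_measurable borel \<Longrightarrow> (\<lambda>(t::real, x::real). g x) \<in> borel_measurable (borel :: (real \<times> real) measure)"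
  by (simp add: borel_prod[symmetric] split_beta')

lemma snd_measurable_intensity:
  assumes "g \<in> borel_measurable borel"
  shows "(\<lambda>(t, x). g x) \<in> borel_measurable intensity"
  unfolding intensity_def using borel_snd_measurable[OF assms]
  by (auto intro!: measurable_restrict_space1)

lemma rect_in_sets_intensity:
  assumes "B \<in> sets borel" "B \<subseteq> {0<..1}"
  shows "{0<..1} \<times> B \<in> sets intensity"
proof -
  have "{0<..1::real} \<times> B \<in> sets (borel \<Otimes>\<^sub>M borel)" using assms by (intro pair_measureI) auto
  then have "{0<..1::real} \<times> B \<in> sets lborel" by (simp add: borel_prod[symmetric])
  moreover have "{0<..1::real} \<times> {0<..1::real} \<in> sets (borel \<Otimes>\<^sub>M borel)" by (intro pair_measureI) auto
  then have "{0<..1::real} \<times> {0<..1::real} \<in> sets lborel" by (simp add: borel_prod[symmetric])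
  ultimately show ?thesis unfolding intensity_def using assms
    by (auto simp: sets_restrict_space_iff)
qed

text \<open>Integrands here depend only on the second coordinate; the first one contributes the length of
  \<open>(0,1]\<close>, which is \<open>1\<close>.\<close>

lemma nn_integral_intensity_snd:
  assumes g: "g \<in> borel_measurable borel"
  shows "(\<integral>\<^sup>+ (t, x). g x \<partial>intensity) = (\<integral>\<^sup>+ x. ennreal (1 / x) * g x * indicator {0<..1} x \<partial>lborel)"
proof -
  let ?Q = "{0<..1::real} \<times> {0<..1::real}"
  have Q: "?Q \<in> sets (borel \<Otimes>\<^sub>M borel)" by (intro pair_measureI) auto
  then have Q': "?Q \<in> sets lborel" by (simp add: borel_prod[symmetric])
  have f: "(\<lambda>(t::real, x::real). ennreal (1 / x)) \<in> borel_measurable borel"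
    by (rule borel_snd_measurable) simp
  have g': "(\<lambda>(t::real, x::real). g x) \<in> borel_measurable borel" by (rule borel_snd_measurable[OF g])
  have "(\<integral>\<^sup>+ (t, x). g x \<partial>intensity) =
     (\<integral>\<^sup>+ z. (\<lambda>(t, x). ennreal (1 / x)) z * (\<lambda>(t, x). g x) z \<partial>restrict_space lborel ?Q)"
    unfolding intensity_def using f g'
    by (intro nn_integral_density) (auto intro!: measurable_restrict_space1)
  also have "\<dots> = (\<integral>\<^sup>+ z. ((\<lambda>(t, x). ennreal (1 / x)) z * (\<lambda>(t, x). g x) z) * indicator ?Q z \<partial>lborel)"
    using Q' by (intro nn_integral_restrict_space) auto
  also have "\<dots> = (\<integral>\<^sup>+ z. ((\<lambda>(t, x). ennreal (1 / x)) z * (\<lambda>(t, x). g x) z) * indicator ?Q z \<partial>(lborel \<Otimes>\<^sub>M lborel))"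
    by (simp add: lborel_prod)
  also have "\<dots> = (\<integral>\<^sup>+ t. \<integral>\<^sup>+ x. (\<lambda>z. ((\<lambda>(t, x). ennreal (1 / x)) z * (\<lambda>(t, x). g x) z) * indicator ?Q z) (t, x) \<partial>lborel \<partial>lborel)"
  proof (rule lborel.nn_integral_fst[symmetric])
    note [measurable] = f g' Q'
    have "(\<lambda>z. ((\<lambda>(t, x). ennreal (1 / x)) z * (\<lambda>(t, x). g x) z) * indicator ?Q z) \<in> borel_measurable lborel"
      by measurable
    then show "(\<lambda>z. ((\<lambda>(t, x). ennreal (1 / x)) z * (\<lambda>(t, x). g x) z) * indicator ?Q z)
        \<in> borel_measurable (lborel \<Otimes>\<^sub>M lborel)" by (simp only: lborel_prod)
  qed
  also have "\<dots> = (\<integral>\<^sup>+ t. indicator {0<..1::real} t * (\<integral>\<^sup>+ x. ennreal (1 / x) * g x * indicator {0<..1} x \<partial>lborel) \<partial>lborel)"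
  proof (intro nn_integral_cong)
    fix t :: real
    have "(\<integral>\<^sup>+ x. (\<lambda>z. ((\<lambda>(t, x). ennreal (1 / x)) z * (\<lambda>(t, x). g x) z) * indicator ?Q z) (t, x) \<partial>lborel)
      = (\<integral>\<^sup>+ x. indicator {0<..1::real} t * (ennreal (1 / x) * g x * indicator {0<..1} x) \<partial>lborel)"
      by (intro nn_integral_cong) (auto simp: indicator_def)
    also have "\<dots> = indicator {0<..1::real} t * (\<integral>\<^sup>+ x. ennreal (1 / x) * g x * indicator {0<..1} x \<partial>lborel)"
      using g by (intro nn_integral_cmult) auto
    finally show "(\<integral>\<^sup>+ x. (\<lambda>z. ((\<lambda>(t, x). ennreal (1 / x)) z * (\<lambda>(t, x). g x) z) * indicator ?Q z) (t, x) \<partial>lborel)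
       = indicator {0<..1::real} t * (\<integral>\<^sup>+ x. ennreal (1 / x) * g x * indicator {0<..1} x \<partial>lborel)" .
  qed
  also have "\<dots> = (\<integral>\<^sup>+ x. ennreal (1 / x) * g x * indicator {0<..1} x \<partial>lborel)"
    by (simp add: nn_integral_multc)
  finally show ?thesis .
qed

text \<open>The Poisson probabilities sum to \<open>1\<close>.\<close>

lemma poisson_count_AE_nat:
  assumes prm: "poisson_random_measure M \<mu> \<eta>" and A: "A \<in> sets \<mu>" "emeasure \<mu> A < \<infinity>"
  shows "AE \<omega> in M. \<exists>k::nat. emeasure (\<eta> \<omega>) A = of_nat k"
proof -
  interpret prob_space M using prm by (simp add: poisson_random_measure_def)
  have meas[measurable]: "(\<lambda>\<omega>. emeasure (\<eta> \<omega>) A) \<in> borel_measurable M"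
    using prm A by (simp add: poisson_random_measure_def)
  have P: "prob {\<omega> \<in> space M. emeasure (\<eta> \<omega>) A = of_nat k} = measure \<mu> A ^ k / fact k * exp (- measure \<mu> A)" for k :: nat
    using prm A by (simp add: poisson_random_measure_def)
  let ?E = "\<lambda>k::nat. {\<omega> \<in> space M. emeasure (\<eta> \<omega>) A = of_nat k}"
  have E: "?E k \<in> events" for k by measurable
  have "(\<lambda>k. prob (?E k)) sums prob (\<Union>k. ?E k)"
    using E by (intro finite_measure_UNION) (auto simp: disjoint_family_on_def)
  moreover have "(\<lambda>k. prob (?E k)) sums (exp (measure \<mu> A) * exp (- measure \<mu> A))"
    unfolding P using exp_converges[of "measure \<mu> A"]
    by (intro sums_mult2) (simp add: field_simps)
  ultimately have "prob (\<Union>k. ?E k) = 1"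
    using sums_unique2 by (fastforce simp: exp_minus)
  then have "AE \<omega> in M. \<omega> \<in> (\<Union>k. ?E k)"
    using E by (subst prob_eq_1[symmetric]) auto
  then show ?thesis by eventually_elim auto
qed

lemma poisson_count_mean:
  assumes prm: "poisson_random_measure M \<mu> \<eta>" and A: "A \<in> sets \<mu>"
  shows "(\<integral>\<^sup>+\<omega>. emeasure (\<eta> \<omega>) A \<partial>M) = emeasure \<mu> A"
proof (cases "emeasure \<mu> A < \<infinity>")
  interpret prob_space M using prm by (simp add: poisson_random_measure_def)
  case True
  have meas[measurable]: "(\<lambda>\<omega>. emeasure (\<eta> \<omega>) A) \<in> borel_measurable M"
    using prm A by (simp add: poisson_random_measure_def)
  define r where "r = measure \<mu> A"
  let ?E = "\<lambda>k::nat. {\<omega> \<in> space M. emeasure (\<eta> \<omega>) A = of_nat k}"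
  have E: "?E k \<in> events" for k by measurable
  have P: "prob (?E k) = r ^ k / fact k * exp (- r)" for k :: nat
    using prm A True by (simp add: poisson_random_measure_def r_def)
  have r0: "r \<ge> 0" by (simp add: r_def)
  have "(\<integral>\<^sup>+\<omega>. emeasure (\<eta> \<omega>) A \<partial>M) = (\<integral>\<^sup>+\<omega>. (\<Sum>k. of_nat k * indicator (?E k) \<omega>) \<partial>M)"
  proof (rule nn_integral_cong_AE)
    show "AE \<omega> in M. emeasure (\<eta> \<omega>) A = (\<Sum>k. of_nat k * indicator (?E k) \<omega>)"
      using poisson_count_AE_nat[OF prm A True] AE_space
    proof eventually_elim
      case (elim \<omega>)
      then obtain j :: nat where j: "emeasure (\<eta> \<omega>) A = of_nat j" by auto
      have "(\<Sum>k. of_nat k * indicator (?E k) \<omega> :: ennreal) = (\<Sum>k\<in>{j}. of_nat k * indicator (?E k) \<omega>)"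
        using elim j by (intro suminf_finite) (auto simp: indicator_def)
      then show ?case using elim j by simp
    qed
  qed
  also have "\<dots> = (\<Sum>k. (\<integral>\<^sup>+\<omega>. of_nat k * indicator (?E k) \<omega> \<partial>M))"
    by (intro nn_integral_suminf) measurable
  also have "\<dots> = (\<Sum>k. ennreal (real k * (r ^ k / fact k * exp (- r))))"
  proof (intro suminf_cong)
    fix k
    have "(\<integral>\<^sup>+\<omega>. of_nat k * indicator (?E k) \<omega> \<partial>M) = of_nat k * emeasure M (?E k)"
      using E by (intro nn_integral_cmult_indicator)
    also have "emeasure M (?E k) = ennreal (r ^ k / fact k * exp (- r))"
      by (simp only: emeasure_eq_measure P)
    also have "of_nat k * ennreal (r ^ k / fact k * exp (- r)) = ennreal (real k * (r ^ k / fact k * exp (- r)))"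
      unfolding ennreal_of_nat_eq_real_of_nat using r0 by (intro ennreal_mult[symmetric]) auto
    finally show "(\<integral>\<^sup>+\<omega>. of_nat k * indicator (?E k) \<omega> \<partial>M) = ennreal (real k * (r ^ k / fact k * exp (- r)))" .
  qed
  also have "\<dots> = ennreal r"
  proof (rule suminf_ennreal_eq)
    have "(\<lambda>k. r * exp (- r) * (r ^ k / fact k)) sums (r * exp (- r) * exp r)"
      using exp_converges[of r] by (intro sums_mult) (simp add: field_simps)
    then have "(\<lambda>k. real (Suc k) * (r ^ Suc k / fact (Suc k) * exp (- r))) sums r"
      by (simp add: exp_minus field_simps del: of_nat_Suc)
    then show "(\<lambda>k. real k * (r ^ k / fact k * exp (- r))) sums r"
      using sums_Suc_iff[of "\<lambda>k. real k * (r ^ k / fact k * exp (- r))" r] by simp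
  qed (use r0 in simp)
  also have "\<dots> = emeasure \<mu> A" using True by (simp add: r_def emeasure_eq_ennreal_measure less_top)
  finally show ?thesis .
next
  interpret prob_space M using prm by (simp add: poisson_random_measure_def)
  case False
  then have inf: "emeasure \<mu> A = \<infinity>" by (simp add: less_top[symmetric])
  then have "AE \<omega> in M. emeasure (\<eta> \<omega>) A = \<infinity>" using prm A by (simp add: poisson_random_measure_def)
  then have "(\<integral>\<^sup>+\<omega>. emeasure (\<eta> \<omega>) A \<partial>M) = (\<integral>\<^sup>+\<omega>. \<infinity> \<partial>M)" by (rule nn_integral_cong_AE)
  then show ?thesis using inf by (simp add: emeasure_space_1)
qed

text \<open>Campbell's formula. For indicators it is the mean of a Poisson count; it extends to all nonnegative
  integrands by linearity and monotone convergence, and the same induction gives measurability.\<close>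

lemma poisson_campbell:
  fixes \<mu> :: "'b measure"
  assumes prm: "poisson_random_measure M \<mu> \<eta>" and f: "f \<in> borel_measurable \<mu>"
  shows "(\<lambda>\<omega>. \<integral>\<^sup>+x. f x \<partial>\<eta> \<omega>) \<in> borel_measurable M"
    and "(\<integral>\<^sup>+\<omega>. (\<integral>\<^sup>+x. f x \<partial>\<eta> \<omega>) \<partial>M) = (\<integral>\<^sup>+x. f x \<partial>\<mu>)"
proof -
  have sets: "sets (\<eta> \<omega>) = sets \<mu>" if "\<omega> \<in> space M" for \<omega>
    using prm that by (simp add: poisson_random_measure_def)
  have mc: "g \<in> borel_measurable (\<eta> \<omega>)" if "\<omega> \<in> space M" "g \<in> borel_measurable \<mu>" for \<omega> and g :: "'b \<Rightarrow> ennreal"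
    using that(2) measurable_cong_sets[OF sets[OF that(1)] refl] by blast
  have "(\<lambda>\<omega>. \<integral>\<^sup>+x. f x \<partial>\<eta> \<omega>) \<in> borel_measurable M \<and>
     (\<integral>\<^sup>+\<omega>. (\<integral>\<^sup>+x. f x \<partial>\<eta> \<omega>) \<partial>M) = (\<integral>\<^sup>+x. f x \<partial>\<mu>)"
    using f
  proof (induction f rule: borel_measurable_induct)
    case (cong f g)
    have "(\<integral>\<^sup>+x. f x \<partial>\<eta> \<omega>) = (\<integral>\<^sup>+x. g x \<partial>\<eta> \<omega>)" if "\<omega> \<in> space M" for \<omega>
      using cong(3) sets_eq_imp_space_eq[OF sets[OF that]] by (intro nn_integral_cong) simp
    moreover have "(\<integral>\<^sup>+x. f x \<partial>\<mu>) = (\<integral>\<^sup>+x. g x \<partial>\<mu>)" using cong(3) by (intro nn_integral_cong) simp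
    ultimately show ?case using cong(4) by (simp cong: measurable_cong nn_integral_cong)
  next
    case (set A)
    have "(\<integral>\<^sup>+x. indicator A x \<partial>\<eta> \<omega>) = emeasure (\<eta> \<omega>) A" if "\<omega> \<in> space M" for \<omega>
      using set sets[OF that] by simp
    moreover have "(\<lambda>\<omega>. emeasure (\<eta> \<omega>) A) \<in> borel_measurable M"
      using prm set by (simp add: poisson_random_measure_def)
    ultimately show ?case using poisson_count_mean[OF prm set] set
      by (simp cong: measurable_cong nn_integral_cong)
  next
    case (mult u c)
    have "(\<integral>\<^sup>+x. c * u x \<partial>\<eta> \<omega>) = c * (\<integral>\<^sup>+x. u x \<partial>\<eta> \<omega>)" if "\<omega> \<in> space M" for \<omega>
      using mult by (intro nn_integral_cmult mc[OF that])
    moreover have [measurable]: "(\<lambda>\<omega>. \<integral>\<^sup>+x. u x \<partial>\<eta> \<omega>) \<in> borel_measurable M" using mult by blast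
    have "(\<lambda>\<omega>. c * (\<integral>\<^sup>+x. u x \<partial>\<eta> \<omega>)) \<in> borel_measurable M" by measurable
    ultimately show ?case using mult
      by (simp add: nn_integral_cmult cong: measurable_cong nn_integral_cong)
  next
    case (add u v)
    have "(\<integral>\<^sup>+x. v x + u x \<partial>\<eta> \<omega>) = (\<integral>\<^sup>+x. v x \<partial>\<eta> \<omega>) + (\<integral>\<^sup>+x. u x \<partial>\<eta> \<omega>)" if "\<omega> \<in> space M" for \<omega>
      using add by (intro nn_integral_add mc[OF that])
    moreover have [measurable]: "(\<lambda>\<omega>. \<integral>\<^sup>+x. u x \<partial>\<eta> \<omega>) \<in> borel_measurable M"
      "(\<lambda>\<omega>. \<integral>\<^sup>+x. v x \<partial>\<eta> \<omega>) \<in> borel_measurable M" using add by blast+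
    have "(\<lambda>\<omega>. (\<integral>\<^sup>+x. v x \<partial>\<eta> \<omega>) + (\<integral>\<^sup>+x. u x \<partial>\<eta> \<omega>)) \<in> borel_measurable M" by measurable
    ultimately show ?case using add
      by (simp add: nn_integral_add cong: measurable_cong nn_integral_cong)
  next
    case (seq U)
    have 1: "(\<integral>\<^sup>+x. (SUP i. U i x) \<partial>\<eta> \<omega>) = (SUP i. \<integral>\<^sup>+x. U i x \<partial>\<eta> \<omega>)" if "\<omega> \<in> space M" for \<omega>
      using seq by (intro nn_integral_monotone_convergence_SUP mc[OF that])
    have 2: "(\<integral>\<^sup>+\<omega>. (SUP i. \<integral>\<^sup>+x. U i x \<partial>\<eta> \<omega>) \<partial>M) = (SUP i. \<integral>\<^sup>+\<omega>. (\<integral>\<^sup>+x. U i x \<partial>\<eta> \<omega>) \<partial>M)"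
      using seq by (intro nn_integral_monotone_convergence_SUP)
        (auto simp: incseq_def le_fun_def intro!: nn_integral_mono)
    have 3: "(\<integral>\<^sup>+x. (SUP i. U i x) \<partial>\<mu>) = (SUP i. \<integral>\<^sup>+x. U i x \<partial>\<mu>)"
      using seq by (intro nn_integral_monotone_convergence_SUP) auto
    have eq: "(Sup (range U)) = (\<lambda>x. SUP i. U i x)" by (rule ext) (simp add: image_comp)
    have "(\<lambda>\<omega>. SUP i. \<integral>\<^sup>+x. U i x \<partial>\<eta> \<omega>) \<in> borel_measurable M" using seq by (intro borel_measurable_SUP) auto
    then show ?case unfolding eq using 1 2 3 seq by (simp cong: measurable_cong nn_integral_cong)
  qed
  then show "(\<lambda>\<omega>. \<integral>\<^sup>+x. f x \<partial>\<eta> \<omega>) \<in> borel_measurable M"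
    "(\<integral>\<^sup>+\<omega>. (\<integral>\<^sup>+x. f x \<partial>\<eta> \<omega>) \<partial>M) = (\<integral>\<^sup>+x. f x \<partial>\<mu>)" by auto
qed

text \<open>The sum over the values of the count is the exponential series at \<open>r * exp c\<close>, where \<open>r\<close> is
  the mean.\<close>

lemma poisson_count_transform:
  fixes c :: complex
  assumes prm: "poisson_random_measure M \<mu> \<eta>" and A: "A \<in> sets \<mu>" "emeasure \<mu> A < \<infinity>" and c: "Re c \<le> 0"
  shows "(\<integral>\<omega>. exp (c * of_real (enn2real (emeasure (\<eta> \<omega>) A))) \<partial>M) = exp (- (of_real (measure \<mu> A) * (1 - exp c)))"
proof -
  interpret prob_space M using prm by (simp add: poisson_random_measure_def)
  have meas[measurable]: "(\<lambda>\<omega>. emeasure (\<eta> \<omega>) A) \<in> borel_measurable M"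
    using prm A by (simp add: poisson_random_measure_def)
  define r where "r = measure \<mu> A"
  define E where "E = (\<lambda>k::nat. {\<omega> \<in> space M. emeasure (\<eta> \<omega>) A = of_nat k})"
  have E: "E k \<in> events" for k unfolding E_def by measurable
  have P: "prob (E k) = r ^ k / fact k * exp (- r)" for k :: nat
    using prm A by (simp add: poisson_random_measure_def r_def E_def)
  have r0: "r \<ge> 0" by (simp add: r_def)
  have nc: "norm (exp (c * of_nat k)) \<le> 1" for k using c by (simp add: mult_nonpos_nonneg)
  have int: "integrable M (\<lambda>\<omega>. indicator (E k) \<omega> *\<^sub>R exp (c * of_nat k))" for k
    using E by (intro integrable_scaleR_left) (auto simp: emeasure_eq_measure)
  have val: "(\<integral>\<omega>. indicator (E k) \<omega> *\<^sub>R exp (c * of_nat k) \<partial>M) = (r ^ k / fact k * exp (- r)) *\<^sub>R exp (c * of_nat k)" for k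
    using E[of k] P[of k] by (subst integral_scaleR_left) (auto simp: emeasure_eq_measure)
  have sumP: "summable (\<lambda>k. r ^ k / fact k * exp (- r))"
    using summable_exp[of r] by (intro summable_mult2) (simp add: field_simps)
  have fin: "(\<lambda>k. indicator (E k) \<omega> *\<^sub>R exp (c * of_nat k)) sums exp (c * of_nat j)"
    "summable (\<lambda>k. norm (indicator (E k) \<omega> *\<^sub>R exp (c * of_nat k)))"
    if "\<omega> \<in> E j" for \<omega> j
  proof -
    have z: "k \<noteq> j \<Longrightarrow> indicator (E k) \<omega> = (0::real)" for k using that by (auto simp: E_def indicator_def)
    have "(\<lambda>k. indicator (E k) \<omega> *\<^sub>R exp (c * of_nat k)) sums (\<Sum>k\<in>{j}. indicator (E k) \<omega> *\<^sub>R exp (c * of_nat k))"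
      by (intro sums_finite) (auto simp: z)
    then show "(\<lambda>k. indicator (E k) \<omega> *\<^sub>R exp (c * of_nat k)) sums exp (c * of_nat j)" using that by simp
    show "summable (\<lambda>k. norm (indicator (E k) \<omega> *\<^sub>R exp (c * of_nat k)))"
      by (rule summable_finite[of "{j}"]) (auto simp: z)
  qed
  have AEE: "AE \<omega> in M. \<exists>j. \<omega> \<in> E j"
    using poisson_count_AE_nat[OF prm A] AE_space by eventually_elim (auto simp: E_def)
  have "(\<integral>\<omega>. exp (c * of_real (enn2real (emeasure (\<eta> \<omega>) A))) \<partial>M) = (\<integral>\<omega>. (\<Sum>k. indicator (E k) \<omega> *\<^sub>R exp (c * of_nat k)) \<partial>M)"
  proof (rule integral_cong_AE)
    show "AE \<omega> in M. exp (c * of_real (enn2real (emeasure (\<eta> \<omega>) A))) = (\<Sum>k. indicator (E k) \<omega> *\<^sub>R exp (c * of_nat k))"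
      using AEE
    proof eventually_elim
      case (elim \<omega>)
      then obtain j where j: "\<omega> \<in> E j" by auto
      then have "emeasure (\<eta> \<omega>) A = of_nat j" by (simp add: E_def)
      then have "enn2real (emeasure (\<eta> \<omega>) A) = real j" by (simp add: ennreal_of_nat_eq_real_of_nat)
      then show ?case using fin(1)[OF j] by (simp add: sums_iff)
    qed
    show "(\<lambda>\<omega>. \<Sum>k. indicator (E k) \<omega> *\<^sub>R exp (c * of_nat k)) \<in> borel_measurable M"
      using E by (intro borel_measurable_suminf borel_measurable_scaleR borel_measurable_indicator) auto
  qed measurable
  also have "\<dots> = (\<Sum>k. (\<integral>\<omega>. indicator (E k) \<omega> *\<^sub>R exp (c * of_nat k) \<partial>M))"
  proof (rule integral_suminf[OF int])
    show "AE \<omega> in M. summable (\<lambda>k. norm (indicator (E k) \<omega> *\<^sub>R exp (c * of_nat k)))"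
      using AEE by eventually_elim (use fin(2) in auto)
    show "summable (\<lambda>k. (\<integral>\<omega>. norm (indicator (E k) \<omega> *\<^sub>R exp (c * of_nat k)) \<partial>M))"
    proof (rule summable_comparison_test'[OF sumP, where N = 0])
      fix k
      have "(\<integral>\<omega>. norm (indicator (E k) \<omega> *\<^sub>R exp (c * of_nat k)) \<partial>M) = prob (E k) * norm (exp (c * of_nat k))"
        using E[of k] by (simp del: norm_exp_eq_Re)
      also have "\<dots> \<le> prob (E k) * 1" using nc by (intro mult_left_mono) auto
      finally show "norm (\<integral>\<omega>. norm (indicator (E k) \<omega> *\<^sub>R exp (c * of_nat k)) \<partial>M) \<le> r ^ k / fact k * exp (- r)"
        using P[of k] by simp
    qed
  qed
  also have "\<dots> = (\<Sum>k. of_real (exp (- r)) * ((of_real r * exp c) ^ k /\<^sub>R fact k))"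
    unfolding val
    by (intro suminf_cong) (simp add: scaleR_conv_of_real power_mult_distrib exp_of_nat2_mult divide_inverse mult_ac)
  also have "\<dots> = of_real (exp (- r)) * exp (of_real r * exp c)"
    using sums_mult[OF exp_converges, of "of_real (exp (- r))" "of_real r * exp c"]
    by (auto dest: sums_unique)
  also have "\<dots> = exp (- (of_real r * (1 - exp c)))"
    unfolding exp_of_real[symmetric] exp_add[symmetric] by (simp add: algebra_simps)
  finally show ?thesis by (simp add: r_def)
qed
text \<open>For \<open>a = 1\<close> the right-hand side is the length of \<open>(0,1]\<close>, so this integral has mean \<open>1\<close>.\<close>

lemma power_integral_mean:
  assumes prm: "poisson_random_measure M intensity \<eta>"
  shows "(\<lambda>\<omega>. power_integral (\<eta> \<omega>) a) \<in> borel_measurable M"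
    and "(\<integral>\<^sup>+\<omega>. power_integral (\<eta> \<omega>) a \<partial>M) = (\<integral>\<^sup>+ x. ennreal (indicator {0<..1} x * x powr (a - 1)) \<partial>lborel)"
proof -
  have f: "(\<lambda>(t, x). ennreal (x powr a)) \<in> borel_measurable intensity"
    by (rule snd_measurable_intensity) simp
  show "(\<lambda>\<omega>. power_integral (\<eta> \<omega>) a) \<in> borel_measurable M"
    unfolding power_integral_def by (rule poisson_campbell(1)[OF prm f])
  have "(\<integral>\<^sup>+\<omega>. power_integral (\<eta> \<omega>) a \<partial>M) = (\<integral>\<^sup>+ (t, x). ennreal (x powr a) \<partial>intensity)"
    unfolding power_integral_def by (rule poisson_campbell(2)[OF prm f])
  also have "\<dots> = (\<integral>\<^sup>+ x. ennreal (1 / x) * ennreal (x powr a) * indicator {0<..1} x \<partial>lborel)"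
    by (rule nn_integral_intensity_snd) simp
  also have "\<dots> = (\<integral>\<^sup>+ x. ennreal (indicator {0<..1} x * x powr (a - 1)) \<partial>lborel)"
    by (intro nn_integral_cong) (auto simp: indicator_def powr_diff ennreal_mult[symmetric])
  finally show "(\<integral>\<^sup>+\<omega>. power_integral (\<eta> \<omega>) a \<partial>M) = (\<integral>\<^sup>+ x. ennreal (indicator {0<..1} x * x powr (a - 1)) \<partial>lborel)" .
qed

lemma power_integral_AE_finite:
  assumes prm: "poisson_random_measure M intensity \<eta>" and a: "a > 0"
  shows "AE \<omega> in M. power_integral (\<eta> \<omega>) a < \<infinity>"
proof -
  have "(\<integral>\<^sup>+ x. ennreal (indicator {0<..1} x * x powr (a - 1)) \<partial>lborel) < \<infinity>"
    using integrable_powr_unit_interval[OF a] by (simp add: integrable_iff_bounded abs_mult)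
  then have "AE \<omega> in M. power_integral (\<eta> \<omega>) a \<noteq> \<infinity>"
    using power_integral_mean[OF prm, of a] by (intro nn_integral_PInf_AE) auto
  then show ?thesis by eventually_elim (simp add: less_top)
qed

text \<open>Largest multiple of \<open>1 / m\<close> that is strictly below \<open>x\<close>; the strict version matches
  half-open cells that are closed on the right.\<close>

definition grid_floor :: "nat \<Rightarrow> real \<Rightarrow> real" where
  "grid_floor m x = (real_of_int \<lceil>real m * x\<rceil> - 1) / real m"

text \<open>The cell on which the grid floor takes the value \<open>(i + 1) / m\<close>. The cell next to
  \<open>0\<close>, which has infinite intensity and grid floor \<open>0\<close>, is left out.\<close>

definition grid_cell :: "nat \<Rightarrow> nat \<Rightarrow> real set" where
  "grid_cell m i = {real (i + 1) / real m <.. real (i + 2) / real m}"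

lemma grid_floor_bounds:
  assumes "m > 0" "x > 0"
  shows "0 \<le> grid_floor m x" "grid_floor m x \<le> x" "x - 1 / real m \<le> grid_floor m x"
proof -
  have "real m * x > 0" using assms by simp
  then have "\<lceil>real m * x\<rceil> \<ge> 1" by linarith
  then show "0 \<le> grid_floor m x" using assms by (simp add: grid_floor_def)
  have "real_of_int \<lceil>real m * x\<rceil> - 1 \<le> real m * x" "real m * x - 1 \<le> real_of_int \<lceil>real m * x\<rceil> - 1" by linarith+
  then show "grid_floor m x \<le> x" "x - 1 / real m \<le> grid_floor m x"
    using assms by (auto simp: grid_floor_def field_simps)
qed

lemma grid_floor_tendsto:
  assumes "x > 0"
  shows "(\<lambda>m. grid_floor m x) \<longlonglongrightarrow> x"
proof (rule tendsto_sandwich)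
  have "(\<lambda>m. x - inverse (real m)) \<longlonglongrightarrow> x - 0" by (intro tendsto_intros lim_inverse_n)
  then show "(\<lambda>m. x - 1 / real m) \<longlonglongrightarrow> x" by (simp add: inverse_eq_divide)
  show "(\<lambda>m. x) \<longlonglongrightarrow> x" by (rule tendsto_const)
qed (use grid_floor_bounds[OF _ assms] in \<open>auto intro!: eventually_mono[OF eventually_gt_at_top[of 0]]\<close>)

lemma grid_cell_subset: "m > 0 \<Longrightarrow> i < m - 1 \<Longrightarrow> grid_cell m i \<subseteq> {0<..1}"
proof
  fix x assume m: "m > 0" "i < m - 1" and x: "x \<in> grid_cell m i"
  have "real (i + 2) / real m \<le> 1" using m by simp
  moreover have "real (i + 1) / real m > 0" using m by simp
  ultimately show "x \<in> {0<..1}" using x by (auto simp: grid_cell_def simp del: of_nat_add)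
qed

lemma grid_cell_iff: "m > 0 \<Longrightarrow> x \<in> grid_cell m i \<longleftrightarrow> \<lceil>real m * x\<rceil> = int i + 2"
  by (auto simp: grid_cell_def ceiling_eq_iff field_simps)

lemma sum_grid_cells:
  fixes g :: "real \<Rightarrow> 'a :: real_vector"
  assumes m: "m > 0" and x: "0 < x" "x \<le> 1" and g: "g 0 = 0"
  shows "(\<Sum>i<m - 1. indicator (grid_cell m i) x *\<^sub>R g (real (i + 1) / real m)) = g (grid_floor m x)"
proof -
  have "real m * x > 0" "real m * x \<le> real m" using m x by (simp_all add: mult_left_le)
  then have c: "\<lceil>real m * x\<rceil> \<ge> 1" "\<lceil>real m * x\<rceil> \<le> int m" by (linarith, simp add: ceiling_le_iff)
  define j where "j = nat (\<lceil>real m * x\<rceil> - 1)"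
  have j: "\<lceil>real m * x\<rceil> = int j + 1" "j \<le> m - 1" using c m by (auto simp: j_def)
  have st: "grid_floor m x = real j / real m" using j by (simp add: grid_floor_def)
  have ind: "indicator (grid_cell m i) x = (if i + 1 = j then 1 else 0 :: real)" for i
    using grid_cell_iff[OF m, of x i] j by (auto simp: indicator_def)
  show ?thesis
  proof (cases j)
    case 0
    then show ?thesis using g st by (simp add: ind)
  next
    case (Suc j')
    have "(\<Sum>i<m - 1. indicator (grid_cell m i) x *\<^sub>R g (real (i + 1) / real m))
       = (\<Sum>i<m - 1. if i = j' then g (real (i + 1) / real m) else 0)"
      by (intro sum.cong) (auto simp: ind Suc)
    also have "\<dots> = g (real (j' + 1) / real m)" using Suc j by (subst sum.delta) auto
    finally show ?thesis using Suc st by simp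
  qed
qed

lemma grid_cell_sets [measurable]: "grid_cell m i \<in> sets borel"
  by (simp add: grid_cell_def)

text \<open>The finite sum is the integral of the discretised power, which is dominated by the power
  itself; this works for each realisation of the random measure separately.\<close>

lemma grid_sums_tendsto_power_integral:
  assumes sets: "sets \<nu> = sets intensity" and a: "a > 0" and fin: "power_integral \<nu> a < \<infinity>"
  shows "(\<lambda>m. \<Sum>i<m - 1. (real (i + 1) / real m) powr a * enn2real (emeasure \<nu> ({0<..1} \<times> grid_cell m i)))
      \<longlonglongrightarrow> enn2real (power_integral \<nu> a)"
proof -
  have mc: "f \<in> borel_measurable \<nu>" if "f \<in> borel_measurable intensity" for f :: "real \<times> real \<Rightarrow> real"
    using that measurable_cong_sets[OF sets refl] by blast
  have sp: "space \<nu> = {0<..1} \<times> {0<..1}" using sets_eq_imp_space_eq[OF sets] by (simp add: space_intensity)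
  define f where "f = (\<lambda>(t::real, x::real). x powr a)"
  define fm where "fm = (\<lambda>m (t::real, x::real). \<Sum>i<m - 1. indicator (grid_cell m i) x *\<^sub>R (real (i + 1) / real m) powr a)"
  have snd: "(\<lambda>(t, x). g x) \<in> borel_measurable \<nu>" if "g \<in> borel_measurable borel" for g :: "real \<Rightarrow> real"
  proof (rule mc)
    have "(\<lambda>(t::real, x::real). g x) \<in> borel_measurable borel"
      using that by (simp add: borel_prod[symmetric] split_beta')
    then show "(\<lambda>(t, x). g x) \<in> borel_measurable intensity"
      unfolding intensity_def by (auto intro!: measurable_restrict_space1)
  qed
  have pi: "power_integral \<nu> a = (\<integral>\<^sup>+z. ennreal (f z) \<partial>\<nu>)"
    by (simp add: power_integral_def f_def split_beta')
  have fmeas: "f \<in> borel_measurable \<nu>" unfolding f_def by (rule snd) simp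
  have fnn: "f z \<ge> 0" for z by (simp add: f_def split_beta')
  have fint: "integrable \<nu> f"
    using fin fmeas fnn by (intro integrableI_bounded) (auto simp: pi)
  have fm_eq: "fm m z = (grid_floor m (snd z)) powr a" if "m > 0" "z \<in> space \<nu>" for m z
    using sum_grid_cells[OF that(1), of "snd z" "\<lambda>v. v powr a"] that(2) a
    by (auto simp: fm_def sp split_beta')
  have lim: "(\<lambda>m. \<integral>z. fm m z \<partial>\<nu>) \<longlonglongrightarrow> (\<integral>z. f z \<partial>\<nu>)"
  proof (rule integral_dominated_convergence[OF fmeas _ fint])
    show "fm m \<in> borel_measurable \<nu>" for m
      unfolding fm_def by (rule snd) measurable
    have "(\<lambda>m. fm m z) \<longlonglongrightarrow> f z" if z: "z \<in> space \<nu>" for z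
    proof (rule Lim_transform_eventually)
      show "(\<lambda>m. grid_floor m (snd z) powr a) \<longlonglongrightarrow> f z"
        unfolding f_def split_beta' using z a
        by (intro tendsto_powr grid_floor_tendsto tendsto_const) (auto simp: sp)
      show "\<forall>\<^sub>F m in sequentially. grid_floor m (snd z) powr a = fm m z"
        using eventually_gt_at_top[of 0] by eventually_elim (simp add: fm_eq z)
    qed
    then show "AE z in \<nu>. (\<lambda>m. fm m z) \<longlonglongrightarrow> f z" by simp
    have "norm (fm m z) \<le> f z" if z: "z \<in> space \<nu>" for m z
    proof (cases "m > 0")
      case True
      then show ?thesis using fm_eq[OF True z] grid_floor_bounds[OF True, of "snd z"] z a
        by (auto simp: sp f_def split_beta' intro!: powr_mono2)
    qed (simp add: fm_def fnn split_beta')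
    then show "AE z in \<nu>. norm (fm m z) \<le> f z" for m by simp
  qed
  have "(\<integral>z. fm m z \<partial>\<nu>) = (\<Sum>i<m - 1. (real (i + 1) / real m) powr a * enn2real (emeasure \<nu> ({0<..1} \<times> grid_cell m i)))" for m
  proof -
    let ?v = "\<lambda>i. (real (i + 1) / real m) powr a"
    have int: "integrable \<nu> (\<lambda>z. ?v i * indicator ({0<..1} \<times> grid_cell m i) z)" if i: "i < m - 1" for i
    proof (rule Bochner_Integration.integrable_bound[OF fint])
      have "{0<..1} \<times> grid_cell m i \<in> sets \<nu>"
        unfolding sets using i by (intro rect_in_sets_intensity grid_cell_sets grid_cell_subset) auto
      then show "(\<lambda>z. ?v i * indicator ({0<..1} \<times> grid_cell m i) z) \<in> borel_measurable \<nu>" by measurable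
      have "?v i * indicator ({0<..1} \<times> grid_cell m i) z \<le> f z" for z
        using a i by (auto simp: f_def split_beta' indicator_def grid_cell_def intro!: powr_mono2)
      then show "AE z in \<nu>. norm (?v i * indicator ({0<..1} \<times> grid_cell m i) z) \<le> norm (f z)"
        using fnn by (auto simp: abs_mult)
    qed
    have "(\<integral>z. fm m z \<partial>\<nu>) = (\<integral>z. (\<Sum>i<m - 1. ?v i * indicator ({0<..1} \<times> grid_cell m i) z) \<partial>\<nu>)"
      by (intro Bochner_Integration.integral_cong) (auto simp: fm_def sp indicator_def)
    also have "\<dots> = (\<Sum>i<m - 1. (\<integral>z. ?v i * indicator ({0<..1} \<times> grid_cell m i) z \<partial>\<nu>))"
      using int by (intro Bochner_Integration.integral_sum) auto
    also have "\<dots> = (\<Sum>i<m - 1. ?v i * enn2real (emeasure \<nu> ({0<..1} \<times> grid_cell m i)))"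
    proof (intro sum.cong refl)
      fix i assume "i \<in> {..<m - 1}"
      then have "m > 0" "i < m - 1" by auto
      then have "({0<..1} \<times> grid_cell m i) \<inter> space \<nu> = {0<..1} \<times> grid_cell m i"
        using grid_cell_subset[of m i] unfolding sp by blast
      then show "(\<integral>z. ?v i * indicator ({0<..1} \<times> grid_cell m i) z \<partial>\<nu>) = ?v i * enn2real (emeasure \<nu> ({0<..1} \<times> grid_cell m i))"
        by (simp add: measure_def)
    qed
    finally show ?thesis .
  qed
  moreover have "(\<integral>z. f z \<partial>\<nu>) = enn2real (power_integral \<nu> a)"
    unfolding pi using fnn by (intro integral_eq_nn_integral fmeas) auto
  ultimately show ?thesis using lim by simp
qed

lemma measure_intensity_grid_cell:
  assumes "m > 0" "i < m - 1"
  shows "emeasure intensity ({0<..1} \<times> grid_cell m i) < \<infinity>"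
    and "integrable lborel (\<lambda>u. indicator (grid_cell m i) u * (1 / u))"
    and "measure intensity ({0<..1} \<times> grid_cell m i) = (\<integral>u. indicator (grid_cell m i) u * (1 / u) \<partial>lborel)"
proof -
  let ?a = "real (i + 1) / real m" and ?b = "real (i + 2) / real m"
  have a: "?a > 0" using assms by simp
  have "set_integrable lborel {?a..?b} (\<lambda>u. 1 / u)"
    using a by (intro borel_integrable_atLeastAtMost' continuous_intros) (auto simp del: of_nat_add)
  then have "set_integrable lborel (grid_cell m i) (\<lambda>u. 1 / u)"
    by (rule set_integrable_subset) (auto simp: grid_cell_def)
  then show int: "integrable lborel (\<lambda>u. indicator (grid_cell m i) u * (1 / u))"
    by (simp add: set_integrable_def)
  have sub: "grid_cell m i \<subseteq> {0<..1}" using grid_cell_subset[of m i] assms by simp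
  have R: "{0<..1} \<times> grid_cell m i \<in> sets intensity"
    by (intro rect_in_sets_intensity grid_cell_sets sub)
  have "emeasure intensity ({0<..1} \<times> grid_cell m i) = (\<integral>\<^sup>+z. indicator ({0<..1} \<times> grid_cell m i) z \<partial>intensity)"
    using R by simp
  also have "\<dots> = (\<integral>\<^sup>+(t, x). indicator (grid_cell m i) x \<partial>intensity)"
    by (intro nn_integral_cong) (auto simp: space_intensity indicator_def)
  also have "\<dots> = (\<integral>\<^sup>+ x. ennreal (1 / x) * indicator (grid_cell m i) x * indicator {0<..1} x \<partial>lborel)"
    by (rule nn_integral_intensity_snd) measurable
  also have "\<dots> = (\<integral>\<^sup>+ x. ennreal (indicator (grid_cell m i) x * (1 / x)) \<partial>lborel)"
    using sub by (intro nn_integral_cong) (auto simp: indicator_def)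
  finally have eq: "emeasure intensity ({0<..1} \<times> grid_cell m i) = (\<integral>\<^sup>+ x. ennreal (indicator (grid_cell m i) x * (1 / x)) \<partial>lborel)" .
  have nn: "0 \<le> indicator (grid_cell m i) x * (1 / x)" for x :: real using sub by (auto simp: indicator_def)
  have eq2: "(\<integral>\<^sup>+ x. ennreal (indicator (grid_cell m i) x * (1 / x)) \<partial>lborel) = ennreal (\<integral>x. indicator (grid_cell m i) x * (1 / x) \<partial>lborel)"
    by (intro nn_integral_eq_integral int) (use nn in auto)
  show "emeasure intensity ({0<..1} \<times> grid_cell m i) < \<infinity>" unfolding eq eq2 by simp
  have "(\<integral>x. indicator (grid_cell m i) x * (1 / x) \<partial>lborel) \<ge> 0" using nn by (intro Bochner_Integration.integral_nonneg) auto
  then show "measure intensity ({0<..1} \<times> grid_cell m i) = (\<integral>u. indicator (grid_cell m i) u * (1 / u) \<partial>lborel)"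
    unfolding measure_def eq eq2 by simp
qed

text \<open>The sum is the integral of the discretised function \<open>1 - limit_twist\<close> against \<open>dx / x\<close>. Near \<open>0\<close> the
  domination comes from its being of order \<open>\<kappa> u + |t| u\<^sup>\<alpha>\<close>.\<close>

lemma grid_transform_tendsto:
  assumes \<alpha>: "\<alpha> > 0" and \<kappa>: "\<kappa> \<ge> 0"
  shows "(\<lambda>m. \<Sum>i<m - 1. of_real (measure intensity ({0<..1} \<times> grid_cell m i)) * (1 - limit_twist \<alpha> t \<kappa> (real (i + 1) / real m)))
     \<longlonglongrightarrow> (\<integral>u. indicator {0<..1} u *\<^sub>R ((1 / u) *\<^sub>R (1 - limit_twist \<alpha> t \<kappa> u)) \<partial>lborel)"
proof -
  define g where "g = (\<lambda>u. 1 - limit_twist \<alpha> t \<kappa> u)"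
  define h where "h = (\<lambda>m u. \<Sum>i<m - 1. (indicator (grid_cell m i) u * (1 / u)) *\<^sub>R g (real (i + 1) / real m))"
  have g0: "g 0 = 0" proof -
    have "Complex 0 0 = 0" by (simp add: complex_eq_iff)
    then show ?thesis using \<alpha> by (simp add: g_def limit_twist_def)
  qed
  have gb: "norm (g u) \<le> \<kappa> * u + \<bar>t\<bar> * u powr \<alpha>" if "u \<ge> 0" for u
    using norm_one_minus_exp_le[of "\<kappa> * u" "t * u powr \<alpha>"] \<kappa> that by (simp add: g_def limit_twist_def abs_mult)
  have gmeas: "g \<in> borel_measurable borel"
  proof -
    have "g = (\<lambda>u. 1 - exp (of_real (- (\<kappa> * u)) + \<i> * of_real (t * u powr \<alpha>)))"
      by (rule ext) (simp add: g_def limit_twist_def complex_eq_iff Complex_eq)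
    then show ?thesis by simp
  qed
  have gcont: "(\<lambda>m. g (grid_floor m u)) \<longlonglongrightarrow> g u" if "u > 0" for u
  proof -
    have l: "(\<lambda>m. grid_floor m u) \<longlonglongrightarrow> u" using that by (rule grid_floor_tendsto)
    have "(\<lambda>m. grid_floor m u powr \<alpha>) \<longlonglongrightarrow> u powr \<alpha>"
      using that by (intro tendsto_powr l tendsto_const) auto
    then show ?thesis unfolding g_def limit_twist_def
      by (intro tendsto_diff tendsto_exp tendsto_Complex tendsto_minus tendsto_mult tendsto_const l)
  qed
  have h_eq: "h m u = indicator {0<..1} u *\<^sub>R ((1 / u) *\<^sub>R g (grid_floor m u))" if m: "m > 0" for m u
  proof (cases "u \<in> {0<..1}")
    case True
    have "h m u = (1 / u) *\<^sub>R (\<Sum>i<m - 1. indicator (grid_cell m i) u *\<^sub>R g (real (i + 1) / real m))"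
      unfolding h_def scaleR_sum_right by (intro sum.cong refl) (simp only: scaleR_scaleR mult.commute)
    then show ?thesis using sum_grid_cells[where m = m and x = u and g = g] m g0 True by simp
  next
    case False
    then have "u \<notin> grid_cell m i" if "i < m - 1" for i using grid_cell_subset[OF m that] by auto
    then show ?thesis using False by (simp add: h_def)
  qed
  have "(\<lambda>m. \<integral>u. h m u \<partial>lborel) \<longlonglongrightarrow> (\<integral>u. indicator {0<..1} u *\<^sub>R ((1 / u) *\<^sub>R g u) \<partial>lborel)"
  proof (rule integral_dominated_convergence)
    show "integrable lborel (\<lambda>u. \<kappa> * (indicator {0<..1} u * u powr (1 - 1)) + \<bar>t\<bar> * (indicator {0<..1} u * u powr (\<alpha> - 1)))"
      using \<alpha> by (intro Bochner_Integration.integrable_add integrable_mult_right integrable_powr_unit_interval) auto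
    show "(\<lambda>u. indicator {0<..1} u *\<^sub>R ((1 / u) *\<^sub>R g u)) \<in> borel_measurable lborel"
      using gmeas by measurable
    show "h m \<in> borel_measurable lborel" for m unfolding h_def by measurable
    have "(\<lambda>m. h m u) \<longlonglongrightarrow> indicator {0<..1} u *\<^sub>R ((1 / u) *\<^sub>R g u)" for u
    proof (rule Lim_transform_eventually)
      show "\<forall>\<^sub>F m in sequentially. indicator {0<..1} u *\<^sub>R ((1 / u) *\<^sub>R g (grid_floor m u)) = h m u"
        using eventually_gt_at_top[of 0] by eventually_elim (simp add: h_eq)
      show "(\<lambda>m. indicator {0<..1} u *\<^sub>R ((1 / u) *\<^sub>R g (grid_floor m u))) \<longlonglongrightarrow> indicator {0<..1} u *\<^sub>R ((1 / u) *\<^sub>R g u)"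
      proof (cases "u \<in> {0<..1}")
        case True
        then show ?thesis by (intro tendsto_scaleR tendsto_const gcont) auto
      qed simp
    qed
    then show "AE u in lborel. (\<lambda>m. h m u) \<longlonglongrightarrow> indicator {0<..1} u *\<^sub>R ((1 / u) *\<^sub>R g u)" by simp
    have "norm (h m u) \<le> \<kappa> * (indicator {0<..1} u * u powr (1 - 1)) + \<bar>t\<bar> * (indicator {0<..1} u * u powr (\<alpha> - 1))" for m u
    proof (cases "m > 0 \<and> u \<in> {0<..1}")
      case True
      then have u: "m > 0" "u > 0" "u \<le> 1" by auto
      have "norm (h m u) = 1 / u * norm (g (grid_floor m u))" using u by (simp add: h_eq)
      also have "\<dots> \<le> 1 / u * (\<kappa> * grid_floor m u + \<bar>t\<bar> * grid_floor m u powr \<alpha>)"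
        using u grid_floor_bounds[OF u(1,2)] by (intro mult_left_mono gb) auto
      also have "\<dots> \<le> 1 / u * (\<kappa> * u + \<bar>t\<bar> * u powr \<alpha>)"
        using u grid_floor_bounds[OF u(1,2)] \<kappa> \<alpha> by (intro mult_left_mono add_mono powr_mono2) auto
      also have "\<dots> = \<kappa> * (indicator {0<..1} u * u powr (1 - 1)) + \<bar>t\<bar> * (indicator {0<..1} u * u powr (\<alpha> - 1))"
        using u by (simp add: powr_diff field_simps)
      finally show ?thesis .
    next
      case False
      then have "h m u = 0" by (cases "m > 0") (auto simp: h_eq, simp add: h_def)
      then show ?thesis using \<kappa> by simp
    qed
    then show "AE u in lborel. norm (h m u) \<le> \<kappa> * (indicator {0<..1} u * u powr (1 - 1)) + \<bar>t\<bar> * (indicator {0<..1} u * u powr (\<alpha> - 1))" for m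
      by simp
  qed
  moreover have "(\<integral>u. h m u \<partial>lborel) = (\<Sum>i<m - 1. of_real (measure intensity ({0<..1} \<times> grid_cell m i)) * g (real (i + 1) / real m))" for m
  proof -
    have m: "m > 0" if "i < m - 1" for i using that by simp
    have "(\<integral>u. h m u \<partial>lborel) = (\<Sum>i<m - 1. \<integral>u. (indicator (grid_cell m i) u * (1 / u)) *\<^sub>R g (real (i + 1) / real m) \<partial>lborel)"
      unfolding h_def using m
      by (intro Bochner_Integration.integral_sum integrable_scaleR_left measure_intensity_grid_cell(2)) auto
    also have "\<dots> = (\<Sum>i<m - 1. of_real (measure intensity ({0<..1} \<times> grid_cell m i)) * g (real (i + 1) / real m))"
    proof (intro sum.cong refl)
      fix i assume "i \<in> {..<m - 1}"
      then have i: "m > 0" "i < m - 1" using m by auto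
      show "(\<integral>u. (indicator (grid_cell m i) u * (1 / u)) *\<^sub>R g (real (i + 1) / real m) \<partial>lborel) =
        of_real (measure intensity ({0<..1} \<times> grid_cell m i)) * g (real (i + 1) / real m)"
        unfolding measure_intensity_grid_cell(3)[OF i] scaleR_conv_of_real[symmetric]
        by (intro integral_scaleR_left measure_intensity_grid_cell(2)[OF i])
    qed
    finally show ?thesis .
  qed
  ultimately show ?thesis by (simp add: g_def)
qed

text \<open>After discretisation both integrals are linear combinations of the independent Poisson counts of
  the same cells, so the transform is a product of Poisson transforms; then the mesh tends to \<open>0\<close>.\<close>

lemma poisson_joint_transform:
  assumes prm: "poisson_random_measure M intensity \<eta>" and \<alpha>: "\<alpha> > 0"
  shows "(\<integral>\<omega>. iexp (t * enn2real (power_integral (\<eta> \<omega>) \<alpha>)) * of_real (exp (- enn2real (power_integral (\<eta> \<omega>) 1))) ^ k \<partial>M)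
    = exp (- (\<integral>u. indicator {0<..1} u *\<^sub>R ((1 / u) *\<^sub>R (1 - limit_twist \<alpha> t (real k) u)) \<partial>lborel))"
proof -
  interpret prob_space M using prm by (simp add: poisson_random_measure_def)
  define R where "R = (\<lambda>m i. {0<..1::real} \<times> grid_cell m i)"
  define c where "c = (\<lambda>m i. Complex (- (real k * (real (i + 1) / real m))) (t * (real (i + 1) / real m) powr \<alpha>))"
  define F where "F = (\<lambda>m \<omega>. \<Prod>i<m - 1. exp (c m i * of_real (enn2real (emeasure (\<eta> \<omega>) (R m i)))))"
  define G where "G = (\<lambda>\<omega>. iexp (t * enn2real (power_integral (\<eta> \<omega>) \<alpha>)) * of_real (exp (- enn2real (power_integral (\<eta> \<omega>) 1))) ^ k)"
  have Rs: "R m i \<in> sets intensity" if "i < m - 1" for m i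
    unfolding R_def using that by (intro rect_in_sets_intensity grid_cell_sets grid_cell_subset) auto
  have Rmeas: "(\<lambda>\<omega>. emeasure (\<eta> \<omega>) (R m i)) \<in> borel_measurable M" if "i < m - 1" for m i
    using prm Rs[OF that] by (simp add: poisson_random_measure_def)
  have disj: "disjoint_family_on (R m) {..<m - 1}" for m
    unfolding disjoint_family_on_def
  proof (intro ballI impI)
    fix i j assume ij: "i \<in> {..<m - 1}" "j \<in> {..<m - 1}" "i \<noteq> j"
    then have m: "m > 0" by auto
    have "grid_cell m i \<inter> grid_cell m j = {}" using ij grid_cell_iff[OF m] by auto
    then show "R m i \<inter> R m j = {}" by (auto simp: R_def)
  qed
  have Fmeas: "F m \<in> borel_measurable M" for m
    unfolding F_def using Rmeas by (intro borel_measurable_prod) simp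
  have Rec: "Re (c m i) \<le> 0" for m i by (simp add: c_def)
  have EF: "(\<integral>\<omega>. F m \<omega> \<partial>M) = exp (- (\<Sum>i<m - 1. of_real (measure intensity (R m i)) * (1 - limit_twist \<alpha> t (real k) (real (i + 1) / real m))))"
    if m: "m > 1" for m
  proof -
    have "indep_vars (\<lambda>_. borel) (\<lambda>i \<omega>. emeasure (\<eta> \<omega>) (R m i)) {..<m - 1}"
      using prm disj[of m] Rs unfolding poisson_random_measure_def by blast
    then have ind: "indep_vars (\<lambda>_. borel) (\<lambda>i \<omega>. exp (c m i * of_real (enn2real (emeasure (\<eta> \<omega>) (R m i))))) {..<m - 1}"
      by (rule indep_vars_compose2) simp
    have "(\<integral>\<omega>. F m \<omega> \<partial>M) = (\<Prod>i<m - 1. \<integral>\<omega>. exp (c m i * of_real (enn2real (emeasure (\<eta> \<omega>) (R m i)))) \<partial>M)"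
      unfolding F_def
    proof (rule indep_vars_lebesgue_integral[OF _ ind])
      fix i assume i: "i \<in> {..<m - 1}"
      show "integrable M (\<lambda>\<omega>. exp (c m i * of_real (enn2real (emeasure (\<eta> \<omega>) (R m i)))))"
        using Rmeas[of i m] i Rec[of m i]
        by (intro integrable_const_bound[where B = 1]) (auto simp: mult_nonpos_nonneg)
    qed simp
    also have "\<dots> = (\<Prod>i<m - 1. exp (- (of_real (measure intensity (R m i)) * (1 - exp (c m i)))))"
      using m Rs Rec by (intro prod.cong refl poisson_count_transform[OF prm])
        (auto simp: R_def intro!: measure_intensity_grid_cell(1)[simplified])
    also have "\<dots> = exp (- (\<Sum>i<m - 1. of_real (measure intensity (R m i)) * (1 - limit_twist \<alpha> t (real k) (real (i + 1) / real m))))"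
      unfolding sum_negf[symmetric] by (subst exp_sum) (simp_all add: c_def limit_twist_def)
    finally show ?thesis .
  qed
  have lim1: "(\<lambda>m. \<integral>\<omega>. F m \<omega> \<partial>M) \<longlonglongrightarrow> (\<integral>\<omega>. G \<omega> \<partial>M)"
  proof (rule integral_dominated_convergence)
    show "integrable M (\<lambda>_. 1 :: real)" by simp
    show "G \<in> borel_measurable M"
      unfolding G_def using power_integral_mean(1)[OF prm, of \<alpha>] power_integral_mean(1)[OF prm, of 1]
      by measurable
    show "F m \<in> borel_measurable M" for m by (rule Fmeas)
    show "AE \<omega> in M. norm (F m \<omega>) \<le> 1" for m
    proof (rule AE_I2)
      fix \<omega>
      have "norm (F m \<omega>) = (\<Prod>i<m - 1. norm (exp (c m i * of_real (enn2real (emeasure (\<eta> \<omega>) (R m i))))))"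
        unfolding F_def by (rule prod_norm[symmetric])
      also have "\<dots> \<le> 1" using Rec by (intro prod_le_1) (auto simp: mult_nonpos_nonneg)
      finally show "norm (F m \<omega>) \<le> 1" .
    qed
    show "AE \<omega> in M. (\<lambda>m. F m \<omega>) \<longlonglongrightarrow> G \<omega>"
      using power_integral_AE_finite[OF prm \<alpha>] power_integral_AE_finite[OF prm zero_less_one] AE_space
    proof eventually_elim
      case (elim \<omega>)
      have sets: "sets (\<eta> \<omega>) = sets intensity" using prm elim(3) by (simp add: poisson_random_measure_def)
      define X where "X = (\<lambda>m. \<Sum>i<m - 1. (real (i + 1) / real m) powr \<alpha> * enn2real (emeasure (\<eta> \<omega>) (R m i)))"
      define Y where "Y = (\<lambda>m. \<Sum>i<m - 1. (real (i + 1) / real m) powr 1 * enn2real (emeasure (\<eta> \<omega>) (R m i)))"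
      have X: "X \<longlonglongrightarrow> enn2real (power_integral (\<eta> \<omega>) \<alpha>)"
        unfolding X_def R_def by (rule grid_sums_tendsto_power_integral[OF sets \<alpha> elim(1)])
      have Y: "Y \<longlonglongrightarrow> enn2real (power_integral (\<eta> \<omega>) 1)"
        unfolding Y_def R_def by (rule grid_sums_tendsto_power_integral[OF sets zero_less_one elim(2)])
      have "F m \<omega> = iexp (t * X m) * of_real (exp (- Y m)) ^ k" for m
      proof -
        have "F m \<omega> = exp (\<Sum>i<m - 1. c m i * of_real (enn2real (emeasure (\<eta> \<omega>) (R m i))))"
          unfolding F_def by (simp add: exp_sum)
        also have "(\<Sum>i<m - 1. c m i * of_real (enn2real (emeasure (\<eta> \<omega>) (R m i)))) = \<i> * of_real (t * X m) + of_nat k * of_real (- Y m)"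
          by (simp add: complex_eq_iff c_def X_def Y_def sum_distrib_left sum_negf mult_ac del: of_nat_Suc of_nat_add)
        also have "exp \<dots> = iexp (t * X m) * of_real (exp (- Y m)) ^ k"
          by (simp only: exp_add exp_of_nat_mult exp_of_real)
        finally show ?thesis .
      qed
      moreover have "(\<lambda>m. iexp (t * X m) * of_real (exp (- Y m)) ^ k) \<longlonglongrightarrow> G \<omega>"
        unfolding G_def by (intro tendsto_intros X Y)
      ultimately show ?case by simp
    qed
  qed
  have "(\<lambda>m. exp (- (\<Sum>i<m - 1. of_real (measure intensity (R m i)) * (1 - limit_twist \<alpha> t (real k) (real (i + 1) / real m)))))
    \<longlonglongrightarrow> exp (- (\<integral>u. indicator {0<..1} u *\<^sub>R ((1 / u) *\<^sub>R (1 - limit_twist \<alpha> t (real k) u)) \<partial>lborel))"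
    unfolding R_def by (intro tendsto_intros grid_transform_tendsto \<alpha>) simp
  then have "(\<lambda>m. \<integral>\<omega>. F m \<omega> \<partial>M)
    \<longlonglongrightarrow> exp (- (\<integral>u. indicator {0<..1} u *\<^sub>R ((1 / u) *\<^sub>R (1 - limit_twist \<alpha> t (real k) u)) \<partial>lborel))"
    by (rule Lim_transform_eventually) (use EF in \<open>auto intro!: eventually_mono[OF eventually_gt_at_top[of 1]]\<close>)
  from LIMSEQ_unique[OF lim1 this] show ?thesis by (simp add: G_def)
qed

section \<open>Passing from transforms to a threshold event\<close>

text \<open>By linearity the hypothesis covers all polynomials in \<open>U\<close>, and polynomials approximate \<open>f\<close> uniformly on
  \<open>[0,1]\<close>.\<close>

lemma continuous_test_convergence:
  fixes \<xi> :: "nat \<Rightarrow> 'a \<Rightarrow> complex" and U :: "nat \<Rightarrow> 'a \<Rightarrow> real"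
    and \<xi>' :: "'b \<Rightarrow> complex" and U' :: "'b \<Rightarrow> real"
  assumes P: "\<And>n. prob_space (P n)" and M: "prob_space M"
    and meas: "\<And>n. \<xi> n \<in> borel_measurable (P n)" "\<And>n. U n \<in> borel_measurable (P n)"
      "\<xi>' \<in> borel_measurable M" "U' \<in> borel_measurable M"
    and bnd: "\<And>n x. norm (\<xi> n x) \<le> 1" "\<And>x. norm (\<xi>' x) \<le> 1"
      "\<And>n x. U n x \<in> {0..1}" "\<And>x. U' x \<in> {0..1}"
    and mom: "\<And>k. (\<lambda>n. \<integral>x. \<xi> n x * of_real (U n x) ^ k \<partial>P n) \<longlonglongrightarrow> (\<integral>x. \<xi>' x * of_real (U' x) ^ k \<partial>M)"
    and f: "continuous_on {0..1} f" "f \<in> borel_measurable borel"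
  shows "(\<lambda>n. \<integral>x. \<xi> n x * of_real (f (U n x)) \<partial>P n) \<longlonglongrightarrow> (\<integral>x. \<xi>' x * of_real (f (U' x)) \<partial>M)"
proof -
  have bounded_integrable: "integrable N (\<lambda>x. \<zeta> x * of_real (h (V x)))"
    if "prob_space N" "\<zeta> \<in> borel_measurable N" "V \<in> borel_measurable N" "h \<in> borel_measurable borel"
      "\<And>x. norm (\<zeta> x) \<le> 1" "\<And>x. V x \<in> {0..1}" "continuous_on {0..1} h"
    for N :: "'c measure" and \<zeta> :: "'c \<Rightarrow> complex" and V and h :: "real \<Rightarrow> real"
  proof -
    interpret N: prob_space N by fact
    have "bounded (h ` {0..1})" using that(7) by (intro compact_imp_bounded compact_continuous_image) auto
    then obtain B where "\<forall>y\<in>h ` {0..1}. norm y \<le> B" unfolding bounded_iff by blast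
    then have B: "\<And>u. u \<in> {0..1} \<Longrightarrow> norm (h u) \<le> B" by blast
    show ?thesis
    proof (rule N.integrable_const_bound[where B = B])
      have "norm (\<zeta> x * of_real (h (V x))) \<le> 1 * B" for x
        unfolding norm_mult using that(5)[of x] B[OF that(6)[of x]] by (intro mult_mono) auto
      then show "AE x in N. norm (\<zeta> x * of_real (h (V x))) \<le> B" by simp
      show "(\<lambda>x. \<zeta> x * of_real (h (V x))) \<in> borel_measurable N"
        using that(2,3,4) by measurable
    qed
  qed
  have close: "norm ((\<integral>x. \<zeta> x * of_real (f (V x)) \<partial>N) - (\<integral>x. \<zeta> x * of_real (h (V x)) \<partial>N)) \<le> e"
    if "prob_space N" "\<zeta> \<in> borel_measurable N" "V \<in> borel_measurable N" "h \<in> borel_measurable borel"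
      "\<And>x. norm (\<zeta> x) \<le> 1" "\<And>x. V x \<in> {0..1}" "continuous_on {0..1} h" "\<And>u. u \<in> {0..1} \<Longrightarrow> \<bar>f u - h u\<bar> \<le> e"
    for N :: "'c measure" and \<zeta> :: "'c \<Rightarrow> complex" and V and h :: "real \<Rightarrow> real" and e
  proof -
    interpret N: prob_space N by fact
    have i: "integrable N (\<lambda>x. \<zeta> x * of_real (f (V x)))" "integrable N (\<lambda>x. \<zeta> x * of_real (h (V x)))"
      by (rule bounded_integrable[OF that(1,2,3) f(2) that(5,6) f(1)],
          rule bounded_integrable[OF that(1,2,3,4,5,6,7)])
    have "(\<integral>x. \<zeta> x * of_real (f (V x)) \<partial>N) - (\<integral>x. \<zeta> x * of_real (h (V x)) \<partial>N) =
      (\<integral>x. \<zeta> x * of_real (f (V x)) - \<zeta> x * of_real (h (V x)) \<partial>N)"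
      by (rule Bochner_Integration.integral_diff[OF i, symmetric])
    also have "norm \<dots> \<le> (\<integral>x. norm (\<zeta> x * of_real (f (V x)) - \<zeta> x * of_real (h (V x))) \<partial>N)"
      by (rule integral_norm_bound)
    also have "\<dots> \<le> (\<integral>x. e \<partial>N)"
    proof (rule integral_mono)
      fix x
      have "norm (\<zeta> x * of_real (f (V x)) - \<zeta> x * of_real (h (V x))) = norm (\<zeta> x) * \<bar>f (V x) - h (V x)\<bar>"
        by (simp add: norm_mult flip: right_diff_distrib of_real_diff)
      also have "\<dots> \<le> 1 * e" using that(5)[of x] that(8)[OF that(6)[of x]] by (intro mult_mono) auto
      finally show "norm (\<zeta> x * of_real (f (V x)) - \<zeta> x * of_real (h (V x))) \<le> e" by simp
    qed (use i in auto)
    also have "\<dots> = e" by (simp add: N.prob_space)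
    finally show ?thesis .
  qed
  show ?thesis
  proof (rule LIMSEQ_I)
    fix r :: real assume r: "r > 0"
    obtain g where g: "real_polynomial_function g" "\<And>u. u \<in> {0..1} \<Longrightarrow> \<bar>f u - g u\<bar> < r / 4"
      using Stone_Weierstrass_real_polynomial_function[OF compact_Icc f(1), of "r / 4"] r by auto
    then obtain a d where ad: "g = (\<lambda>u. \<Sum>i\<le>d. a i * u ^ i)"
      using real_polynomial_function_iff_sum by blast
    have gc: "continuous_on {0..1} g" "g \<in> borel_measurable borel" unfolding ad by (auto intro!: continuous_intros)
    have gint: "(\<integral>x. \<zeta> x * of_real (g (V x)) \<partial>N) = (\<Sum>i\<le>d. of_real (a i) * (\<integral>x. \<zeta> x * of_real (V x) ^ i \<partial>N))"
      if "prob_space N" "\<zeta> \<in> borel_measurable N" "V \<in> borel_measurable N"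
        "\<And>x. norm (\<zeta> x) \<le> 1" "\<And>x. V x \<in> {0..1}" for N :: "'c measure" and \<zeta> :: "'c \<Rightarrow> complex" and V
    proof -
      have "integrable N (\<lambda>x. \<zeta> x * of_real (V x ^ i))" for i
        using that by (intro bounded_integrable) (auto intro!: continuous_intros)
      then have i: "integrable N (\<lambda>x. \<zeta> x * of_real (V x) ^ i)" for i by simp
      have "(\<integral>x. \<zeta> x * of_real (g (V x)) \<partial>N) = (\<integral>x. (\<Sum>j\<le>d. of_real (a j) * (\<zeta> x * of_real (V x) ^ j)) \<partial>N)"
        by (simp add: ad sum_distrib_left mult_ac)
      also have "\<dots> = (\<Sum>j\<le>d. \<integral>x. of_real (a j) * (\<zeta> x * of_real (V x) ^ j) \<partial>N)"
        using i by (intro Bochner_Integration.integral_sum integrable_mult_right)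
      finally show ?thesis by simp
    qed
    have "(\<lambda>n. \<integral>x. \<xi> n x * of_real (g (U n x)) \<partial>P n) \<longlonglongrightarrow> (\<integral>x. \<xi>' x * of_real (g (U' x)) \<partial>M)"
      using gint[OF P meas(1,2) bnd(1,3)] gint[OF M meas(3,4) bnd(2,4)]
      by (simp add: tendsto_sum tendsto_mult_left mom)
    then obtain n0 where n0: "\<And>n. n \<ge> n0 \<Longrightarrow> norm ((\<integral>x. \<xi> n x * of_real (g (U n x)) \<partial>P n) - (\<integral>x. \<xi>' x * of_real (g (U' x)) \<partial>M)) < r / 4"
      using LIMSEQ_D[of _ _ "r / 4"] r by fastforce
    show "\<exists>no. \<forall>n\<ge>no. norm ((\<integral>x. \<xi> n x * of_real (f (U n x)) \<partial>P n) - (\<integral>x. \<xi>' x * of_real (f (U' x)) \<partial>M)) < r"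
    proof (intro exI[of _ n0] allI impI)
      fix n assume n: "n \<ge> n0"
      have "norm ((\<integral>x. \<xi> n x * of_real (f (U n x)) \<partial>P n) - (\<integral>x. \<xi> n x * of_real (g (U n x)) \<partial>P n)) \<le> r / 4"
        by (rule close[OF P meas(1,2) gc(2) bnd(1,3) gc(1)]) (use g(2) in force)
      moreover have "norm ((\<integral>x. \<xi>' x * of_real (f (U' x)) \<partial>M) - (\<integral>x. \<xi>' x * of_real (g (U' x)) \<partial>M)) \<le> r / 4"
        by (rule close[OF M meas(3,4) gc(2) bnd(2,4) gc(1)]) (use g(2) in force)
      ultimately show "norm ((\<integral>x. \<xi> n x * of_real (f (U n x)) \<partial>P n) - (\<integral>x. \<xi>' x * of_real (f (U' x)) \<partial>M)) < r"
        using n0[OF n] r by norm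
    qed
  qed
qed

text \<open>The indicator of \<open>[c, \<infinity>)\<close> is replaced by a continuous ramp that rises on \<open>(b, c)\<close>. The
  cost is the mass of \<open>(b, c)\<close>, which is small along the sequence by hypothesis and small
  in the limit by continuity of measure from above, because \<open>c\<close> itself is excluded.\<close>

lemma threshold_convergence:
  fixes \<xi> :: "nat \<Rightarrow> 'a \<Rightarrow> complex" and U :: "nat \<Rightarrow> 'a \<Rightarrow> real"
    and \<xi>' :: "'b \<Rightarrow> complex" and U' :: "'b \<Rightarrow> real"
  assumes P: "\<And>n. prob_space (P n)" and M: "prob_space M"
    and meas: "\<And>n. \<xi> n \<in> borel_measurable (P n)" "\<And>n. U n \<in> borel_measurable (P n)"
      "\<xi>' \<in> borel_measurable M" "U' \<in> borel_measurable M"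
    and bnd: "\<And>n x. norm (\<xi> n x) \<le> 1" "\<And>x. norm (\<xi>' x) \<le> 1"
      "\<And>n x. U n x \<in> {0..1}" "\<And>x. U' x \<in> {0..1}"
    and mom: "\<And>k. (\<lambda>n. \<integral>x. \<xi> n x * of_real (U n x) ^ k \<partial>P n) \<longlonglongrightarrow> (\<integral>x. \<xi>' x * of_real (U' x) ^ k \<partial>M)"
    and small: "\<And>e. e > 0 \<Longrightarrow> \<exists>b<c. \<forall>\<^sub>F n in sequentially. measure (P n) {x \<in> space (P n). b < U n x \<and> U n x < c} \<le> e"
  shows "(\<lambda>n. \<integral>x. \<xi> n x * indicator {c..} (U n x) \<partial>P n) \<longlonglongrightarrow> (\<integral>x. \<xi>' x * indicator {c..} (U' x) \<partial>M)"
proof -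
  define ramp where "ramp = (\<lambda>b u. max 0 (min 1 ((u - b) / (c - b))))"
  have close: "norm ((\<integral>x. \<zeta> x * indicator {c..} (V x) \<partial>N) - (\<integral>x. \<zeta> x * of_real (ramp b (V x)) \<partial>N))
      \<le> measure N {x \<in> space N. b < V x \<and> V x < c}"
    if "prob_space N" "\<zeta> \<in> borel_measurable N" "V \<in> borel_measurable N" "\<And>x. norm (\<zeta> x) \<le> 1" "b < c"
    for N :: "'c measure" and \<zeta> :: "'c \<Rightarrow> complex" and V b
  proof -
    interpret N: prob_space N by fact
    note [measurable] = that(2,3)
    have ramp: "0 \<le> ramp b u" "ramp b u \<le> 1" "u \<ge> c \<Longrightarrow> ramp b u = 1" "u \<le> b \<Longrightarrow> ramp b u = 0" for u
      using that(5) by (auto simp: ramp_def divide_le_0_iff field_simps min_def max_def)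
    have i1: "integrable N (\<lambda>x. \<zeta> x * indicator {c..} (V x))"
      by (rule N.integrable_const_bound[where B = 1]) (use that(4) in \<open>auto simp: norm_mult indicator_def\<close>)
    have i2: "integrable N (\<lambda>x. \<zeta> x * of_real (ramp b (V x)))"
    proof (rule N.integrable_const_bound[where B = 1])
      have "norm (\<zeta> x * of_real (ramp b (V x))) \<le> 1 * 1" for x
        unfolding norm_mult using that(4)[of x] ramp(1,2)[of "V x"] by (intro mult_mono) auto
      then show "AE x in N. norm (\<zeta> x * of_real (ramp b (V x))) \<le> 1" by simp
      show "(\<lambda>x. \<zeta> x * of_real (ramp b (V x))) \<in> borel_measurable N" unfolding ramp_def by measurable
    qed
    have "(\<integral>x. \<zeta> x * indicator {c..} (V x) \<partial>N) - (\<integral>x. \<zeta> x * of_real (ramp b (V x)) \<partial>N) =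
      (\<integral>x. \<zeta> x * indicator {c..} (V x) - \<zeta> x * of_real (ramp b (V x)) \<partial>N)"
      by (rule Bochner_Integration.integral_diff[OF i1 i2, symmetric])
    also have "norm \<dots> \<le> (\<integral>x. norm (\<zeta> x * indicator {c..} (V x) - \<zeta> x * of_real (ramp b (V x))) \<partial>N)"
      by (rule integral_norm_bound)
    also have "\<dots> \<le> (\<integral>x. indicator {x \<in> space N. b < V x \<and> V x < c} x \<partial>N)"
    proof (rule integral_mono)
      fix x assume x: "x \<in> space N"
      have "norm (\<zeta> x * indicator {c..} (V x) - \<zeta> x * of_real (ramp b (V x))) =
        norm (\<zeta> x) * norm (indicator {c..} (V x) - complex_of_real (ramp b (V x)))"
        by (simp add: norm_mult flip: right_diff_distrib)
      also have "\<dots> \<le> 1 * norm (indicator {c..} (V x) - complex_of_real (ramp b (V x)))"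
        using that(4) by (intro mult_right_mono) auto
      also have "\<dots> \<le> indicator {x \<in> space N. b < V x \<and> V x < c} x"
      proof -
        consider "V x \<ge> c" | "V x \<le> b" | "b < V x" "V x < c" by linarith
        then show ?thesis
          by cases (use x ramp[of "V x"] that(5) in \<open>auto simp: indicator_def\<close>)
      qed
      finally show "norm (\<zeta> x * indicator {c..} (V x) - \<zeta> x * of_real (ramp b (V x))) \<le> indicator {x \<in> space N. b < V x \<and> V x < c} x" .
    qed (use i1 i2 in \<open>auto intro!: integrable_real_indicator simp: N.emeasure_eq_measure\<close>)
    also have "\<dots> = measure N {x \<in> space N. b < V x \<and> V x < c}"
      by (simp add: Int_def conj_commute)
    finally show ?thesis .
  qed
  interpret M: prob_space M by fact
  note [measurable] = meas(3,4)
  have tail: "\<exists>b<c. M.prob {x \<in> space M. b < U' x \<and> U' x < c} \<le> e" if e: "e > 0" for e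
  proof -
    let ?S = "\<lambda>j::nat. {x \<in> space M. c - 1 / real (Suc j) < U' x \<and> U' x < c}"
    have "(\<lambda>j. M.prob (?S j)) \<longlonglongrightarrow> M.prob (\<Inter>j. ?S j)"
    proof (rule M.finite_Lim_measure_decseq)
      have "?S j \<in> M.events" for j by measurable
      then show "range ?S \<subseteq> M.events" by blast
      show "decseq ?S" unfolding decseq_def
      proof (intro allI impI subsetI)
        fix i j :: nat and x assume "i \<le> j" "x \<in> ?S j"
        moreover have "1 / real (Suc j) \<le> 1 / real (Suc i)" using \<open>i \<le> j\<close> by (intro divide_left_mono) auto
        ultimately show "x \<in> ?S i" by auto
      qed
    qed
    moreover have "(\<Inter>j. ?S j) = {}"
    proof (rule ccontr)
      assume "(\<Inter>j. ?S j) \<noteq> {}"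
      then obtain x where x: "\<And>j. c - 1 / real (Suc j) < U' x" "U' x < c" by blast
      obtain j where "1 / real (Suc j) < c - U' x" using reals_Archimedean[of "c - U' x"] x(2)
        by (auto simp: inverse_eq_divide)
      then show False using x(1)[of j] by linarith
    qed
    ultimately have "(\<lambda>j. M.prob (?S j)) \<longlonglongrightarrow> 0" by simp
    then have "\<forall>\<^sub>F j in sequentially. M.prob (?S j) < e" using e by (simp add: order_tendstoD)
    then obtain j where "M.prob (?S j) < e" by (auto simp: eventually_sequentially)
    then show ?thesis by (intro exI[of _ "c - 1 / real (Suc j)"]) auto
  qed
  show ?thesis
  proof (rule LIMSEQ_I)
    fix r :: real assume r: "r > 0"
    obtain b1 where b1: "b1 < c" "\<forall>\<^sub>F n in sequentially. measure (P n) {x \<in> space (P n). b1 < U n x \<and> U n x < c} \<le> r / 4"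
      using small[of "r / 4"] r by auto
    obtain b2 where b2: "b2 < c" "M.prob {x \<in> space M. b2 < U' x \<and> U' x < c} \<le> r / 4"
      using tail[of "r / 4"] r by auto
    define b where "b = max b1 b2"
    have b: "b < c" using b1 b2 by (simp add: b_def)
    have "M.prob {x \<in> space M. b < U' x \<and> U' x < c} \<le> M.prob {x \<in> space M. b2 < U' x \<and> U' x < c}"
      by (intro M.finite_measure_mono) (auto simp: b_def)
    then have m2: "M.prob {x \<in> space M. b < U' x \<and> U' x < c} \<le> r / 4" using b2 by simp
    have rc: "continuous_on {0..1} (ramp b)" "ramp b \<in> borel_measurable borel"
      unfolding ramp_def using b by (auto intro!: continuous_intros)
    have conv: "(\<lambda>n. \<integral>x. \<xi> n x * of_real (ramp b (U n x)) \<partial>P n) \<longlonglongrightarrow> (\<integral>x. \<xi>' x * of_real (ramp b (U' x)) \<partial>M)"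
      by (rule continuous_test_convergence[OF P M meas bnd mom rc])
    have "\<forall>\<^sub>F n in sequentially. norm ((\<integral>x. \<xi> n x * of_real (ramp b (U n x)) \<partial>P n) - (\<integral>x. \<xi>' x * of_real (ramp b (U' x)) \<partial>M)) < r / 4"
      using tendstoD[OF conv, of "r / 4"] r by (simp add: dist_norm)
    with b1(2) have "\<forall>\<^sub>F n in sequentially. norm ((\<integral>x. \<xi> n x * indicator {c..} (U n x) \<partial>P n) - (\<integral>x. \<xi>' x * indicator {c..} (U' x) \<partial>M)) < r"
    proof eventually_elim
      case (elim n)
      interpret Pn: prob_space "P n" by (rule P)
      have "Pn.prob {x \<in> space (P n). b < U n x \<and> U n x < c} \<le> Pn.prob {x \<in> space (P n). b1 < U n x \<and> U n x < c}"
        using meas(2)[of n] by (intro Pn.finite_measure_mono) (auto simp: b_def)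
      then have m1: "Pn.prob {x \<in> space (P n). b < U n x \<and> U n x < c} \<le> r / 4" using elim(1) by simp
      show ?case
        using close[OF P meas(1,2) bnd(1) b, of n] close[OF M meas(3,4) bnd(2) b] m1 m2 elim(2) r by norm
    qed
    then show "\<exists>no. \<forall>n\<ge>no. norm ((\<integral>x. \<xi> n x * indicator {c..} (U n x) \<partial>P n) - (\<integral>x. \<xi>' x * indicator {c..} (U' x) \<partial>M)) < r"
      by (simp add: eventually_sequentially)
  qed
qed

section \<open>Conditioning\<close>

lemma harm_diff_le_ln:
  assumes "n > 0" "n \<le> N"
  shows "(\<Sum>m\<in>{n<..N}. 1 / real m) \<le> ln (real N) - ln (real n)"
  using assms(2)
proof (induction N rule: dec_induct)
  case (step N)
  have N: "N > 0" using step assms by simp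
  have "1 / real (Suc N) \<le> - ln (1 - 1 / real (Suc N))"
    using ln_le_minus_one[of "1 - 1 / real (Suc N)"] N by simp
  also have "1 - 1 / real (Suc N) = real N / real (Suc N)" by (simp add: field_simps)
  also have "- ln (real N / real (Suc N)) = ln (real (Suc N)) - ln (real N)" using N by (simp add: ln_div del: of_nat_Suc)
  finally have "1 / real (Suc N) \<le> ln (real (Suc N)) - ln (real N)" .
  moreover have "{n<..Suc N} = insert (Suc N) {n<..N}" using step by auto
  ultimately show ?case using step by simp
qed simp

text \<open>On \<open>{1..n}\<close> the smooth law is proportional to \<open>1 / k\<close>, like the harmonic law; the factor in front of
  the sum cancels in the quotient by the case \<open>h = 1\<close>.\<close>

lemma smooth_mass_upto:
  fixes h :: "nat \<Rightarrow> complex"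
  shows "measure_pmf.expectation (smooth_pmf n) (\<lambda>m. h m * indicator {..n} m)
     = of_real (\<Prod>p\<in>primes_le n. 1 - 1 / real p) * (\<Sum>k=1..n. h k / of_nat k)"
proof -
  have z: "pmf (smooth_pmf n) 0 = 0"
    by (auto simp: pmf_eq_0_set_pmf smooth_pmf_def) (metis less_irrefl prime_power_product_pos)
  have "measure_pmf.expectation (smooth_pmf n) (\<lambda>m. h m * indicator {..n} m)
     = (\<Sum>m\<in>{..n}. pmf (smooth_pmf n) m *\<^sub>R (h m * indicator {..n} m))"
    by (rule integral_measure_pmf) (auto simp: indicator_def split: if_splits)
  also have "\<dots> = (\<Sum>m=1..n. pmf (smooth_pmf n) m *\<^sub>R h m)"
    using z by (intro sum.mono_neutral_cong_right) (auto simp: not_less_eq_eq)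
  also have "\<dots> = (\<Sum>k=1..n. of_real (\<Prod>p\<in>primes_le n. 1 - 1 / real p) * (h k / of_nat k))"
    by (intro sum.cong refl) (auto simp: pmf_smooth(2) scaleR_conv_of_real)
  finally show ?thesis by (simp only: sum_distrib_left)
qed

text \<open>The point probabilities are at most \<open>c / m\<close>, so the mass is at most \<open>c \<delta> ln n\<close>. The same
  constant satisfies \<open>c ln n \<le> c * harm n \<le> 1\<close>, since \<open>c * harm n\<close> is the probability of being at most \<open>n\<close>.\<close>

lemma smooth_mass_near_threshold:
  assumes n: "n \<ge> 2" and d: "\<delta> > 0"
  shows "measure (measure_pmf (smooth_pmf n)) {m. n < m \<and> ln (real m) \<le> (1 + \<delta>) * ln (real n)} \<le> \<delta>"
proof -
  define c where "c = (\<Prod>p\<in>primes_le n. 1 - 1 / real p)"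
  have c0: "c \<ge> 0" unfolding c_def by (intro prod_nonneg) (auto simp: primes_le_def dest: prime_ge_1_nat)
  have L: "ln (real n) > 0" using n by simp
  define N where "N = nat \<lfloor>exp ((1 + \<delta>) * ln (real n))\<rfloor>"
  have "real n = exp (ln (real n))" using n by simp
  also have "\<dots> \<le> exp ((1 + \<delta>) * ln (real n))" using d L by simp
  finally have nN: "n \<le> N" unfolding N_def by (simp add: le_nat_iff le_floor_iff)
  have "real N \<le> exp ((1 + \<delta>) * ln (real n))" unfolding N_def by (simp add: of_nat_floor)
  then have lnN: "ln (real N) \<le> (1 + \<delta>) * ln (real n)"
    using nN n ln_mono[of "real N" "exp ((1 + \<delta>) * ln (real n))"] by simp
  have sub: "{m. n < m \<and> ln (real m) \<le> (1 + \<delta>) * ln (real n)} \<subseteq> {n<..N}"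
  proof
    fix m assume "m \<in> {m. n < m \<and> ln (real m) \<le> (1 + \<delta>) * ln (real n)}"
    then have m: "n < m" "ln (real m) \<le> (1 + \<delta>) * ln (real n)" by auto
    have "real m = exp (ln (real m))" using m by simp
    also have "\<dots> \<le> exp ((1 + \<delta>) * ln (real n))" using m by (simp only: exp_le_cancel_iff)
    finally have "m \<le> N" unfolding N_def by (rule le_nat_floor)
    then show "m \<in> {n<..N}" using m by simp
  qed
  have "c * ln (real n) \<le> 1"
  proof -
    have "ln (real n) \<le> ln (real n + 1)" using n by simp
    also have "\<dots> \<le> harm n" by (rule ln_le_harm)
    finally have "c * ln (real n) \<le> c * harm n" using c0 by (rule mult_left_mono)
    also have "c * harm n = (\<Sum>k=1..n. pmf (smooth_pmf n) k)"
      unfolding harm_def sum_distrib_left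
      by (intro sum.cong refl) (auto simp: pmf_smooth(2) c_def divide_inverse)
    also have "\<dots> \<le> 1" by (simp add: measure_measure_pmf_finite[symmetric])
    finally show ?thesis .
  qed
  have "measure (measure_pmf (smooth_pmf n)) {m. n < m \<and> ln (real m) \<le> (1 + \<delta>) * ln (real n)}
      \<le> measure (measure_pmf (smooth_pmf n)) {n<..N}"
    by (intro measure_pmf.finite_measure_mono sub) auto
  also have "\<dots> = (\<Sum>m\<in>{n<..N}. pmf (smooth_pmf n) m)" by (simp add: measure_measure_pmf_finite)
  also have "\<dots> \<le> (\<Sum>m\<in>{n<..N}. c * (1 / real m))"
    unfolding c_def by (intro sum_mono) (use pmf_smooth(1) in auto)
  also have "\<dots> = c * (\<Sum>m\<in>{n<..N}. 1 / real m)" by (simp only: sum_distrib_left)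
  also have "\<dots> \<le> c * (ln (real N) - ln (real n))"
    using n nN c0 by (intro mult_left_mono harm_diff_le_ln) auto
  also have "\<dots> \<le> c * (\<delta> * ln (real n))" using lnN c0 by (intro mult_left_mono) (auto simp: algebra_simps)
  also have "\<dots> = \<delta> * (c * ln (real n))" by simp
  also have "\<dots> \<le> \<delta> * 1" using \<open>c * ln (real n) \<le> 1\<close> d by (intro mult_left_mono) auto
  finally show ?thesis by simp
qed

lemma char_harmonic_distributed:
  assumes H: "harmonic_distributed N n H" and n: "n \<ge> 1"
  shows "char (distr N borel (\<lambda>\<omega>. X (H \<omega>))) t = (\<Sum>k=1..n. iexp (t * X k) / of_nat k) / of_real (harm n)"
proof -
  interpret prob_space N using H by (simp add: harmonic_distributed_def)
  have Hm[measurable]: "H \<in> measurable N (count_space UNIV)" using H by (simp add: harmonic_distributed_def)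
  have P: "prob {\<omega> \<in> space N. H \<omega> = k} = 1 / (real k * harm n)" if "k \<in> {1..n}" for k
    using H that by (simp add: harmonic_distributed_def)
  define E where "E = (\<lambda>k. {\<omega> \<in> space N. H \<omega> = k})"
  have Ev: "E k \<in> events" for k unfolding E_def by measurable
  have hpos: "(harm n :: real) > 0" using n by (intro harm_pos) auto
  have "prob (\<Union>k\<in>{1..n}. E k) = (\<Sum>k\<in>{1..n}. prob (E k))"
    using Ev by (intro finite_measure_finite_Union) (auto simp: disjoint_family_on_def E_def)
  also have "\<dots> = (\<Sum>k\<in>{1..n}. inverse (real k) / harm n)"
    by (intro sum.cong refl) (simp add: E_def P divide_simps)
  also have "\<dots> = 1" using hpos by (simp add: harm_def flip: sum_divide_distrib)
  finally have "prob (\<Union>k\<in>{1..n}. E k) = 1" .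
  then have AE: "AE \<omega> in N. \<omega> \<in> (\<Union>k\<in>{1..n}. E k)" using Ev by (subst prob_eq_1[symmetric]) auto
  have "char (distr N borel (\<lambda>\<omega>. X (H \<omega>))) t = (\<integral>\<omega>. iexp (t * X (H \<omega>)) \<partial>N)"
    unfolding char_def by (subst integral_distr) auto
  also have "\<dots> = (\<integral>\<omega>. (\<Sum>k=1..n. indicator (E k) \<omega> *\<^sub>R iexp (t * X k)) \<partial>N)"
  proof (rule integral_cong_AE)
    show "AE \<omega> in N. iexp (t * X (H \<omega>)) = (\<Sum>k=1..n. indicator (E k) \<omega> *\<^sub>R iexp (t * X k))"
      using AE
    proof eventually_elim
      case (elim \<omega>)
      then obtain j where j: "j \<in> {1..n}" "\<omega> \<in> E j" by auto
      have "(\<Sum>k=1..n. indicator (E k) \<omega> *\<^sub>R iexp (t * X k)) = (\<Sum>k=1..n. if k = j then iexp (t * X k) else 0)"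
        using j(2) by (intro sum.cong) (auto simp: E_def indicator_def)
      also have "\<dots> = iexp (t * X j)" using j(1) by (subst sum.delta) auto
      finally show ?case using j(2) by (simp add: E_def)
    qed
    show "(\<lambda>\<omega>. \<Sum>k=1..n. indicator (E k) \<omega> *\<^sub>R iexp (t * X k)) \<in> borel_measurable N"
      using Ev by (intro borel_measurable_sum borel_measurable_scaleR borel_measurable_indicator) auto
  qed measurable
  also have "\<dots> = (\<Sum>k=1..n. \<integral>\<omega>. indicator (E k) \<omega> *\<^sub>R iexp (t * X k) \<partial>N)"
    using Ev by (intro Bochner_Integration.integral_sum integrable_scaleR_left) (auto simp: emeasure_eq_measure)
  also have "\<dots> = (\<Sum>k=1..n. (iexp (t * X k) / of_nat k) / of_real (harm n))"
  proof (intro sum.cong refl)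
    fix k assume k: "k \<in> {1..n}"
    have "(\<integral>\<omega>. indicator (E k) \<omega> *\<^sub>R iexp (t * X k) \<partial>N) = prob (E k) *\<^sub>R iexp (t * X k)"
      using Ev[of k] by (subst integral_scaleR_left) (auto simp: emeasure_eq_measure)
    also have "\<dots> = (iexp (t * X k) / of_nat k) / of_real (harm n)"
      using P[OF k] by (simp add: E_def scaleR_conv_of_real)
    finally show "(\<integral>\<omega>. indicator (E k) \<omega> *\<^sub>R iexp (t * X k) \<partial>N) = (iexp (t * X k) / of_nat k) / of_real (harm n)" .
  qed
  finally show ?thesis by (simp only: sum_divide_distrib)
qed

text \<open>A variable with mean \<open>1\<close> cannot exceed \<open>1\<close> almost surely.\<close>

lemma prob_power_integral_le_1_pos:
  assumes prm: "poisson_random_measure M intensity \<eta>"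
  shows "measure M {\<omega> \<in> space M. power_integral (\<eta> \<omega>) 1 \<le> 1} > 0"
proof (rule ccontr)
  interpret prob_space M using prm by (simp add: poisson_random_measure_def)
  note [measurable] = power_integral_mean(1)[OF prm]
  assume "\<not> ?thesis"
  then have "prob {\<omega> \<in> space M. power_integral (\<eta> \<omega>) 1 \<le> 1} = 0" by (simp add: zero_less_measure_iff)
  then have AE: "AE \<omega> in M. \<not> power_integral (\<eta> \<omega>) 1 \<le> 1"
    by (subst (asm) prob_eq_0) (auto elim: eventually_mono)
  have "(\<integral>\<^sup>+\<omega>. power_integral (\<eta> \<omega>) 1 \<partial>M) = (\<integral>\<^sup>+ x. indicator {0<..1::real} x \<partial>lborel)"
    unfolding power_integral_mean(2)[OF prm]
    by (intro nn_integral_cong) (auto simp: indicator_def)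
  also have "\<dots> = 1" by simp
  finally have one: "(\<integral>\<^sup>+\<omega>. power_integral (\<eta> \<omega>) 1 \<partial>M) = 1" .
  have "(\<integral>\<^sup>+\<omega>. 1 \<partial>M) < (\<integral>\<^sup>+\<omega>. power_integral (\<eta> \<omega>) 1 \<partial>M)"
  proof (rule nn_integral_less)
    show "AE \<omega> in M. 1 \<le> power_integral (\<eta> \<omega>) 1" using AE by eventually_elim auto
    show "\<not> (AE \<omega> in M. power_integral (\<eta> \<omega>) 1 \<le> 1)"
    proof
      assume "AE \<omega> in M. power_integral (\<eta> \<omega>) 1 \<le> 1"
      with AE have "AE \<omega> in M. False" by eventually_elim auto
      then show False by (simp add: AE_False emeasure_space_1)
    qed
  qed (auto simp: emeasure_space_1)
  then show False using one by (simp add: emeasure_space_1)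
qed

text \<open>Conditioning on an event of positive probability divides the restricted expectation by that
  probability.\<close>

lemma char_conditional_limit_law:
  assumes prm: "poisson_random_measure M intensity \<eta>"
  shows "real_distribution (conditional_limit_law M \<eta> \<alpha>)"
    and "char (conditional_limit_law M \<eta> \<alpha>) t =
      (\<integral>\<omega>. iexp (t * enn2real (power_integral (\<eta> \<omega>) \<alpha>)) * indicator {\<omega> \<in> space M. power_integral (\<eta> \<omega>) 1 \<le> 1} \<omega> \<partial>M)
        / of_real (measure M {\<omega> \<in> space M. power_integral (\<eta> \<omega>) 1 \<le> 1})"
proof -
  interpret prob_space M using prm by (simp add: poisson_random_measure_def)
  note [measurable] = power_integral_mean(1)[OF prm]
  define B where "B = {\<omega> \<in> space M. power_integral (\<eta> \<omega>) 1 \<le> 1}"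
  have B: "B \<in> events" unfolding B_def by measurable
  have pos: "prob B > 0" unfolding B_def by (rule prob_power_integral_le_1_pos[OF prm])
  let ?X = "\<lambda>\<omega>. enn2real (power_integral (\<eta> \<omega>) \<alpha>)"
  have ps: "prob_space (uniform_measure M B)"
    using pos by (intro prob_space_uniform_measure) (auto simp: emeasure_eq_measure)
  have Xm: "?X \<in> borel_measurable (uniform_measure M B)" by measurable
  show "real_distribution (conditional_limit_law M \<eta> \<alpha>)"
    unfolding conditional_limit_law_def B_def[symmetric]
    using prob_space.real_distribution_distr[OF ps Xm] .
  have "char (conditional_limit_law M \<eta> \<alpha>) t = (\<integral>\<omega>. iexp (t * ?X \<omega>) \<partial>uniform_measure M B)"
    unfolding char_def conditional_limit_law_def B_def[symmetric] by (subst integral_distr) auto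
  also have "uniform_measure M B = density M (\<lambda>\<omega>. ennreal (indicator B \<omega> / prob B))"
    unfolding uniform_measure_def
  proof (intro density_cong)
    show "AE \<omega> in M. indicator B \<omega> / emeasure M B = ennreal (indicator B \<omega> / prob B)"
      using pos by (auto simp: emeasure_eq_measure indicator_def divide_ennreal simp flip: ennreal_1)
  qed (use B in auto)
  also have "(\<integral>\<omega>. iexp (t * ?X \<omega>) \<partial>density M (\<lambda>\<omega>. ennreal (indicator B \<omega> / prob B))) =
      (\<integral>\<omega>. (indicator B \<omega> / prob B) *\<^sub>R iexp (t * ?X \<omega>) \<partial>M)"
    using B by (intro integral_density) auto
  also have "\<dots> = (\<integral>\<omega>. iexp (t * ?X \<omega>) * indicator B \<omega> / of_real (prob B) \<partial>M)"
    by (intro Bochner_Integration.integral_cong refl) (simp add: scaleR_conv_of_real indicator_def)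
  also have "\<dots> = (\<integral>\<omega>. iexp (t * ?X \<omega>) * indicator B \<omega> \<partial>M) / of_real (prob B)"
    by (rule integral_divide_zero)
  finally show "char (conditional_limit_law M \<eta> \<alpha>) t =
      (\<integral>\<omega>. iexp (t * ?X \<omega>) * indicator {\<omega> \<in> space M. power_integral (\<eta> \<omega>) 1 \<le> 1} \<omega> \<partial>M)
        / of_real (prob {\<omega> \<in> space M. power_integral (\<eta> \<omega>) 1 \<le> 1})" by (simp add: B_def)
qed

text \<open>With \<open>U = exp(- ln m / ln n)\<close> the event \<open>m \<le> n\<close> is \<open>U \<ge> exp(-1)\<close>, and the \<open>k\<close>-th moments of \<open>U\<close> are
  the transforms computed for the smooth integers and for the Poisson integrals. The interval of values
  just below \<open>exp(-1)\<close> corresponds to integers between \<open>n\<close> and a slightly larger power of \<open>n\<close>.\<close>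

lemma restricted_transform_tendsto:
  assumes V: "\<theta> \<in> class_V" and \<alpha>: "\<alpha> > 0" and rv: "regularly_varying \<theta> \<alpha>"
    and prm: "poisson_random_measure M intensity \<eta>"
  shows "(\<lambda>n. of_real (\<Prod>p\<in>primes_le n. 1 - 1 / real p) * (\<Sum>k=1..n. iexp (t * (induced \<theta> k / \<theta> (ln (real n)))) / of_nat k))
    \<longlonglongrightarrow> (\<integral>\<omega>. iexp (t * enn2real (power_integral (\<eta> \<omega>) \<alpha>)) * indicator {\<omega> \<in> space M. power_integral (\<eta> \<omega>) 1 \<le> 1} \<omega> \<partial>M)"
proof -
  interpret prob_space M using prm by (simp add: poisson_random_measure_def)
  note [measurable] = power_integral_mean(1)[OF prm]
  define \<xi> where "\<xi> = (\<lambda>n m. iexp (t * (induced \<theta> m / \<theta> (ln (real n)))))"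
  define U where "U = (\<lambda>n m. exp (- (ln (real m) / ln (real n))))"
  define \<xi>' where "\<xi>' = (\<lambda>\<omega>. iexp (t * enn2real (power_integral (\<eta> \<omega>) \<alpha>)))"
  define U' where "U' = (\<lambda>\<omega>. exp (- enn2real (power_integral (\<eta> \<omega>) 1)))"
  have nn: "ln (real m) \<ge> 0" for m :: nat by (cases "m = 0") auto
  have U01: "0 \<le> U n m" "U n m \<le> 1" for n m using nn[of m] nn[of n] by (auto simp: U_def)
  have key: "(\<lambda>n. measure_pmf.expectation (smooth_pmf n) (\<lambda>m. \<xi> n m * indicator {exp (- 1)..} (U n m)))
      \<longlonglongrightarrow> (\<integral>\<omega>. \<xi>' \<omega> * indicator {exp (- 1)..} (U' \<omega>) \<partial>M)"
  proof (rule threshold_convergence)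
    show "(\<lambda>n. measure_pmf.expectation (smooth_pmf n) (\<lambda>m. \<xi> n m * of_real (U n m) ^ k))
      \<longlonglongrightarrow> (\<integral>\<omega>. \<xi>' \<omega> * of_real (U' \<omega>) ^ k \<partial>M)" for k
      unfolding \<xi>_def U_def \<xi>'_def U'_def poisson_joint_transform[OF prm \<alpha>]
      by (rule smooth_expectation_tendsto[OF V rv])
  next
    fix e :: real assume e: "e > 0"
    show "\<exists>b<exp (- 1). \<forall>\<^sub>F n in sequentially. measure (measure_pmf (smooth_pmf n)) {x \<in> space (measure_pmf (smooth_pmf n)). b < U n x \<and> U n x < exp (- 1)} \<le> e"
    proof (intro exI[of _ "exp (- (1 + e))"] conjI)
      show "\<forall>\<^sub>F n in sequentially. measure (measure_pmf (smooth_pmf n)) {x \<in> space (measure_pmf (smooth_pmf n)). exp (- (1 + e)) < U n x \<and> U n x < exp (- 1)} \<le> e"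
        using eventually_ge_at_top[of 2]
      proof eventually_elim
        case (elim n)
        then have L: "ln (real n) > 0" by simp
        have "{x \<in> space (measure_pmf (smooth_pmf n)). exp (- (1 + e)) < U n x \<and> U n x < exp (- 1)}
            \<subseteq> {m. n < m \<and> ln (real m) \<le> (1 + e) * ln (real n)}"
        proof
          fix m assume "m \<in> {x \<in> space (measure_pmf (smooth_pmf n)). exp (- (1 + e)) < U n x \<and> U n x < exp (- 1)}"
          then have "ln (real m) / ln (real n) < 1 + e" "1 < ln (real m) / ln (real n)" by (auto simp: U_def)
          then have m: "ln (real m) < (1 + e) * ln (real n)" "ln (real n) < ln (real m)" using L by (auto simp: field_simps)
          moreover have "m > 0" using m L by (cases "m = 0") auto
          ultimately show "m \<in> {m. n < m \<and> ln (real m) \<le> (1 + e) * ln (real n)}" using elim by auto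
        qed
        then have "measure (measure_pmf (smooth_pmf n)) {x \<in> space (measure_pmf (smooth_pmf n)). exp (- (1 + e)) < U n x \<and> U n x < exp (- 1)}
           \<le> measure (measure_pmf (smooth_pmf n)) {m. n < m \<and> ln (real m) \<le> (1 + e) * ln (real n)}"
          by (intro measure_pmf.finite_measure_mono) auto
        also have "\<dots> \<le> e" by (rule smooth_mass_near_threshold[OF elim e])
        finally show ?case .
      qed
    qed (use e in auto)
  next
    show "U' \<omega> \<in> {0..1}" for \<omega> by (simp add: U'_def)
    show "\<xi>' \<in> borel_measurable M" "U' \<in> borel_measurable M" unfolding \<xi>'_def U'_def by measurable
  qed (auto simp: \<xi>_def \<xi>'_def prob_space_measure_pmf prob_space_axioms intro: U01)
  have "(\<integral>\<omega>. \<xi>' \<omega> * indicator {exp (- 1)..} (U' \<omega>) \<partial>M)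
    = (\<integral>\<omega>. \<xi>' \<omega> * indicator {\<omega> \<in> space M. power_integral (\<eta> \<omega>) 1 \<le> 1} \<omega> \<partial>M)"
  proof (rule integral_cong_AE)
    show "AE \<omega> in M. \<xi>' \<omega> * indicator {exp (- 1)..} (U' \<omega>) = \<xi>' \<omega> * indicator {\<omega> \<in> space M. power_integral (\<eta> \<omega>) 1 \<le> 1} \<omega>"
      using power_integral_AE_finite[OF prm zero_less_one] AE_space
    proof eventually_elim
      case (elim \<omega>)
      then obtain y where y: "power_integral (\<eta> \<omega>) 1 = ennreal y" "y \<ge> 0"
        by (cases "power_integral (\<eta> \<omega>) 1") auto
      then have "exp (- 1) \<le> U' \<omega> \<longleftrightarrow> power_integral (\<eta> \<omega>) 1 \<le> 1"
        by (simp add: U'_def ennreal_le_iff flip: ennreal_1)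
      then show ?case using elim(2) by (simp add: indicator_def)
    qed
  qed (auto simp: \<xi>'_def U'_def)
  moreover have "\<forall>\<^sub>F n in sequentially. measure_pmf.expectation (smooth_pmf n) (\<lambda>m. \<xi> n m * indicator {exp (- 1)..} (U n m))
    = of_real (\<Prod>p\<in>primes_le n. 1 - 1 / real p) * (\<Sum>k=1..n. iexp (t * (induced \<theta> k / \<theta> (ln (real n)))) / of_nat k)"
    using eventually_ge_at_top[of 2]
  proof eventually_elim
    case (elim n)
    then have L: "ln (real n) > 0" by simp
    have "exp (- 1) \<le> U n m \<longleftrightarrow> m \<le> n" for m
    proof (cases "m = 0")
      case False
      have "exp (- 1) \<le> U n m \<longleftrightarrow> ln (real m) \<le> ln (real n)" using L by (simp add: U_def)
      then show ?thesis using False elim by simp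
    qed (simp add: U_def)
    then have "indicator {exp (- 1)..} (U n m) = (indicator {..n} m :: complex)" for m by (simp add: indicator_def)
    then show ?case using smooth_mass_upto[of n "\<xi> n"] by (simp add: \<xi>_def)
  qed
  ultimately show ?thesis using Lim_transform_eventually[OF key] by (simp add: \<xi>'_def)
qed

theorem theorem3p1:
  fixes \<theta> :: "real \<Rightarrow> real" and \<alpha> :: real
    and N :: "nat \<Rightarrow> 'b measure" and H :: "nat \<Rightarrow> 'b \<Rightarrow> nat"
    and M :: "'w measure" and \<eta> :: "'w \<Rightarrow> (real \<times> real) measure"
  assumes "\<theta> \<in> class_V"
    and "\<alpha> > 0" and "regularly_varying \<theta> \<alpha>"
    and "\<And>n. n \<ge> 1 \<Longrightarrow> harmonic_distributed (N n) n (H n)"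
    and "poisson_random_measure M intensity \<eta>"
  shows "weak_conv_m
           (\<lambda>n. distr (N n) borel (\<lambda>\<omega>. induced \<theta> (H n \<omega>) / \<theta> (ln (real n))))
           (conditional_limit_law M \<eta> \<alpha>)"
proof -
  note V = assms(1) and \<alpha> = assms(2) and rv = assms(3) and H = assms(4) and prm = assms(5)
  interpret prob_space M using prm by (simp add: poisson_random_measure_def)
  define D where "D = (\<lambda>n. distr (N n) borel (\<lambda>\<omega>. induced \<theta> (H n \<omega>) / \<theta> (ln (real n))))"
  define B where "B = {\<omega> \<in> space M. power_integral (\<eta> \<omega>) 1 \<le> 1}"
  define c where "c = (\<lambda>n. \<Prod>p\<in>primes_le n. 1 - 1 / real p)"
  define A where "A = (\<lambda>t n. of_real (c n) * (\<Sum>k=1..n. iexp (t * (induced \<theta> k / \<theta> (ln (real n)))) / of_nat k))"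
  define A' where "A' = (\<lambda>t. \<integral>\<omega>. iexp (t * enn2real (power_integral (\<eta> \<omega>) \<alpha>)) * indicator B \<omega> \<partial>M)"
  have AA: "A t \<longlonglongrightarrow> A' t" for t
    unfolding A_def A'_def B_def c_def by (rule restricted_transform_tendsto[OF V \<alpha> rv prm])
  have B: "B \<in> events" unfolding B_def using power_integral_mean(1)[OF prm, of 1] by measurable
  have pos: "prob B > 0" unfolding B_def by (rule prob_power_integral_le_1_pos[OF prm])
  have A'0: "A' 0 = of_real (prob B)"
  proof -
    have "A' 0 = (\<integral>\<omega>. of_real (indicator B \<omega>) \<partial>M)"
      unfolding A'_def by (intro Bochner_Integration.integral_cong refl) (simp add: indicator_def)
    also have "\<dots> = of_real (prob B)" using B by simp
    finally show ?thesis .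
  qed
  have cpos: "c n > 0" for n
    unfolding c_def by (intro prod_pos) (auto simp: primes_le_def dest: prime_gt_1_nat)
  have chars: "char (D (Suc n)) t = A t (Suc n) / A 0 (Suc n)" for n t
  proof -
    have "A 0 (Suc n) = of_real (c (Suc n)) * of_real (harm (Suc n))"
      by (simp add: A_def harm_def inverse_eq_divide)
    then show ?thesis
      unfolding D_def using char_harmonic_distributed[OF H, of "Suc n" "\<lambda>k. induced \<theta> k / \<theta> (ln (real (Suc n)))" t] cpos[of "Suc n"]
      by (simp add: A_def)
  qed
  \<comment> \<open>The measure at index \<open>0\<close> is arbitrary, hence the shift by one.\<close>
  have "weak_conv_m (\<lambda>n. D (Suc n)) (conditional_limit_law M \<eta> \<alpha>)"
  proof (rule levy_continuity)
    show "real_distribution (D (Suc n))" for n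
    proof -
      interpret Nn: prob_space "N (Suc n)" using H[of "Suc n"] by (simp add: harmonic_distributed_def)
      have Hm: "H (Suc n) \<in> measurable (N (Suc n)) (count_space UNIV)" using H[of "Suc n"] by (simp add: harmonic_distributed_def)
      then show ?thesis unfolding D_def
        by (intro Nn.real_distribution_distr measurable_compose[OF Hm]) simp
    qed
    show "real_distribution (conditional_limit_law M \<eta> \<alpha>)" by (rule char_conditional_limit_law(1)[OF prm])
    fix t
    have "(\<lambda>n. A t n / A 0 n) \<longlonglongrightarrow> A' t / A' 0"
      using pos by (intro tendsto_divide AA) (simp add: A'0)
    moreover have "char (conditional_limit_law M \<eta> \<alpha>) t = A' t / A' 0"
      using char_conditional_limit_law(2)[OF prm, of \<alpha> t] by (simp add: A'0) (simp add: A'_def B_def)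
    ultimately show "(\<lambda>n. char (D (Suc n)) t) \<longlonglongrightarrow> char (conditional_limit_law M \<eta> \<alpha>) t"
      unfolding chars using LIMSEQ_Suc[of "\<lambda>n. A t n / A 0 n"] by simp
  qed
  then show ?thesis
    unfolding weak_conv_m_def weak_conv_def D_def by (auto intro: LIMSEQ_imp_Suc)
qed

end
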